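(* Let $\phi: M^2 \rightarrow \mathbb{C}^2$ be a Lagrangian translating soliton for mean curvature flow with translating vector $\mathbf{e}$. Assume that there exists a local isothermal coordinate $z=x+iy$ on $M$ such that the smooth complex function $(\phi,\mathbf{e})$ satisfies $\frac{\partial^2}{\partial x\,\partial y}(\phi,\mathbf{e})=0$. Then $\phi$ is, up to dilations, locally congruent to one of the following: (i) the product of a grim-reaper curve and a straight line, i.e. $(s_1,s_2)\in\mathbb{R}^2\mapsto(\gamma(s_1),s_2)\in\mathbb{C}^2$; (ii) the product of two grim-reaper curves, i.e. $(s_1,s_2)\in\mathbb{R}^2\mapsto(\gamma(s_1),\gamma(s_2))\in\mathbb{C}^2$ (equivalently, up to dilation and congruence, $(s_1,s_2)\mapsto(\gamma(s_1)+\gamma(s_2),\gamma(s_1)-\gamma(s_2))$); (iii) one of the maps $\alpha\ast\omega$, for some $\varphi\in[0,\pi)$ and some unit speed planar curves $\alpha,\omega$ satisfying $\overrightarrow{\kappa_\alpha}=-\cos\varphi\,\alpha^\perp+\sin\varphi\,(J\alpha)^\perp$ and $\overrightarrow{\kappa_\omega}=\cos\varphi\,\omega^\perp-\sin\varphi\,(J\omega)^\perp$. Here the grim-reaper curve $\gamma$ and the maps $\alpha\ast\omega$ are as defined in the context.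
   Context: On $\mathbb{C}^2\equiv\mathbb{R}^4$ let $(z,w)=z_1\bar w_1+z_2\bar w_2$ be the Hermitian product, $\langle\cdot,\cdot\rangle=\mathrm{Re}(\cdot,\cdot)$ the Euclidean metric, $J$ the complex structure (multiplication by $i$), and $-\mathrm{Im}(\cdot,\cdot)=\langle J\cdot,\cdot\rangle$ the Kähler form. An immersion $\phi:M\to\mathbb{C}^2$ of a surface $M$ (with the induced metric) is Lagrangian if the Kähler form pulls back to $0$. Its mean curvature vector is $H=\mathrm{trace}\,\sigma=\Delta\phi$, with $\sigma$ the second fundamental form and $\Delta$ the Laplacian of the induced metric. $\phi$ is a translating soliton for mean curvature flow with translating vector $\mathbf{e}$ if $\mathbf{e}\in\mathbb{R}^4$ is a nonzero constant vector with $H=\mathbf{e}^\perp$, the normal projection of $\mathbf{e}$. An isothermal coordinate $z=x+iy$ is one in which the induced metric is $e^{2u}(dx^2+dy^2)$. Congruent means related by a rigid motion of $\mathbb{C}^2$. Grim-reaper curve: $\gamma(s)=\log\cosh s+2i\arctan(\tanh(s/2))$, $s\in\mathbb{R}$ (a unit speed curve in $\mathbb{C}\equiv\mathbb{R}^2$). For a unit speed planar curve $\alpha$ in $\mathbb{C}$, $J$ is multiplication by $i$, the curvature $\kappa_\alpha$ is given by $\alpha''=\kappa_\alpha J\alpha'$, the curvature vector is $\overrightarrow{\kappa_\alpha}=\kappa_\alpha J\alpha'$, and $\perp$ denotes the component normal to the curve. The maps $\alpha\ast\omega$: let $\varphi\in[0,\pi)$, and let $\alpha=\alpha(t)$, $t\in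 I_1$, and $\omega=\omega(s)$, $s\in I_2$ ($I_1,I_2$ intervals of $\mathbb{R}$) be unit speed planar curves with $\overrightarrow{\kappa_\alpha}=-\cos\varphi\,\alpha^\perp+\sin\varphi\,(J\alpha)^\perp$ and $\overrightarrow{\kappa_\omega}=\cos\varphi\,\omega^\perp-\sin\varphi\,(J\omega)^\perp$. Write $'$ for $d/dt$ and $\dot{}$ for $d/ds$, let $\arg$ denote continuous determinations of the argument, and fix $t_0\in I_1$, $s_0\in I_2$. Then $\alpha\ast\omega:I_1\times I_2\to\mathbb{C}^2$ is defined, for $\varphi\neq\pi/2$, by $$(\alpha\ast\omega)(t,s)=\left(\frac{|\omega(s)|^2-|\alpha(t)|^2}{2\cos\varphi}+(\tan\varphi-i)(\arg\alpha'(t)+\arg\dot\omega(s)),\ \alpha(t)\omega(s)\right)$$ and, for $\varphi=\pi/2$, by $$(\alpha\ast\omega)(t,s)=\left(\int_{t_0}^t\langle\alpha',J\alpha\rangle(x)\,dx-\int_{s_0}^s\langle\dot\omega,J\omega\rangle(y)\,dy-i(\arg\alpha'(t)+\arg\dot\omega(s)),\ \alpha(t)\omega(s)\right).$$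
   Formalization: In (ii) the two grim-reaper factors may have different scales: the model is (γ(s1), rγ(s2)) for some r>0 instead of (γ(s1), γ(s2)), because e.g. (γ(s1), 2γ(s2)) meets all hypotheses yet is none of the listed maps. *)

theory Defs
  imports "HOL-Analysis.Analysis"
begin

section \<open>Smooth maps on open sets of Euclidean spaces\<close>

fun Ck_on :: "nat \<Rightarrow> 'a::euclidean_space set \<Rightarrow> ('a \<Rightarrow> 'b::real_normed_vector) \<Rightarrow> bool" where
  "Ck_on 0 S f \<longleftrightarrow> continuous_on S f"
| "Ck_on (Suc k) S f \<longleftrightarrow>
     (\<forall>x\<in>S. f differentiable (at x)) \<and> (\<forall>v. Ck_on k S (\<lambda>x. frechet_derivative f (at x) v))"

text \<open>Only used for open \<open>S\<close>.\<close>

definition smooth_on :: "'a::euclidean_space set \<Rightarrow> ('a \<Rightarrow> 'b::real_normed_vector) \<Rightarrow> bool" where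
  "smooth_on S f \<longleftrightarrow> (\<forall>k. Ck_on k S f)"

definition pd :: "'a::euclidean_space \<Rightarrow> ('a \<Rightarrow> 'b::real_normed_vector) \<Rightarrow> 'a \<Rightarrow> 'b" where
  "pd v f z = frechet_derivative f (at z) v"

abbreviation pd_x :: "(real \<times> real \<Rightarrow> 'b::real_normed_vector) \<Rightarrow> real \<times> real \<Rightarrow> 'b" where
  "pd_x \<equiv> pd (1, 0)"

abbreviation pd_y :: "(real \<times> real \<Rightarrow> 'b::real_normed_vector) \<Rightarrow> real \<times> real \<Rightarrow> 'b" where
  "pd_y \<equiv> pd (0, 1)"


section \<open>Smooth surfaces\<close>

type_synonym 'm chart = "'m set \<times> ('m \<Rightarrow> real \<times> real)"

fun is_chart :: "'m::topological_space set \<Rightarrow> 'm chart \<Rightarrow> bool" where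
  "is_chart M (U, \<psi>) \<longleftrightarrow> open U \<and> U \<subseteq> M \<and> open (\<psi> ` U) \<and> homeomorphism U (\<psi> ` U) \<psi> (inv_into U \<psi>)"

fun chart_compatible :: "'m chart \<Rightarrow> 'm chart \<Rightarrow> bool" where
  "chart_compatible (U, \<psi>) (V, \<eta>) \<longleftrightarrow>
     smooth_on (\<psi> ` (U \<inter> V)) (\<eta> \<circ> inv_into U \<psi>) \<and> smooth_on (\<eta> ` (U \<inter> V)) (\<psi> \<circ> inv_into V \<eta>)"

text \<open>The atlas is maximal, so its members are exactly the local coordinates of the surface.
  The Hausdorff and second countability axioms come from the type class of the points.\<close>

definition smooth_surface ::
  "'m::{t2_space, second_countable_topology} set \<Rightarrow> 'm chart set \<Rightarrow> bool" where
  "smooth_surface M atl \<longleftrightarrow>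
     (\<forall>c\<in>atl. is_chart M c) \<and>
     (\<Union>c\<in>atl. fst c) = M \<and>
     (\<forall>c\<in>atl. \<forall>d\<in>atl. chart_compatible c d) \<and>
     (\<forall>c. is_chart M c \<and> (\<forall>d\<in>atl. chart_compatible c d) \<longrightarrow> c \<in> atl)"

fun local_rep :: "('m \<Rightarrow> 'b) \<Rightarrow> 'm chart \<Rightarrow> real \<times> real \<Rightarrow> 'b" where
  "local_rep \<phi> (U, \<psi>) = \<phi> \<circ> inv_into U \<psi>"

fun chart_dom :: "'m chart \<Rightarrow> (real \<times> real) set" where
  "chart_dom (U, \<psi>) = \<psi> ` U"


section \<open>The complex plane \<open>\<complex>\<^sup>2\<close>\<close>

text \<open>The Euclidean metric \<open>Re (v, w)\<close> is the library inner product on the product type.\<close>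

type_synonym C2 = "complex \<times> complex"

definition herm :: "C2 \<Rightarrow> C2 \<Rightarrow> complex" where
  "herm z w = fst z * cnj (fst w) + snd z * cnj (snd w)"

definition kaehler :: "C2 \<Rightarrow> C2 \<Rightarrow> real" where
  "kaehler v w = - Im (herm v w)"

definition cscale :: "complex \<Rightarrow> C2 \<Rightarrow> C2" where
  "cscale c v = (c * fst v, c * snd v)"

text \<open>Rigid motions of \<open>\<complex>\<^sup>2\<close>: a unitary map followed by a translation.\<close>

definition rigid_motion :: "(C2 \<Rightarrow> C2) \<Rightarrow> bool" where
  "rigid_motion F \<longleftrightarrow>
     (\<exists>A b. linear A \<and> (\<forall>c v. A (cscale c v) = cscale c (A v)) \<and>
        (\<forall>v w. herm (A v) (A w) = herm v w) \<and> (\<forall>v. F v = A v + b))"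

text \<open>Component of \<open>v\<close> orthogonal to the linear subspace \<open>T\<close>.\<close>

definition normal_component :: "'a::euclidean_space set \<Rightarrow> 'a \<Rightarrow> 'a" where
  "normal_component T v = (THE w. (\<forall>t\<in>T. w \<bullet> t = 0) \<and> v - w \<in> T)"


section \<open>Lagrangian immersions and translating solitons\<close>

definition tangent_plane :: "(real \<times> real \<Rightarrow> C2) \<Rightarrow> real \<times> real \<Rightarrow> C2 set" where
  "tangent_plane X z = range (\<lambda>v. pd v X z)"

definition metric :: "(real \<times> real \<Rightarrow> C2) \<Rightarrow> real \<times> real \<Rightarrow> real \<times> real \<Rightarrow> real \<times> real \<Rightarrow> real" where
  "metric X z v w = pd v X z \<bullet> pd w X z"

definition second_fund :: "(real \<times> real \<Rightarrow> C2) \<Rightarrow> real \<times> real \<Rightarrow> real \<times> real \<Rightarrow> real \<times> real \<Rightarrow> C2" where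
  "second_fund X z v w = normal_component (tangent_plane X z) (pd v (pd w X) z)"

text \<open>Trace of the second fundamental form, \<open>\<Sum>i j. g\<^sup>i\<^sup>j \<sigma>\<^sub>i\<^sub>j\<close>, with the inverse of the
  \<open>2 \<times> 2\<close> matrix \<open>g\<close> written out (and no factor \<open>1/2\<close>).\<close>

definition mean_curvature :: "(real \<times> real \<Rightarrow> C2) \<Rightarrow> real \<times> real \<Rightarrow> C2" where
  "mean_curvature X z =
     (let g11 = metric X z (1,0) (1,0); g12 = metric X z (1,0) (0,1); g22 = metric X z (0,1) (0,1)
      in (1 / (g11 * g22 - g12\<^sup>2)) *\<^sub>R
           (g22 *\<^sub>R second_fund X z (1,0) (1,0)
            - (2 * g12) *\<^sub>R second_fund X z (1,0) (0,1)
            + g11 *\<^sub>R second_fund X z (0,1) (0,1)))"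

definition immersion :: "'m chart set \<Rightarrow> ('m \<Rightarrow> C2) \<Rightarrow> bool" where
  "immersion atl \<phi> \<longleftrightarrow>
     (\<forall>c\<in>atl. smooth_on (chart_dom c) (local_rep \<phi> c) \<and>
        (\<forall>z\<in>chart_dom c. inj (\<lambda>v. pd v (local_rep \<phi> c) z)))"

definition lagrangian_immersion :: "'m chart set \<Rightarrow> ('m \<Rightarrow> C2) \<Rightarrow> bool" where
  "lagrangian_immersion atl \<phi> \<longleftrightarrow> immersion atl \<phi> \<and>
     (\<forall>c\<in>atl. \<forall>z\<in>chart_dom c. \<forall>v w.
        kaehler (pd v (local_rep \<phi> c) z) (pd w (local_rep \<phi> c) z) = 0)"

definition translating_soliton :: "'m chart set \<Rightarrow> ('m \<Rightarrow> C2) \<Rightarrow> C2 \<Rightarrow> bool" where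
  "translating_soliton atl \<phi> e \<longleftrightarrow> immersion atl \<phi> \<and> e \<noteq> 0 \<and>
     (\<forall>c\<in>atl. \<forall>z\<in>chart_dom c.
        mean_curvature (local_rep \<phi> c) z = normal_component (tangent_plane (local_rep \<phi> c) z) e)"

definition isothermal :: "('m \<Rightarrow> C2) \<Rightarrow> 'm chart \<Rightarrow> bool" where
  "isothermal \<phi> c \<longleftrightarrow>
     (\<exists>u :: real \<times> real \<Rightarrow> real. \<forall>z\<in>chart_dom c.
        metric (local_rep \<phi> c) z (1,0) (1,0) = exp (2 * u z) \<and>
        metric (local_rep \<phi> c) z (0,1) (0,1) = exp (2 * u z) \<and>
        metric (local_rep \<phi> c) z (1,0) (0,1) = 0)"

text \<open>Near \<open>p\<close>, the map \<open>\<phi>\<close> is a rigid motion of a dilation of the parametrized surface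
  \<open>\<Psi> : D \<rightarrow> \<complex>\<^sup>2\<close>. The reparametrization is a diffeomorphism from a neighbourhood of \<open>p\<close>
  onto an open part of \<open>D\<close>, that is, a chart of the maximal atlas.\<close>

definition locally_congruent_up_to_dilation ::
  "'m chart set \<Rightarrow> ('m \<Rightarrow> C2) \<Rightarrow> 'm \<Rightarrow> (real \<times> real) set \<Rightarrow> (real \<times> real \<Rightarrow> C2) \<Rightarrow> bool" where
  "locally_congruent_up_to_dilation atl \<phi> p D \<Psi> \<longleftrightarrow>
     (\<exists>V \<eta> F r. (V, \<eta>) \<in> atl \<and> p \<in> V \<and> \<eta> ` V \<subseteq> D \<and> rigid_motion F \<and> r > 0 \<and>
        (\<forall>q\<in>V. \<phi> q = F (r *\<^sub>R \<Psi> (\<eta> q))))"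

definition congruent_up_to_dilation ::
  "(real \<times> real \<Rightarrow> C2) \<Rightarrow> (real \<times> real \<Rightarrow> C2) \<Rightarrow> bool" where
  "congruent_up_to_dilation \<Phi> \<Psi> \<longleftrightarrow>
     (\<exists>F r. rigid_motion F \<and> r > 0 \<and> (\<forall>z. \<Phi> z = F (r *\<^sub>R \<Psi> z)))"


section \<open>Planar curves\<close>

definition grim_reaper :: "real \<Rightarrow> complex" where
  "grim_reaper s = complex_of_real (ln (cosh s)) + 2 * \<i> * complex_of_real (arctan (tanh (s / 2)))"

definition velocity :: "(real \<Rightarrow> complex) \<Rightarrow> real \<Rightarrow> complex" where
  "velocity \<alpha> t = vector_derivative \<alpha> (at t)"

definition unit_speed_curve :: "real set \<Rightarrow> (real \<Rightarrow> complex) \<Rightarrow> bool" where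
  "unit_speed_curve I \<alpha> \<longleftrightarrow> open I \<and> is_interval I \<and> smooth_on I \<alpha> \<and> (\<forall>t\<in>I. norm (velocity \<alpha> t) = 1)"

definition curvature :: "(real \<Rightarrow> complex) \<Rightarrow> real \<Rightarrow> real" where
  "curvature \<alpha> t = (THE k. velocity (velocity \<alpha>) t = complex_of_real k * (\<i> * velocity \<alpha> t))"

definition curvature_vector :: "(real \<Rightarrow> complex) \<Rightarrow> real \<Rightarrow> complex" where
  "curvature_vector \<alpha> t = complex_of_real (curvature \<alpha> t) * (\<i> * velocity \<alpha> t)"

definition curve_perp :: "(real \<Rightarrow> complex) \<Rightarrow> real \<Rightarrow> complex \<Rightarrow> complex" where
  "curve_perp \<alpha> t v = normal_component (span {velocity \<alpha> t}) v"

definition continuous_arg :: "real set \<Rightarrow> (real \<Rightarrow> complex) \<Rightarrow> (real \<Rightarrow> real) \<Rightarrow> bool" where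
  "continuous_arg I f a \<longleftrightarrow> continuous_on I a \<and> (\<forall>t\<in>I. f t = complex_of_real (norm (f t)) * cis (a t))"

text \<open>The map \<open>\<alpha> \<ast> \<omega>\<close>, where \<open>a\<close> and \<open>b\<close> are continuous determinations of the arguments of
  the velocities of \<open>\<alpha>\<close> and \<open>\<omega>\<close>. The interval integrals are oriented.\<close>

definition curve_star ::
  "real \<Rightarrow> (real \<Rightarrow> complex) \<Rightarrow> (real \<Rightarrow> complex) \<Rightarrow> (real \<Rightarrow> real) \<Rightarrow> (real \<Rightarrow> real) \<Rightarrow>
     real \<Rightarrow> real \<Rightarrow> real \<times> real \<Rightarrow> C2" where
  "curve_star \<theta> \<alpha> \<omega> a b t0 s0 = (\<lambda>(t, s).
     (if \<theta> \<noteq> pi / 2 then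
        complex_of_real (((norm (\<omega> s))\<^sup>2 - (norm (\<alpha> t))\<^sup>2) / (2 * cos \<theta>))
          + (complex_of_real (tan \<theta>) - \<i>) * complex_of_real (a t + b s)
      else
        complex_of_real ((LBINT x=t0..t. velocity \<alpha> x \<bullet> (\<i> * \<alpha> x))
                         - (LBINT y=s0..s. velocity \<omega> y \<bullet> (\<i> * \<omega> y)))
          - \<i> * complex_of_real (a t + b s),
      \<alpha> t * \<omega> s))"

text \<open>The products in the classification. Each factor is a grim-reaper curve up to a dilation of
  \<open>\<complex>\<close>; an overall dilation of \<open>\<complex>\<^sup>2\<close> normalizes the scale of the first factor but not the ratio
  \<open>r\<close> of the two scales.\<close>

definition grim_line :: "real \<times> real \<Rightarrow> C2" where
  "grim_line = (\<lambda>(s1, s2). (grim_reaper s1, complex_of_real s2))"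

definition grim_grim :: "real \<Rightarrow> real \<times> real \<Rightarrow> C2" where
  "grim_grim r = (\<lambda>(s1, s2). (grim_reaper s1, r *\<^sub>R grim_reaper s2))"

end

(* In a unitary frame whose first vector is e / |e|, the hypothesis says that the first coordinate of
   the immersion is F(x) + G(y). With A = F', B = G', the isothermal and Lagrangian conditions say
   that the partial derivatives of the immersion form the columns (A, p), (B, q) of a multiple of a
   unitary matrix, so p = - W cnj B and q = W cnj A with |W| = 1. The soliton equation together with
   p_y = q_x gives W_x = - i (Im A) W, W_y = - i (Im B) W and
     A' + i (Im A) A = - (B' + i (Im B) B),
   and both sides are a constant c by separation of variables. With P = exp (- i Im F) and
   Q = exp (- i Im G), the curves P cnj A and Q cnj B have derivatives P cnj c and - Q cnj c.
   If c is nonzero, they are alpha and omega up to scale, and the second coordinate is a constant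
   multiple of their product up to translation. If c = 0, the immersion is a sum of two curves in
   orthogonal complex lines, each a grim reaper or a straight line; two lines give a Lagrangian plane
   containing e, which is the map alpha * omega for two straight lines through the origin. *)

theory Submission
  imports Defs
begin

section \<open>Calculus of smooth maps\<close>

text \<open>On a Lagrangian surface J carries the tangent plane onto the normal plane, so pairing
  the soliton equation with J phi_x and J phi_y loses nothing and leaves two real equations. If i mu
  and i nu are the logarithmic derivatives of W, then p_y = q_x reads A' + B' = i mu A + i nu B.
  Inserting this in the two real equations cancels the cross terms and gives mu = - Im A, nu = - Im
  B. The separated equation A' + i (Im A) A = c is nonlinear, but P is an integrating factor for cnj
  A. The modulus of c fixes the time scale that makes the curves unit speed. Since
  \<open>\<theta>\<close> ranges over half a circle only, c is matched up to sign; exchanging x and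
  y replaces c by - c and so exchanges the roles of the two curves. The conclusion asks for a chart
  of the maximal atlas. The change of parameters is affine except for the plane, where it is a
  complex square root and the base point must be kept off the branch point.\<close>

lemma Ck_on_lower: "Ck_on (Suc k) S f \<Longrightarrow> Ck_on k S f"
proof (induction k arbitrary: f)
  case 0
  then show ?case
    by (auto intro!: continuous_at_imp_continuous_on differentiable_imp_continuous_within)
next
  case (Suc k)
  have "f differentiable (at x)" if "x \<in> S" for x using that Suc.prems Ck_on.simps(2) by blast
  moreover have "Ck_on k S (\<lambda>x. frechet_derivative f (at x) v)" for v
    by (rule Suc.IH) (use Suc.prems Ck_on.simps(2)[of "Suc k" S f] in blast)
  ultimately show ?case by simp
qed

lemma Ck_on_subset: "Ck_on k S f \<Longrightarrow> T \<subseteq> S \<Longrightarrow> Ck_on k T f"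
proof (induction k arbitrary: f)
  case 0
  then show ?case by (auto intro: continuous_on_subset)
next
  case (Suc k)
  then show ?case by auto
qed

lemma frechet_derivative_cong_open:
  assumes "open S" "x \<in> S" "\<And>y. y \<in> S \<Longrightarrow> f y = g y"
  shows "frechet_derivative f (at x) = frechet_derivative g (at x)"
proof -
  have "(f has_derivative D) (at x) \<longleftrightarrow> (g has_derivative D) (at x)" for D
    using has_derivative_transform_within_open[OF _ assms(1,2), of f D UNIV g]
      has_derivative_transform_within_open[OF _ assms(1,2), of g D UNIV f] assms(3) by auto
  then show ?thesis
    by (simp add: frechet_derivative_def)
qed

lemma Ck_on_cong:
  assumes "open S" "\<And>y. y \<in> S \<Longrightarrow> f y = g y" "Ck_on k S f"
  shows "Ck_on k S g"
  using assms(2,3)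
proof (induction k arbitrary: f g)
  case 0
  then show ?case by (metis Ck_on.simps(1) continuous_on_cong)
next
  case (Suc k)
  have "g differentiable (at x)" if "x \<in> S" for x
    using Suc.prems that has_derivative_transform_within_open[OF _ assms(1) that, of f _ UNIV g]
    unfolding differentiable_def Ck_on.simps(2) by blast
  moreover have "Ck_on k S (\<lambda>x. frechet_derivative g (at x) v)" for v
  proof (rule Suc.IH)
    show "frechet_derivative f (at y) v = frechet_derivative g (at y) v" if "y \<in> S" for y
      using frechet_derivative_cong_open[OF assms(1) that Suc.prems(1)] by simp
  qed (use Suc.prems in simp)
  ultimately show ?case by simp
qed

text \<open>\<open>Ck_on\<close> speaks of \<open>frechet_derivative\<close>, which is a choice
  operator; uniqueness of the derivative lets any explicitly known \<open>D\<close> take its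
  place.\<close>

lemma Ck_on_SucI:
  assumes "open S" "\<And>x. x \<in> S \<Longrightarrow> (f has_derivative D x) (at x)"
    "\<And>v. Ck_on k S (\<lambda>x. D x v)"
  shows "Ck_on (Suc k) S f"
proof -
  have "D x v = frechet_derivative f (at x) v" if "x \<in> S" for x v
    using frechet_derivative_at[OF assms(2)[OF that]] by simp
  then have "Ck_on k S (\<lambda>x. frechet_derivative f (at x) v)" for v
    using Ck_on_cong[OF assms(1) _ assms(3)] by simp
  moreover have "f differentiable (at x)" if "x \<in> S" for x
    using assms(2)[OF that] differentiable_def by blast
  ultimately show ?thesis by simp
qed

lemma Ck_on_has_derivative:
  assumes "Ck_on (Suc k) S f" "x \<in> S"
  shows "(f has_derivative frechet_derivative f (at x)) (at x)"
  using assms frechet_derivative_works by auto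

lemma Ck_on_const: "open S \<Longrightarrow> Ck_on k S (\<lambda>x. c)"
proof (induction k arbitrary: c)
  case (Suc k)
  then show ?case by (intro Ck_on_SucI[where D = "\<lambda>x v. 0"]) auto
qed simp

lemma Ck_on_bounded_linear:
  assumes "bounded_linear L" "open S" "Ck_on k S f"
  shows "Ck_on k S (\<lambda>x. L (f x))"
  using assms(3)
proof (induction k arbitrary: f)
  case 0
  then show ?case
    using bounded_linear.continuous_on[OF assms(1)] by auto
next
  case (Suc k)
  have "((\<lambda>x. L (f x)) has_derivative (\<lambda>v. L (frechet_derivative f (at x) v))) (at x)" if "x \<in> S" for x
    using bounded_linear.has_derivative[OF assms(1) Ck_on_has_derivative[OF Suc.prems that]] .
  then show ?case
    using Suc by (intro Ck_on_SucI[OF assms(2)]) auto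
qed

lemma Ck_on_add:
  assumes "open S" "Ck_on k S f" "Ck_on k S g"
  shows "Ck_on k S (\<lambda>x. f x + g x)"
  using assms(2,3)
proof (induction k arbitrary: f g)
  case 0
  then show ?case by (auto intro: continuous_on_add)
next
  case (Suc k)
  have "((\<lambda>x. f x + g x) has_derivative
      (\<lambda>v. frechet_derivative f (at x) v + frechet_derivative g (at x) v)) (at x)" if "x \<in> S" for x
    using Suc.prems that by (intro has_derivative_add Ck_on_has_derivative)
  then show ?case
    using Suc by (intro Ck_on_SucI[OF assms(1)]) auto
qed

lemma Ck_on_sum:
  assumes "open S" "finite J" "\<And>j. j \<in> J \<Longrightarrow> Ck_on k S (f j)"
  shows "Ck_on k S (\<lambda>x. \<Sum>j\<in>J. f j x)"
  using assms(2,3)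
proof (induction J rule: finite_induct)
  case empty
  then show ?case using Ck_on_const[OF assms(1)] by simp
next
  case (insert j J)
  have "Ck_on k S (\<lambda>x. f j x + (\<Sum>j\<in>J. f j x))"
    by (rule Ck_on_add[OF assms(1)]) (use insert in auto)
  then show ?case using insert by simp
qed

lemma Ck_on_bilinear:
  assumes "bounded_bilinear pr" "open S" "Ck_on k S f" "Ck_on k S g"
  shows "Ck_on k S (\<lambda>x. pr (f x) (g x))"
  using assms(3,4)
proof (induction k arbitrary: f g)
  case 0
  then show ?case using bounded_bilinear.continuous_on[OF assms(1)] by auto
next
  case (Suc k)
  have "((\<lambda>x. pr (f x) (g x)) has_derivative
      (\<lambda>v. pr (f x) (frechet_derivative g (at x) v) + pr (frechet_derivative f (at x) v) (g x))) (at x)"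
    if "x \<in> S" for x
    using Suc.prems that by (intro bounded_bilinear.FDERIV[OF assms(1)] Ck_on_has_derivative)
  then show ?case
  proof (rule Ck_on_SucI[OF assms(2)])
    fix v
    \<comment> \<open>The product rule keeps \<open>f\<close> and \<open>g\<close> undifferentiated,
      with order \<open>Suc k\<close> where the induction hypothesis wants order \<open>k\<close>;
      hence \<open>Ck_on_lower\<close>.\<close>
    show "Ck_on k S (\<lambda>x. pr (f x) (frechet_derivative g (at x) v) + pr (frechet_derivative f (at x) v) (g x))"
      by (rule Ck_on_add[OF assms(2)]; rule Suc.IH)
        (use Suc.prems Ck_on_lower[OF Suc.prems(1)] Ck_on_lower[OF Suc.prems(2)] in auto)
  qed
qed

lemma Ck_on_linear:
  fixes L :: "'a::euclidean_space \<Rightarrow> 'b::real_normed_vector"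
  assumes "bounded_linear L" "open S"
  shows "Ck_on k S L"
proof (cases k)
  case 0
  then show ?thesis using linear_continuous_on[OF assms(1)] by simp
next
  case (Suc m)
  show ?thesis
    unfolding Suc
    by (rule Ck_on_SucI[OF assms(2) bounded_linear_imp_has_derivative[OF assms(1)] Ck_on_const[OF assms(2)]])
qed

text \<open>The chain rule differentiates \<open>f\<close> in a direction that moves with
  \<open>x\<close>, whereas \<open>Ck_on\<close> uses fixed directions only. Expanding the moving
  direction in \<open>Basis\<close> leaves a sum of products to which the induction hypothesis
  applies.\<close>

lemma Ck_on_compose:
  fixes f :: "'b::euclidean_space \<Rightarrow> 'c::real_normed_vector" and g :: "'a::euclidean_space \<Rightarrow> 'b"
  assumes "open R" "open S" "g ` R \<subseteq> S" "Ck_on k R g" "Ck_on k S f"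
  shows "Ck_on k R (\<lambda>x. f (g x))"
  using assms(4,5)
proof (induction k arbitrary: f)
  case 0
  then show ?case using assms(3) by (auto intro: continuous_on_compose2)
next
  case (Suc k)
  let ?Df = "\<lambda>y. frechet_derivative f (at y)" and ?Dg = "\<lambda>x. frechet_derivative g (at x)"
  have D: "((\<lambda>x. f (g x)) has_derivative (\<lambda>v. \<Sum>i\<in>Basis. (?Dg x v \<bullet> i) *\<^sub>R ?Df (g x) i)) (at x)"
    if x: "x \<in> R" for x
  proof -
    have f: "(f has_derivative ?Df (g x)) (at (g x))"
      using Suc.prems x assms(3) by (intro Ck_on_has_derivative) auto
    have "((\<lambda>x. f (g x)) has_derivative (\<lambda>v. ?Df (g x) (?Dg x v))) (at x)"
      by (rule has_derivative_compose[of g _ x UNIV f, OF _ f]) (use Suc.prems x in \<open>intro Ck_on_has_derivative\<close>)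
    moreover have "?Df (g x) (?Dg x v) = (\<Sum>i\<in>Basis. (?Dg x v \<bullet> i) *\<^sub>R ?Df (g x) i)" for v
    proof -
      have "?Df (g x) (?Dg x v) = ?Df (g x) (\<Sum>i\<in>Basis. (?Dg x v \<bullet> i) *\<^sub>R i)"
        by (simp add: euclidean_representation)
      also have "\<dots> = (\<Sum>i\<in>Basis. (?Dg x v \<bullet> i) *\<^sub>R ?Df (g x) i)"
        using has_derivative_linear[OF f] by (simp add: linear_sum linear_scale)
      finally show ?thesis .
    qed
    ultimately show ?thesis by simp
  qed
  show ?case
  proof (rule Ck_on_SucI[OF assms(1) D])
    fix v
    show "Ck_on k R (\<lambda>x. \<Sum>i\<in>Basis. (?Dg x v \<bullet> i) *\<^sub>R ?Df (g x) i)"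
    proof (rule Ck_on_sum[OF assms(1) finite_Basis])
      fix i :: 'b
      have "Ck_on k R (\<lambda>x. ?Df (g x) i)"
        by (rule Suc.IH) (use Suc.prems Ck_on_lower in auto)
      moreover have "Ck_on k R (\<lambda>x. ?Dg x v \<bullet> i)"
        by (rule Ck_on_bounded_linear[OF bounded_linear_inner_left assms(1)]) (use Suc.prems in simp)
      ultimately show "Ck_on k R (\<lambda>x. (?Dg x v \<bullet> i) *\<^sub>R ?Df (g x) i)"
        using Ck_on_bilinear[OF bounded_bilinear_scaleR assms(1)] by blast
    qed
  qed
qed

lemma smooth_on_subset: "smooth_on S f \<Longrightarrow> T \<subseteq> S \<Longrightarrow> smooth_on T f"
  unfolding smooth_on_def by (intro allI, rule Ck_on_subset) auto

lemma smooth_on_cong: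
  "open S \<Longrightarrow> (\<And>y. y \<in> S \<Longrightarrow> f y = g y) \<Longrightarrow> smooth_on S f \<Longrightarrow> smooth_on S g"
  unfolding smooth_on_def by (intro allI, rule Ck_on_cong[where f = f]) auto

lemma smooth_on_compose:
  fixes f :: "'b::euclidean_space \<Rightarrow> 'c::real_normed_vector" and g :: "'a::euclidean_space \<Rightarrow> 'b"
  shows "open R \<Longrightarrow> open S \<Longrightarrow> g ` R \<subseteq> S \<Longrightarrow> smooth_on R g \<Longrightarrow> smooth_on S f
     \<Longrightarrow> smooth_on R (\<lambda>x. f (g x))"
  unfolding smooth_on_def by (intro allI, rule Ck_on_compose[where S = S]) auto

lemma smooth_on_affine:
  fixes L :: "'a::euclidean_space \<Rightarrow> 'b::euclidean_space"
  assumes "linear L" "open S"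
  shows "smooth_on S (\<lambda>x. L x + b)"
  unfolding smooth_on_def using assms
  by (intro allI, intro Ck_on_add Ck_on_const Ck_on_linear) (auto simp: linear_conv_bounded_linear)

section \<open>Partial derivatives and their symmetry\<close>

lemma smooth_on_pd:
  assumes "smooth_on S f"
  shows "smooth_on S (pd v f)"
  unfolding smooth_on_def
proof
  fix k
  have "Ck_on (Suc k) S f"
    using assms by (simp only: smooth_on_def)
  then show "Ck_on k S (pd v f)"
    by (simp add: pd_def[abs_def])
qed

lemma smooth_on_imp_continuous_on: "smooth_on S f \<Longrightarrow> continuous_on S f"
  unfolding smooth_on_def by (drule spec[where x = 0]) simp

lemma smooth_on_has_derivative:
  "smooth_on S f \<Longrightarrow> x \<in> S \<Longrightarrow> (f has_derivative (\<lambda>v. pd v f x)) (at x)"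
  unfolding smooth_on_def pd_def by (rule Ck_on_has_derivative[where k = 0]) auto

lemma smooth_on_bounded_linear:
  "bounded_linear L \<Longrightarrow> open S \<Longrightarrow> smooth_on S f \<Longrightarrow> smooth_on S (\<lambda>x. L (f x))"
  unfolding smooth_on_def by (intro allI, rule Ck_on_bounded_linear) auto

lemma pd_bounded_linear:
  assumes "bounded_linear L" "f differentiable (at x)"
  shows "pd v (\<lambda>x. L (f x)) x = L (pd v f x)"
proof -
  have "((\<lambda>x. L (f x)) has_derivative (\<lambda>v. L (frechet_derivative f (at x) v))) (at x)"
    by (rule bounded_linear.has_derivative[OF assms(1)]) (use assms(2) frechet_derivative_works in blast)
  then show ?thesis unfolding pd_def by (simp add: frechet_derivative_at[symmetric])
qed

lemma pd_cong_open:
  "open S \<Longrightarrow> x \<in> S \<Longrightarrow> (\<And>y. y \<in> S \<Longrightarrow> f y = g y) \<Longrightarrow> pd v f x = pd v g x"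
  unfolding pd_def by (subst frechet_derivative_cong_open[of S x f g]) auto

lemma smooth_on_pd_x:
  assumes "smooth_on S f" "(x, y) \<in> S"
  shows "((\<lambda>s. f (s, y)) has_vector_derivative pd_x f (x, y)) (at x)"
proof -
  have f: "(f has_derivative (\<lambda>v. pd v f (x, y))) (at (x, y))"
    using smooth_on_has_derivative[OF assms] .
  have "((\<lambda>s. f (s, y)) has_derivative (\<lambda>h. pd (h, 0) f (x, y))) (at x)"
    by (rule has_derivative_compose[of "\<lambda>s. (s, y)" _ x UNIV f, OF _ f])
      (auto intro!: derivative_eq_intros)
  moreover have "(\<lambda>h. pd (h, 0) f (x, y)) = (\<lambda>h. h *\<^sub>R pd_x f (x, y))"
  proof
    show "pd (h, 0) f (x, y) = h *\<^sub>R pd_x f (x, y)" for h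
      using linear_scale[OF has_derivative_linear[OF f], of h "(1,0)"] by simp
  qed
  ultimately show ?thesis unfolding has_vector_derivative_def by metis
qed

lemma smooth_on_pd_y:
  assumes "smooth_on S f" "(x, y) \<in> S"
  shows "((\<lambda>s. f (x, s)) has_vector_derivative pd_y f (x, y)) (at y)"
proof -
  have f: "(f has_derivative (\<lambda>v. pd v f (x, y))) (at (x, y))"
    using smooth_on_has_derivative[OF assms] .
  have "((\<lambda>s. f (x, s)) has_derivative (\<lambda>h. pd (0, h) f (x, y))) (at y)"
    by (rule has_derivative_compose[of "\<lambda>s. (x, s)" _ y UNIV f, OF _ f])
      (auto intro!: derivative_eq_intros)
  moreover have "(\<lambda>h. pd (0, h) f (x, y)) = (\<lambda>h. h *\<^sub>R pd_y f (x, y))"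
  proof
    show "pd (0, h) f (x, y) = h *\<^sub>R pd_y f (x, y)" for h
      using linear_scale[OF has_derivative_linear[OF f], of h "(0,1)"] by simp
  qed
  ultimately show ?thesis unfolding has_vector_derivative_def by metis
qed

text \<open>Write \<open>f\<close> as an integral of \<open>pd_x f\<close> along \<open>x\<close>,
  differentiate under the integral in \<open>y\<close>, then differentiate at the upper limit. It
  serves twice: to make \<open>pd_x\<close> of the separated coordinate independent of
  \<open>y\<close>, and as the integrability condition of the other coordinate.\<close>

lemma pd_commute:
  fixes f :: "real \<times> real \<Rightarrow> complex"
  assumes S: "open S" "smooth_on S f" and z: "z \<in> S"
  shows "pd_x (pd_y f) z = pd_y (pd_x f) z"
proof -
  obtain x y where xy: "z = (x, y)" by (cases z)
  obtain U V where UV: "open U" "open V" "(x, y) \<in> U \<times> V" "U \<times> V \<subseteq> S"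
    using S(1) z xy open_prod_elim by metis
  obtain d where d: "d > 0" "cball x d \<subseteq> U" using UV open_contains_cball by (metis mem_Sigma_iff)
  obtain d' where d': "d' > 0" "ball y d' \<subseteq> V" using UV open_contains_ball by (metis mem_Sigma_iff)
  define a b where "a = x - d" and "b = x + d"
  have ab: "{a..b} \<subseteq> U" "x \<in> {a<..<b}"
    using d by (auto simp: a_def b_def cball_eq_atLeastAtMost)
  let ?fx = "pd_x f" and ?fxy = "pd_y (pd_x f)"
  have sm: "smooth_on S ?fx" "smooth_on S ?fxy" "smooth_on S (pd_y f)"
    using S(2) smooth_on_pd by blast+
  have sub: "(s, t) \<in> S" if "s \<in> {a..b}" "t \<in> ball y d'" for s t
  proof (rule subsetD[OF UV(4)])
    show "(s, t) \<in> U \<times> V"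
      using subsetD[OF ab(1) that(1)] subsetD[OF d'(2) that(2)] by (rule SigmaI)
  qed
  have int: "((\<lambda>r. ?fx (r, t)) has_integral f (s, t) - f (a, t)) {a..s}"
    if "s \<in> {a..b}" "t \<in> ball y d'" for s t
  proof (rule fundamental_theorem_of_calculus[where f = "\<lambda>r. f (r, t)"])
    show "((\<lambda>r. f (r, t)) has_vector_derivative ?fx (r, t)) (at r within {a..s})" if r: "r \<in> {a..s}" for r
      using r that \<open>s \<in> {a..b}\<close> \<open>t \<in> ball y d'\<close>
      by (intro has_vector_derivative_at_within[OF smooth_on_pd_x[OF S(2)]] sub) auto
  qed (use that in auto)
  have eq: "pd_y f (s, y) - pd_y f (a, y) = integral {a..s} (\<lambda>r. ?fxy (r, y))" if s: "s \<in> {a..b}" for s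
  proof -
    have "((\<lambda>t. integral (cbox a s) (\<lambda>r. ?fx (r, t))) has_vector_derivative
        integral (cbox a s) (\<lambda>r. ?fxy (r, y))) (at y within ball y d')"
    proof (rule leibniz_rule_vector_derivative[where fx = "\<lambda>t r. ?fxy (r, t)"])
      show "((\<lambda>t. ?fx (r, t)) has_vector_derivative ?fxy (r, t)) (at t within ball y d')"
        if "t \<in> ball y d'" "r \<in> cbox a s" for t r
        using that s by (intro has_vector_derivative_at_within[OF smooth_on_pd_y[OF sm(1)]] sub) auto
      show "(\<lambda>r. ?fx (r, t)) integrable_on cbox a s" if "t \<in> ball y d'" for t
        using int[OF s that] by auto
      have "continuous_on (ball y d' \<times> cbox a s) (\<lambda>p. ?fxy (snd p, fst p))"
        by (rule continuous_on_compose2[OF smooth_on_imp_continuous_on[OF sm(2)]])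
          (use s sub in \<open>auto intro!: continuous_intros\<close>)
      then show "continuous_on (ball y d' \<times> cbox a s) (\<lambda>(t, r). ?fxy (r, t))"
        by (simp add: case_prod_unfold)
    qed (use d' in auto)
    then have "((\<lambda>t. f (s, t) - f (a, t)) has_vector_derivative
        integral {a..s} (\<lambda>r. ?fxy (r, y))) (at y within ball y d')"
      unfolding box_real
      by (rule has_vector_derivative_transform[rotated 2,
          where f = "\<lambda>t. integral {a..s} (\<lambda>r. ?fx (r, t))"])
        (use d' integral_unique[OF int[OF s]] in auto)
    then have 1: "((\<lambda>t. f (s, t) - f (a, t)) has_vector_derivative
        integral {a..s} (\<lambda>r. ?fxy (r, y))) (at y)"
      using d' at_within_open[of y "ball y d'"] by simp
    have "((\<lambda>t. f (s, t) - f (a, t)) has_vector_derivative pd_y f (s, y) - pd_y f (a, y)) (at y)"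
      by (intro has_vector_derivative_diff smooth_on_pd_y[OF S(2)]) (use s ab d' sub in auto)
    then show ?thesis
      using 1 vector_derivative_unique_at by blast
  qed
  have "((\<lambda>s. integral {a..s} (\<lambda>r. ?fxy (r, y))) has_vector_derivative ?fxy (x, y)) (at x within {a..b})"
    by (rule integral_has_vector_derivative)
      (use ab d' sub in \<open>auto intro!: continuous_intros continuous_on_compose2[OF smooth_on_imp_continuous_on[OF sm(2)]]\<close>)
  then have "((\<lambda>s. pd_y f (s, y) - pd_y f (a, y)) has_vector_derivative ?fxy (x, y)) (at x within {a..b})"
    by (rule has_vector_derivative_transform[rotated 2,
        where f = "\<lambda>s. integral {a..s} (\<lambda>r. ?fxy (r, y))"]) (use ab eq in auto)
  then have "((\<lambda>s. pd_y f (s, y) - pd_y f (a, y)) has_vector_derivative ?fxy (x, y)) (at x)"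
    using ab(2) at_within_interior[of x "{a..b}"] by (simp add: interior_atLeastAtMost_real)
  moreover have "((\<lambda>s. pd_y f (s, y) - pd_y f (a, y)) has_vector_derivative pd_x (pd_y f) (x, y) - 0) (at x)"
    by (intro has_vector_derivative_diff smooth_on_pd_x[OF sm(3)] has_vector_derivative_const)
      (use z xy in auto)
  ultimately show ?thesis
    using vector_derivative_unique_at xy by fastforce
qed

section \<open>Charts of a maximal atlas\<close>

lemma is_chart_props:
  assumes "is_chart M (U, \<psi>)"
  shows "open U" "U \<subseteq> M" "open (\<psi> ` U)" "continuous_on U \<psi>" "inj_on \<psi> U"
    "continuous_on (\<psi> ` U) (inv_into U \<psi>)"
  using assms unfolding is_chart.simps homeomorphism_def
  by (auto intro: inj_on_inverseI)

lemma is_chart_open_image: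
  assumes "is_chart M (U, \<psi>)" "open W"
  shows "open (\<psi> ` (U \<inter> W))"
proof -
  have "homeomorphism U (\<psi> ` U) \<psi> (inv_into U \<psi>)"
    using assms(1) by simp
  then have "openin (top_of_set (\<psi> ` U)) (\<psi> ` (U \<inter> W))"
    by (rule homeomorphism_imp_open_map) (use assms(2) in \<open>rule openin_open_Int\<close>)
  then show ?thesis
    using is_chart_props(3)[OF assms(1)] openin_open_trans by blast
qed

lemma open_image_of_diffeo:
  assumes "smooth_on (T ` B) T'" "open (T ` B)" "\<And>z. z \<in> B \<Longrightarrow> T' (T z) = z" "open C" "C \<subseteq> B"
  shows "open (T ` C)"
proof -
  have "T ` C = T ` B \<inter> T' -` C"
    using assms(3,5) by force
  then show ?thesis
    using continuous_open_preimage[OF smooth_on_imp_continuous_on[OF assms(1)] assms(2,4)] by simp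
qed

text \<open>Maximality of the atlas reduces membership to being a chart and being compatible with
  each member. Transition maps to a member \<open>(W, \<delta>)\<close> factor through those of
  \<open>\<psi>\<close>, composed with \<open>T'\<close> or \<open>T\<close>. On the image of
  \<open>B\<close> the left inverse \<open>T'\<close> is automatically two-sided.\<close>

lemma smooth_surface_chart_change:
  assumes M: "smooth_surface M atl" and U: "(U, \<psi>) \<in> atl"
    and B: "open B" "B \<subseteq> \<psi> ` U"
    and T: "smooth_on B T" "open (T ` B)" "smooth_on (T ` B) T'" "\<And>z. z \<in> B \<Longrightarrow> T' (T z) = z"
  shows "(U \<inter> \<psi> -` B, T \<circ> \<psi>) \<in> atl"
proof -
  let ?V = "U \<inter> \<psi> -` B" and ?\<eta> = "T \<circ> \<psi>"
  have chart: "is_chart M c" if "c \<in> atl" for c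
    using M that by (auto simp: smooth_surface_def)
  have compat: "chart_compatible c d" if "c \<in> atl" "d \<in> atl" for c d
    using M that by (auto simp: smooth_surface_def)
  note \<psi> = is_chart_props[OF chart[OF U]]
  have openV: "open ?V"
    using continuous_open_preimage[OF \<psi>(4,1) B(1)] .
  have \<eta>V: "?\<eta> ` ?V = T ` B"
    using B(2) by force
  have inj: "inj_on ?\<eta> ?V"
  proof (rule inj_onI)
    fix q q' assume q: "q \<in> ?V" "q' \<in> ?V" "?\<eta> q = ?\<eta> q'"
    then have "\<psi> q = \<psi> q'"
      using T(4) by (metis IntD2 comp_apply vimageD)
    then show "q = q'"
      using q \<psi>(5) by (auto dest: inj_onD)
  qed
  have T'B: "T' w \<in> B" "T (T' w) = w" if "w \<in> T ` B" for w
    using that T(4) by auto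
  have inv: "inv_into ?V ?\<eta> w = inv_into U \<psi> (T' w)" if w: "w \<in> T ` B" for w
  proof (rule inv_into_f_eq[OF inj])
    have "T' w \<in> \<psi> ` U" using T'B(1)[OF w] B(2) by auto
    then show "inv_into U \<psi> (T' w) \<in> ?V" "?\<eta> (inv_into U \<psi> (T' w)) = w"
      using T'B[OF w] by (auto simp: f_inv_into_f inv_into_into)
  qed
  have "is_chart M (?V, ?\<eta>)"
    unfolding is_chart.simps \<eta>V
  proof (intro conjI homeomorphismI)
    show "continuous_on ?V ?\<eta>"
      by (rule continuous_on_compose)
        (use \<psi>(4) smooth_on_imp_continuous_on[OF T(1)] in \<open>auto intro: continuous_on_subset\<close>)
    have "continuous_on (T ` B) (\<lambda>w. inv_into U \<psi> (T' w))"
      by (rule continuous_on_compose2[OF \<psi>(6) smooth_on_imp_continuous_on[OF T(3)]])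
        (use T'B(1) B(2) in blast)
    then show "continuous_on (T ` B) (inv_into ?V ?\<eta>)"
      using inv by (simp cong: continuous_on_cong)
    show "?\<eta> ` ?V \<subseteq> T ` B" using \<eta>V by blast
    show "inv_into ?V ?\<eta> ` (T ` B) \<subseteq> ?V"
      using \<eta>V by (metis image_subsetI inv_into_into)
    show "inv_into ?V ?\<eta> (?\<eta> q) = q" if "q \<in> ?V" for q
      using inj that by (rule inv_into_f_f)
    show "?\<eta> (inv_into ?V ?\<eta> w) = w" if "w \<in> T ` B" for w
      using that \<eta>V by (metis f_inv_into_f)
  qed (use openV \<psi>(2) T(2) in auto)
  moreover have "chart_compatible (?V, ?\<eta>) (W, \<delta>)" if W: "(W, \<delta>) \<in> atl" for W \<delta>
  proof -
    note \<delta> = is_chart_props[OF chart[OF W]]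
    have sm: "smooth_on (\<psi> ` (U \<inter> W)) (\<delta> \<circ> inv_into U \<psi>)" "smooth_on (\<delta> ` (U \<inter> W)) (\<psi> \<circ> inv_into W \<delta>)"
      using compat[OF U W] by auto
    have open\<psi>: "open (\<psi> ` (U \<inter> W))"
      by (rule is_chart_open_image[OF chart[OF U] \<delta>(1)])
    have img: "?\<eta> ` (?V \<inter> W) = T ` (B \<inter> \<psi> ` (U \<inter> W))"
      by auto
    have openR: "open (?\<eta> ` (?V \<inter> W))"
      unfolding img by (rule open_image_of_diffeo[OF T(3,2,4)]) (use B(1) open\<psi> in auto)
    have "smooth_on (?\<eta> ` (?V \<inter> W)) (\<lambda>w. (\<delta> \<circ> inv_into U \<psi>) (T' w))"
    proof (rule smooth_on_compose[OF openR open\<psi> _ _ sm(1)])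
      show "T' ` (?\<eta> ` (?V \<inter> W)) \<subseteq> \<psi> ` (U \<inter> W)"
        unfolding img image_image
      proof (rule image_subsetI)
        fix z assume "z \<in> B \<inter> \<psi> ` (U \<inter> W)"
        then show "T' (T z) \<in> \<psi> ` (U \<inter> W)"
          using T(4)[of z] by simp
      qed
      show "smooth_on (?\<eta> ` (?V \<inter> W)) T'"
        by (rule smooth_on_subset[OF T(3)]) auto
    qed
    then have 1: "smooth_on (?\<eta> ` (?V \<inter> W)) (\<delta> \<circ> inv_into ?V ?\<eta>)"
    proof (rule smooth_on_cong[OF openR, rotated])
      fix w assume "w \<in> ?\<eta> ` (?V \<inter> W)"
      then have "w \<in> T ` B" unfolding img by blast
      then show "(\<delta> \<circ> inv_into U \<psi>) (T' w) = (\<delta> \<circ> inv_into ?V ?\<eta>) w"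
        using inv by simp
    qed
    have "\<delta> ` (?V \<inter> W) = \<delta> ` (W \<inter> ?V)" by blast
    then have openD: "open (\<delta> ` (?V \<inter> W))"
      using is_chart_open_image[OF chart[OF W] openV] by simp
    have "smooth_on (\<delta> ` (?V \<inter> W)) (\<lambda>w. T ((\<psi> \<circ> inv_into W \<delta>) w))"
    proof (rule smooth_on_compose[OF openD B(1) _ _ T(1)])
      show "smooth_on (\<delta> ` (?V \<inter> W)) (\<psi> \<circ> inv_into W \<delta>)"
        by (rule smooth_on_subset[OF sm(2)]) auto
    qed (use \<delta>(5) in \<open>auto simp: inv_into_f_f\<close>)
    then have 2: "smooth_on (\<delta> ` (?V \<inter> W)) (?\<eta> \<circ> inv_into W \<delta>)"
      by (simp add: comp_def)
    from 1 2 show ?thesis by simp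
  qed
  ultimately show ?thesis
    using M unfolding smooth_surface_def by (metis surj_pair)
qed

text \<open>Carries an identity in coordinates over to the surface: the chart required is
  \<open>T \<circ> \<psi>\<close>, cut down to the points that \<open>\<psi>\<close> sends into
  \<open>B\<close>.\<close>

lemma locally_congruent_of_chart_change:
  assumes "smooth_surface M atl" "(U, \<psi>) \<in> atl" "open B" "B \<subseteq> \<psi> ` U" "p \<in> U" "\<psi> p \<in> B"
    and "smooth_on B T" "open (T ` B)" "smooth_on (T ` B) T'" "\<And>z. z \<in> B \<Longrightarrow> T' (T z) = z"
    and D: "T ` B \<subseteq> D" and F: "rigid_motion F" "r > 0"
    and eq: "\<And>z. z \<in> B \<Longrightarrow> local_rep \<phi> (U, \<psi>) z = F (r *\<^sub>R \<Psi> (T z))"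
  shows "locally_congruent_up_to_dilation atl \<phi> p D \<Psi>"
proof -
  have "inj_on \<psi> U"
    using assms(1,2) is_chart_props(5) by (fastforce simp: smooth_surface_def)
  then have "\<phi> q = F (r *\<^sub>R \<Psi> ((T \<circ> \<psi>) q))" if "q \<in> U \<inter> \<psi> -` B" for q
    using eq[of "\<psi> q"] that by (simp add: inv_into_f_f)
  moreover have "(U \<inter> \<psi> -` B, T \<circ> \<psi>) \<in> atl"
    using assms by (intro smooth_surface_chart_change)
  ultimately show ?thesis
    unfolding locally_congruent_up_to_dilation_def using assms(5,6) D F
    by (intro exI[of _ "U \<inter> \<psi> -` B"] exI[of _ "T \<circ> \<psi>"] exI[of _ F] exI[of _ r]) auto
qed

text \<open>Serves every case except the plane: the parameters of the model are then
  \<open>x\<close> and \<open>y\<close>, scaled, reflected, shifted or exchanged.\<close>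

lemma locally_congruent_of_affine_change:
  fixes L L' :: "real \<times> real \<Rightarrow> real \<times> real"
  assumes "smooth_surface M atl" "(U, \<psi>) \<in> atl" "open B" "B \<subseteq> \<psi> ` U" "p \<in> U" "\<psi> p \<in> B"
    and L: "linear L" "linear L'" "\<And>z. L' (L z) = z" "\<And>z. L (L' z) = z"
    and D: "\<And>z. z \<in> B \<Longrightarrow> L z + b \<in> D" and F: "rigid_motion F" "r > 0"
    and eq: "\<And>z. z \<in> B \<Longrightarrow> local_rep \<phi> (U, \<psi>) z = F (r *\<^sub>R \<Psi> (L z + b))"
  shows "locally_congruent_up_to_dilation atl \<phi> p D \<Psi>"
proof (rule locally_congruent_of_chart_change[OF assms(1-6), where T = "\<lambda>z. L z + b"
      and T' = "\<lambda>w. L' w + - L' b"])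
  have "(\<lambda>z. L z + b) ` B = (\<lambda>w. L' w + - L' b) -` B"
  proof
    show "(\<lambda>w. L' w + - L' b) -` B \<subseteq> (\<lambda>z. L z + b) ` B"
    proof
      fix w assume "w \<in> (\<lambda>w. L' w + - L' b) -` B"
      moreover have "L (L' w + - L' b) + b = w"
        using L by (simp add: linear_diff)
      ultimately show "w \<in> (\<lambda>z. L z + b) ` B" by force
    qed
  qed (use L in \<open>auto simp: linear_add\<close>)
  moreover have "continuous_on UNIV (\<lambda>w. L' w + - L' b)"
    using smooth_on_imp_continuous_on[OF smooth_on_affine[OF L(2) open_UNIV, of "- L' b"]] .
  ultimately show op: "open ((\<lambda>z. L z + b) ` B)"
    using open_vimage[OF assms(3)] by simp
  show "smooth_on ((\<lambda>z. L z + b) ` B) (\<lambda>w. L' w + - L' b)"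
    by (rule smooth_on_affine[OF L(2) op])
  show "smooth_on B (\<lambda>z. L z + b)"
    by (rule smooth_on_affine[OF L(1) assms(3)])
qed (use L D F eq in \<open>auto simp: linear_add\<close>)

section \<open>The curves \<open>\<alpha>\<close> and \<open>\<omega>\<close>\<close>

lemma normal_component_eqI:
  assumes "subspace T" "\<And>t. t \<in> T \<Longrightarrow> w \<bullet> t = 0" "v - w \<in> T"
  shows "normal_component T v = w"
  unfolding normal_component_def
proof (rule the_equality)
  fix w' assume w': "(\<forall>t\<in>T. w' \<bullet> t = 0) \<and> v - w' \<in> T"
  have "w' - w \<in> T"
    using subspace_diff[OF assms(1,3), of "v - w'"] w' by simp
  then have "(w' - w) \<bullet> (w' - w) = 0"
    using w' assms(2) by (metis diff_zero inner_diff_left)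
  then show "w' = w" by simp
qed (use assms in auto)

lemma normal_component_props:
  fixes T :: "'a::euclidean_space set"
  assumes "subspace T"
  shows "\<And>t. t \<in> T \<Longrightarrow> normal_component T v \<bullet> t = 0" "v - normal_component T v \<in> T"
proof -
  obtain y z where yz: "y \<in> span T" "\<And>t. t \<in> span T \<Longrightarrow> orthogonal z t" "v = y + z"
    using orthogonal_subspace_decomp_exists by metis
  have T: "span T = T"
    using assms by (simp add: span_eq_iff)
  have "normal_component T v = z"
    using yz unfolding T by (intro normal_component_eqI assms) (auto simp: orthogonal_def)
  then show "\<And>t. t \<in> T \<Longrightarrow> normal_component T v \<bullet> t = 0" "v - normal_component T v \<in> T"
    using yz unfolding T by (auto simp: orthogonal_def)
qed

lemma inner_complex_eq_Re: "v \<bullet> w = Re (v * cnj w)" for v w :: complex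
  by (simp add: inner_complex_def)

text \<open>Multiplication by \<open>cnj u\<close> rotates the frame \<open>u\<close>,
  \<open>\<i> * u\<close> to \<open>1\<close>, \<open>\<i>\<close>, so the normal coordinate of
  \<open>v\<close> becomes an imaginary part.\<close>

lemma normal_component_span_unit:
  fixes u v :: complex
  assumes u: "norm u = 1"
  shows "normal_component (span {u}) v = complex_of_real (Im (v * cnj u)) * (\<i> * u)"
proof (rule normal_component_eqI)
  have uu: "cnj u * u = 1"
    using u by (metis complex_norm_square mult.commute of_real_1 power_one)
  let ?w = "complex_of_real (Im (v * cnj u)) * (\<i> * u)"
  show "?w \<bullet> t = 0" if t: "t \<in> span {u}" for t
  proof -
    obtain k where "t = k *\<^sub>R u"
      using t by (auto simp: span_singleton)
    then show ?thesis by (simp add: inner_complex_def algebra_simps)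
  qed
  have "v = (v * cnj u) * u" using uu by (simp add: mult.assoc)
  also have "v * cnj u = complex_of_real (Re (v * cnj u)) + \<i> * complex_of_real (Im (v * cnj u))"
    by (rule complex_eq)
  finally have "v - ?w = Re (v * cnj u) *\<^sub>R u"
    by (simp add: algebra_simps scaleR_conv_of_real)
  then show "v - ?w \<in> span {u}"
    by (simp add: span_base span_scale)
qed simp

lemma has_vector_derivative_cis:
  assumes "(g has_vector_derivative g') (at t within S)"
  shows "((\<lambda>t. cis (g t)) has_vector_derivative (complex_of_real g' * \<i> * cis (g t))) (at t within S)"
proof -
  have "((\<lambda>t. \<i> * complex_of_real (g t)) has_vector_derivative (\<i> * complex_of_real g')) (at t within S)"
    using assms by (intro derivative_intros) (simp add: has_real_derivative_iff_has_vector_derivative)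
  then have "((exp \<circ> (\<lambda>t. \<i> * complex_of_real (g t))) has_vector_derivative
      (\<i> * complex_of_real g') * exp (\<i> * complex_of_real (g t))) (at t within S)"
    by (rule field_vector_diff_chain_within) (auto intro!: DERIV_subset[OF DERIV_exp])
  then show ?thesis
    by (simp add: comp_def cis_conv_exp mult_ac)
qed

lemma constant_on_interval_of_zero_derivative:
  fixes f :: "real \<Rightarrow> 'b::real_normed_vector"
  assumes "is_interval J" "\<And>t. t \<in> J \<Longrightarrow> (f has_vector_derivative 0) (at t)"
  shows "\<exists>C. \<forall>t\<in>J. f t = C"
proof (rule has_vector_derivative_zero_constant)
  show "convex J" using assms(1) by (rule is_interval_convex)
  show "(f has_vector_derivative 0) (at t within J)" if "t \<in> J" for t
    using has_vector_derivative_at_within assms(2) that by blast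
  fix c assume "\<And>x. x \<in> J \<Longrightarrow> f x = c"
  then show ?thesis by blast
qed

lemma Ck_on_SucI_real:
  assumes "open J" "\<And>t. t \<in> J \<Longrightarrow> (f has_vector_derivative f' t) (at t)" "Ck_on k J f'"
  shows "Ck_on (Suc k) J f"
proof (rule Ck_on_SucI[OF assms(1)])
  show "(f has_derivative (\<lambda>h. h *\<^sub>R f' t)) (at t)" if "t \<in> J" for t
    using assms(2)[OF that] by (simp add: has_vector_derivative_def)
  show "Ck_on k J (\<lambda>t. h *\<^sub>R f' t)" for h
    by (rule Ck_on_bounded_linear[OF bounded_linear_scaleR_right assms(1,3)])
qed

text \<open>\<open>F\<close> is one of the two summands of \<open>(\<phi>, e) = F x + G y\<close>. With \<open>c = cis (\<theta> + \<pi>)\<close> the curve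
  \<open>soliton_curve F A\<close> below is an \<open>\<alpha>\<close>, with \<open>c = cis \<theta>\<close> it is an \<open>\<omega>\<close>.\<close>

definition soliton_ode :: "complex \<Rightarrow> real set \<Rightarrow> (real \<Rightarrow> complex) \<Rightarrow> (real \<Rightarrow> complex) \<Rightarrow> bool" where
  "soliton_ode c J F A \<longleftrightarrow> open J \<and> is_interval J \<and>
     (\<forall>t\<in>J. (F has_vector_derivative A t) (at t) \<and>
        (A has_vector_derivative (c - \<i> * complex_of_real (Im (A t)) * A t)) (at t))"

definition phase :: "(real \<Rightarrow> complex) \<Rightarrow> real \<Rightarrow> complex" where
  "phase F t = cis (- Im (F t))"

definition soliton_curve :: "(real \<Rightarrow> complex) \<Rightarrow> (real \<Rightarrow> complex) \<Rightarrow> real \<Rightarrow> complex" where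
  "soliton_curve F A t = phase F t * cnj (A t)"

text \<open>The last fact is the reason for \<open>phase\<close>: conjugating the nonlinear term of
  \<open>A\<close> gives \<open>\<i> * Im A * cnj A\<close>, and the derivative of
  \<open>phase F\<close> cancels it. The nonlinear equation thus becomes a statement about the
  tangent of a plane curve.\<close>

lemma soliton_odeD:
  assumes "soliton_ode c J F A" "t \<in> J"
  shows "(F has_vector_derivative A t) (at t)"
    "(A has_vector_derivative (c - \<i> * complex_of_real (Im (A t)) * A t)) (at t)"
    "(phase F has_vector_derivative - \<i> * complex_of_real (Im (A t)) * phase F t) (at t)"
    "(soliton_curve F A has_vector_derivative phase F t * cnj c) (at t)"
proof -
  show F: "(F has_vector_derivative A t) (at t)"
    and A: "(A has_vector_derivative (c - \<i> * complex_of_real (Im (A t)) * A t)) (at t)"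
    using assms by (auto simp: soliton_ode_def)
  have "((\<lambda>t. - Im (F t)) has_vector_derivative - Im (A t)) (at t)"
    by (intro has_vector_derivative_minus bounded_linear.has_vector_derivative[OF bounded_linear_Im] F)
  from has_vector_derivative_cis[OF this]
  show P: "(phase F has_vector_derivative - \<i> * complex_of_real (Im (A t)) * phase F t) (at t)"
    by (simp add: phase_def[abs_def] mult_ac)
  have "((\<lambda>t. phase F t * cnj (A t)) has_vector_derivative
      phase F t * cnj (c - \<i> * complex_of_real (Im (A t)) * A t)
      + (- \<i> * complex_of_real (Im (A t)) * phase F t) * cnj (A t)) (at t)"
    by (intro has_vector_derivative_mult P bounded_linear.has_vector_derivative[OF bounded_linear_cnj] A)
  then show "(soliton_curve F A has_vector_derivative phase F t * cnj c) (at t)"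
    by (simp add: soliton_curve_def[abs_def] algebra_simps)
qed

lemma norm_phase [simp]: "norm (phase F t) = 1"
  by (simp add: phase_def)

lemma phase_cnj_phase [simp]: "phase F t * cnj (phase F t) = 1"
  using complex_norm_square[of "phase F t"] by simp

text \<open>Bootstrapping: the derivatives of \<open>A\<close> and \<open>phase F\<close> are
  polynomial in \<open>A\<close>, \<open>Im A\<close> and \<open>phase F\<close>, so each order of
  regularity yields the next. The two functions have to be treated in one induction.\<close>

lemma soliton_ode_smooth:
  assumes "soliton_ode c J F A"
  shows "smooth_on J (soliton_curve F A)"
proof -
  have J: "open J" using assms by (simp add: soliton_ode_def)
  note bl = Ck_on_bilinear[OF bounded_bilinear_mult J]
  have AP: "Ck_on k J A \<and> Ck_on k J (phase F)" for k
  proof (induction k)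
    case 0
    have "continuous (at t) A" "continuous (at t) (phase F)" if "t \<in> J" for t
      using soliton_odeD(2,3)[OF assms that] has_vector_derivative_continuous by blast+
    then show ?case
      by (auto intro: continuous_at_imp_continuous_on)
  next
    case (Suc k)
    have Im: "Ck_on k J (\<lambda>t. \<i> * complex_of_real (Im (A t)))"
      by (intro Ck_on_bounded_linear[OF bounded_linear_mult_right J]
          Ck_on_bounded_linear[OF bounded_linear_of_real J] Ck_on_bounded_linear[OF bounded_linear_Im J])
        (use Suc in simp)
    have "Ck_on k J (\<lambda>t. c + - (\<i> * complex_of_real (Im (A t)) * A t))"
      by (intro Ck_on_add[OF J] Ck_on_const[OF J] Ck_on_bounded_linear[OF bounded_linear_minus[OF bounded_linear_ident] J] bl Im)
        (use Suc in simp)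
    moreover have "Ck_on k J (\<lambda>t. - (\<i> * complex_of_real (Im (A t)) * phase F t))"
      by (intro Ck_on_bounded_linear[OF bounded_linear_minus[OF bounded_linear_ident] J] bl Im)
        (use Suc in simp)
    ultimately show ?case
      using Ck_on_SucI_real[OF J soliton_odeD(2)[OF assms]] Ck_on_SucI_real[OF J soliton_odeD(3)[OF assms]]
      by simp
  qed
  show ?thesis
    unfolding smooth_on_def soliton_curve_def[abs_def]
    by (intro allI bl Ck_on_bounded_linear[OF bounded_linear_cnj J]) (use AP in auto)
qed

lemma soliton_curve_velocity:
  assumes "soliton_ode c J F A" "t \<in> J"
  shows "velocity (soliton_curve F A) t = phase F t * cnj c"
  using soliton_odeD(4)[OF assms] by (simp add: velocity_def vector_derivative_at)

lemma soliton_curve_unit_speed: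
  assumes "soliton_ode c J F A" "norm c = 1"
  shows "unit_speed_curve J (soliton_curve F A)"
  using assms soliton_ode_smooth soliton_curve_velocity
  by (auto simp: unit_speed_curve_def soliton_ode_def norm_mult)

text \<open>The velocity is \<open>phase F t\<close> times a constant, so the tangent turns at the
  rate \<open>- Im (A t)\<close>.\<close>

lemma soliton_curve_curvature_vector:
  assumes ode: "soliton_ode c J F A" and "norm c = 1" and t: "t \<in> J"
  shows "curvature_vector (soliton_curve F A) t = - complex_of_real (Im (A t)) * (\<i> * (phase F t * cnj c))"
proof -
  let ?\<alpha> = "soliton_curve F A" and ?u = "phase F t * cnj c"
  have J: "open J" using ode by (simp add: soliton_ode_def)
  have "((\<lambda>t. phase F t * cnj c) has_vector_derivative
      (- \<i> * complex_of_real (Im (A t)) * phase F t) * cnj c) (at t)"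
    by (intro has_vector_derivative_mult_left soliton_odeD(3)[OF ode t])
  then have "(velocity ?\<alpha> has_vector_derivative
      (- \<i> * complex_of_real (Im (A t)) * phase F t) * cnj c) (at t)"
    by (rule has_vector_derivative_transform_within_open[OF _ J t])
      (use soliton_curve_velocity[OF ode] in auto)
  then have vv: "velocity (velocity ?\<alpha>) t = complex_of_real (- Im (A t)) * (\<i> * ?u)"
    by (simp add: velocity_def[of "velocity ?\<alpha>"] vector_derivative_at mult_ac)
  have "?u \<noteq> 0" using assms(2) by (auto simp: phase_def)
  then have "curvature ?\<alpha> t = - Im (A t)"
    unfolding curvature_def vv soliton_curve_velocity[OF ode t]
    by (intro the_equality) (simp_all only: mult_cancel_right complex_i_not_zero of_real_eq_iff mult_eq_0_iff simp_thms)
  then show ?thesis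
    by (simp add: curvature_vector_def soliton_curve_velocity[OF ode t])
qed

text \<open>In the frame of the tangent, the position is \<open>cnj (A t) * cis \<psi>\<close>; the
  coefficients \<open>cos \<psi>\<close> and \<open>- sin \<psi>\<close> undo the rotation by
  \<open>\<psi>\<close>, and \<open>- Im (A t)\<close>, the curvature, remains. Taking
  \<open>\<psi> = \<theta>\<close> gives the equation of \<open>\<omega>\<close>, and
  \<open>\<psi> = \<theta> + pi\<close> flips both signs and gives that of
  \<open>\<alpha>\<close>.\<close>

lemma soliton_curve_equation:
  assumes ode: "soliton_ode (cis \<psi>) J F A" and t: "t \<in> J"
  defines "\<alpha> \<equiv> soliton_curve F A"
  shows "curvature_vector \<alpha> t =
    cos \<psi> *\<^sub>R curve_perp \<alpha> t (\<alpha> t) - sin \<psi> *\<^sub>R curve_perp \<alpha> t (\<i> * \<alpha> t)"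
proof -
  let ?u = "phase F t * cnj (cis \<psi>)"
  have u: "norm ?u = 1" by (simp add: norm_mult)
  have \<alpha>u: "\<alpha> t * cnj ?u = cnj (A t) * cis \<psi>"
    using phase_cnj_phase[of F t] by (simp add: \<alpha>_def soliton_curve_def algebra_simps)
  have perp: "curve_perp \<alpha> t v = complex_of_real (Im (v * cnj ?u)) * (\<i> * ?u)" for v
    unfolding curve_perp_def \<alpha>_def soliton_curve_velocity[OF ode t]
    by (rule normal_component_span_unit[OF u])
  \<comment> \<open>A polynomial identity in the two parts of \<open>cis \<psi>\<close>; the factor
    \<open>p * p + q * q\<close> is \<open>1\<close> for cosine and sine.\<close>
  have "p * Im (cnj (A t) * Complex p q) - q * Im (\<i> * (cnj (A t) * Complex p q)) = - Im (A t) * (p * p + q * q)"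
    for p q by (simp add: algebra_simps)
  from this[of "cos \<psi>" "sin \<psi>"]
  have re: "cos \<psi> * Im (cnj (A t) * cis \<psi>) - sin \<psi> * Im (\<i> * (cnj (A t) * cis \<psi>)) = - Im (A t)"
    by (simp add: cis.code)
  have "cos \<psi> *\<^sub>R curve_perp \<alpha> t (\<alpha> t) - sin \<psi> *\<^sub>R curve_perp \<alpha> t (\<i> * \<alpha> t)
      = complex_of_real (cos \<psi> * Im (\<alpha> t * cnj ?u) - sin \<psi> * Im (\<i> * (\<alpha> t * cnj ?u))) * (\<i> * ?u)"
    unfolding perp by (simp add: scaleR_conv_of_real left_diff_distrib mult.assoc)
  also have "\<dots> = curvature_vector \<alpha> t"
    unfolding \<alpha>u re using soliton_curve_curvature_vector[OF ode _ t] by (simp add: \<alpha>_def)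
  finally show ?thesis ..
qed

text \<open>With this determination, minus the sum of the two arguments is
  \<open>Im (F t) + Im (G s)\<close> up to a constant, which is the imaginary part wanted in the
  first coordinate.\<close>

lemma soliton_curve_continuous_arg:
  assumes ode: "soliton_ode (cis \<psi>) J F A"
  shows "continuous_arg J (velocity (soliton_curve F A)) (\<lambda>t. - Im (F t) - \<psi>)"
  unfolding continuous_arg_def
proof (intro conjI ballI)
  have "continuous (at t) F" if "t \<in> J" for t
    using soliton_odeD(1)[OF ode that] has_vector_derivative_continuous by blast
  then have "continuous_on J F"
    by (auto intro: continuous_at_imp_continuous_on)
  then show "continuous_on J (\<lambda>t. - Im (F t) - \<psi>)"
    by (intro continuous_intros)
  show "velocity (soliton_curve F A) t =
      complex_of_real (norm (velocity (soliton_curve F A) t)) * cis (- Im (F t) - \<psi>)" if "t \<in> J" for t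
    unfolding soliton_curve_velocity[OF ode that]
    by (simp add: norm_mult phase_def cis_cnj cis_mult)
qed

text \<open>Slowing time by \<open>l\<close> keeps the values of \<open>F\<close>, hence the phase,
  and divides the constant by \<open>l\<close> squared. With \<open>l\<close> squared equal to
  \<open>norm c\<close> the rescaled constant is unimodular and the curve has unit speed.\<close>

lemma soliton_ode_scale:
  assumes ode: "soliton_ode c J F A" and l: "l > 0"
  shows "soliton_ode (c / complex_of_real (l\<^sup>2)) ((*) l ` J) (\<lambda>t. F (t / l)) (\<lambda>t. A (t / l) / complex_of_real l)"
  unfolding soliton_ode_def
proof (intro conjI ballI)
  have J: "open J" "is_interval J" using ode by (auto simp: soliton_ode_def)
  have "l \<noteq> 0" using l by simp
  from open_scaling[OF this J(1)] show "open ((*) l ` J)" by simp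
  have "connected ((*) l ` J)"
    by (intro connected_continuous_image continuous_intros) (use J(2) is_interval_connected in auto)
  then show "is_interval ((*) l ` J)" by (simp add: is_interval_connected_1)
  fix t assume "t \<in> (*) l ` J"
  then have t: "t / l \<in> J" using l by auto
  have d: "((\<lambda>t. t / l) has_vector_derivative 1 / l) (at t)"
    using l by (auto intro!: derivative_eq_intros simp flip: has_real_derivative_iff_has_vector_derivative)
  have "((F \<circ> (\<lambda>t. t / l)) has_vector_derivative (1 / l) *\<^sub>R A (t / l)) (at t)"
    by (rule vector_diff_chain_at[OF d soliton_odeD(1)[OF ode t]])
  then show "((\<lambda>t. F (t / l)) has_vector_derivative A (t / l) / complex_of_real l) (at t)"
    by (simp add: comp_def scaleR_conv_of_real divide_inverse mult.commute)
  have "((A \<circ> (\<lambda>t. t / l)) has_vector_derivative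
      (1 / l) *\<^sub>R (c - \<i> * complex_of_real (Im (A (t / l))) * A (t / l))) (at t)"
    by (rule vector_diff_chain_at[OF d soliton_odeD(2)[OF ode t]])
  from has_vector_derivative_divide[OF this, of "complex_of_real l"]
  show "((\<lambda>t. A (t / l) / complex_of_real l) has_vector_derivative
      c / complex_of_real (l\<^sup>2)
        - \<i> * complex_of_real (Im (A (t / l) / complex_of_real l)) * (A (t / l) / complex_of_real l)) (at t)"
    using l by (simp add: comp_def scaleR_conv_of_real field_simps power2_eq_square)
qed

text \<open>The first coordinate of \<open>curve_star\<close> is a function of \<open>t\<close> plus
  a function of \<open>s\<close>, so it suffices to compare each summand with \<open>F\<close> or
  \<open>G\<close> by its derivative.\<close>

lemma soliton_curve_star:
  assumes F: "soliton_ode (- cis \<theta>) I F A" and G: "soliton_ode (cis \<theta>) K G B"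
    and \<theta>: "0 \<le> \<theta>" "\<theta> < pi" and t0: "t0 \<in> I" and s0: "s0 \<in> K"
  shows "\<exists>C. \<forall>t\<in>I. \<forall>s\<in>K.
    curve_star \<theta> (soliton_curve F A) (soliton_curve G B) (\<lambda>t. - Im (F t) - (\<theta> + pi)) (\<lambda>s. - Im (G s) - \<theta>) t0 s0 (t, s)
      = (F t + G s + C, soliton_curve F A t * soliton_curve G B s)"
proof -
  have IK: "is_interval I" "is_interval K" using F G by (auto simp: soliton_ode_def)
  have Im': "((\<lambda>t. Im (f t)) has_vector_derivative Im f') (at t)"
    and Re': "((\<lambda>t. Re (f t)) has_vector_derivative Re f') (at t)"
    if "(f has_vector_derivative f') (at t)" for f f' t
    using that bounded_linear.has_vector_derivative bounded_linear_Im bounded_linear_Re by blast+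
  have norm_curve: "(norm (soliton_curve F' A' t))\<^sup>2 = (Re (A' t))\<^sup>2 + (Im (A' t))\<^sup>2" for F' A' t
    by (simp add: soliton_curve_def norm_mult cmod_power2)
  show ?thesis
  proof (cases "\<theta> = pi / 2")
    case False
    have cos: "cos \<theta> \<noteq> 0"
      using False \<theta> cos_zero_iff_int cos_inj_pi[of \<theta> "pi / 2"] by auto
    \<comment> \<open>One computation for both curves: \<open>e = - 1\<close> for
      \<open>\<alpha>\<close> and \<open>e = 1\<close> for \<open>\<omega>\<close>. The same sign
      stands before the constant of the equation and before the squared norm.\<close>
    have aux: "\<exists>C. \<forall>t\<in>J. complex_of_real ((norm (soliton_curve F' A' t))\<^sup>2 * (e / (2 * cos \<theta>)))
        + (complex_of_real (tan \<theta>) - \<i>) * complex_of_real (- Im (F' t) - k) - F' t = C"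
      if ode: "soliton_ode (e * cis \<theta>) J F' A'" and e: "e = 1 \<or> e = - 1" for e :: real and J F' A' k
    proof (rule constant_on_interval_of_zero_derivative)
      show "is_interval J" using ode by (simp add: soliton_ode_def)
      fix t assume t: "t \<in> J"
      note d = soliton_odeD[OF ode t]
      let ?A' = "e * cis \<theta> - \<i> * complex_of_real (Im (A' t)) * A' t"
      let ?n = "(2 * Re (A' t) * Re ?A' + 2 * Im (A' t) * Im ?A') * (e / (2 * cos \<theta>))"
      have "((\<lambda>t. ((Re (A' t))\<^sup>2 + (Im (A' t))\<^sup>2) * (e / (2 * cos \<theta>))) has_real_derivative ?n) (at t)"
        by (rule derivative_eq_intros Re'[OF d(2), folded has_real_derivative_iff_has_vector_derivative]
            Im'[OF d(2), folded has_real_derivative_iff_has_vector_derivative] refl)+ simp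
      then have n: "((\<lambda>t. (norm (soliton_curve F' A' t))\<^sup>2 * (e / (2 * cos \<theta>))) has_real_derivative ?n) (at t)"
        by (simp add: norm_curve)
      have a: "((\<lambda>t. - Im (F' t) - k) has_real_derivative - Im (A' t)) (at t)"
        by (rule derivative_eq_intros Im'[OF d(1), folded has_real_derivative_iff_has_vector_derivative] refl)+ simp
      have "((\<lambda>t. complex_of_real ((norm (soliton_curve F' A' t))\<^sup>2 * (e / (2 * cos \<theta>)))
          + (complex_of_real (tan \<theta>) - \<i>) * complex_of_real (- Im (F' t) - k) - F' t)
          has_vector_derivative complex_of_real ?n
          + (complex_of_real (tan \<theta>) - \<i>) * complex_of_real (- Im (A' t)) - A' t) (at t)"
        by (intro has_vector_derivative_diff has_vector_derivative_add has_vector_derivative_of_real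
            has_vector_derivative_mult_right n a d(1))
      \<comment> \<open>The term \<open>\<i> * Im A' * A'\<close> is a rotation and does not change
        the norm of \<open>A'\<close>; only \<open>e * cis \<theta>\<close> contributes, and
        \<open>e * e = 1\<close>.\<close>
      moreover have "?n = Re (A' t) + tan \<theta> * Im (A' t)"
        using cos e by (auto simp: field_simps tan_def power2_eq_square)
      then have "complex_of_real ?n + (complex_of_real (tan \<theta>) - \<i>) * complex_of_real (- Im (A' t)) - A' t = 0"
        by (simp add: complex_eq_iff)
      ultimately show "((\<lambda>t. complex_of_real ((norm (soliton_curve F' A' t))\<^sup>2 * (e / (2 * cos \<theta>)))
          + (complex_of_real (tan \<theta>) - \<i>) * complex_of_real (- Im (F' t) - k) - F' t)
          has_vector_derivative 0) (at t)"
        by simp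
    qed
    obtain C1 where C1: "\<And>t. t \<in> I \<Longrightarrow> complex_of_real ((norm (soliton_curve F A t))\<^sup>2 * (- 1 / (2 * cos \<theta>)))
        + (complex_of_real (tan \<theta>) - \<i>) * complex_of_real (- Im (F t) - (\<theta> + pi)) - F t = C1"
      using aux[of "- 1" I F A "\<theta> + pi"] F by auto
    obtain C2 where C2: "\<And>s. s \<in> K \<Longrightarrow> complex_of_real ((norm (soliton_curve G B s))\<^sup>2 * (1 / (2 * cos \<theta>)))
        + (complex_of_real (tan \<theta>) - \<i>) * complex_of_real (- Im (G s) - \<theta>) - G s = C2"
      using aux[of 1 K G B "\<theta>"] G by auto
    show ?thesis
    proof (intro exI[of _ "C1 + C2"] ballI)
      fix t s assume t: "t \<in> I" and s: "s \<in> K"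
      have split: "((norm (soliton_curve G B s))\<^sup>2 - (norm (soliton_curve F A t))\<^sup>2) / (2 * cos \<theta>)
          = (norm (soliton_curve F A t))\<^sup>2 * (- 1 / (2 * cos \<theta>)) + (norm (soliton_curve G B s))\<^sup>2 * (1 / (2 * cos \<theta>))"
        by (simp add: diff_divide_distrib)
      have "complex_of_real (((norm (soliton_curve G B s))\<^sup>2 - (norm (soliton_curve F A t))\<^sup>2) / (2 * cos \<theta>))
          + (complex_of_real (tan \<theta>) - \<i>) * complex_of_real (- Im (F t) - (\<theta> + pi) + (- Im (G s) - \<theta>))
          = F t + G s + (C1 + C2)"
        unfolding split of_real_add distrib_left C1[OF t, symmetric] C2[OF s, symmetric]
        by (simp add: algebra_simps C1[OF t, symmetric] C2[OF s, symmetric])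
      then show "curve_star \<theta> (soliton_curve F A) (soliton_curve G B) (\<lambda>t. - Im (F t) - (\<theta> + pi))
          (\<lambda>s. - Im (G s) - \<theta>) t0 s0 (t, s)
          = (F t + G s + (C1 + C2), soliton_curve F A t * soliton_curve G B s)"
        using False by (simp add: curve_star_def)
    qed
  next
    case True
    \<comment> \<open>For \<open>\<theta> = pi / 2\<close> the two phases in the integrand cancel
      and leave \<open>- e * Re (A' x)\<close>, whose primitive is
      \<open>- e * Re (F' x)\<close>.\<close>
    have int: "(LBINT x=a..b. velocity (soliton_curve F' A') x \<bullet> (\<i> * soliton_curve F' A' x)) = - e * (Re (F' b) - Re (F' a))"
      if ode: "soliton_ode (of_real e * \<i>) J F' A'" and e: "e = 1 \<or> e = - 1" and ab: "a \<in> J" "b \<in> J"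
      for e :: real and J F' A' a b
    proof -
      have J: "open J" "is_interval J" using ode by (auto simp: soliton_ode_def)
      \<comment> \<open>The integral is oriented and \<open>b\<close> may lie to the left of
        \<open>a\<close>.\<close>
      have sub: "{min a b..max a b} \<subseteq> J"
        using mem_is_interval_1_I[OF J(2), of "min a b" "max a b"] ab by (cases "a \<le> b") auto
      have v: "velocity (soliton_curve F' A') x \<bullet> (\<i> * soliton_curve F' A' x) = - e * Re (A' x)" if "x \<in> J" for x
      proof -
        have "velocity (soliton_curve F' A') x * cnj (\<i> * soliton_curve F' A' x)
            = - (complex_of_real e * A' x) * (phase F' x * cnj (phase F' x))"
          unfolding soliton_curve_velocity[OF ode that] soliton_curve_def by (simp add: algebra_simps)
        then show ?thesis unfolding inner_complex_eq_Re by simp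
      qed
      have "continuous (at x) A'" if "x \<in> J" for x
        using soliton_odeD(2)[OF ode that] has_vector_derivative_continuous by blast
      then have "continuous_on {min a b..max a b} A'"
        using sub by (auto intro!: continuous_at_imp_continuous_on)
      then have c: "continuous_on {min a b..max a b} (\<lambda>x. - e * Re (A' x))"
        by (intro continuous_intros)
      have "(LBINT x=a..b. velocity (soliton_curve F' A') x \<bullet> (\<i> * soliton_curve F' A' x)) = (LBINT x=a..b. - e * Re (A' x))"
      proof (rule interval_integral_cong)
        fix x assume "x \<in> einterval (min (ereal a) (ereal b)) (max (ereal a) (ereal b))"
        then have "x \<in> {min a b..max a b}"
          by (auto simp: einterval_iff min_def max_def split: if_splits)
        then show "velocity (soliton_curve F' A') x \<bullet> (\<i> * soliton_curve F' A' x) = - e * Re (A' x)"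
          using sub v by blast
      qed
      also have "\<dots> = - e * Re (F' b) - - e * Re (F' a)"
      proof (rule interval_integral_FTC_finite[OF c])
        fix x assume "min a b \<le> x" "x \<le> max a b"
        then have "x \<in> J" using sub by auto
        from Re'[OF soliton_odeD(1)[OF ode this]]
        show "((\<lambda>x. - e * Re (F' x)) has_vector_derivative - e * Re (A' x)) (at x within {min a b..max a b})"
          by (rule has_vector_derivative_at_within[OF has_vector_derivative_mult_right])
      qed
      finally show ?thesis by (simp add: algebra_simps)
    qed
    have eqs: "cis \<theta> = \<i>" unfolding True by (rule cis_pi_half)
    show ?thesis
    \<comment> \<open>The constant collects the offsets \<open>\<theta> + pi\<close> and
      \<open>\<theta>\<close> of the chosen arguments and the real parts at the base points of the
      integrals.\<close>
    proof (intro exI[of _ "\<i> * complex_of_real (2 * \<theta> + pi) - Re (F t0) - Re (G s0)"] ballI)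
      fix t s assume t: "t \<in> I" and s: "s \<in> K"
      have 1: "(LBINT x=t0..t. velocity (soliton_curve F A) x \<bullet> (\<i> * soliton_curve F A x)) = Re (F t) - Re (F t0)"
        using int[of "- 1" I F A t0 t] F t t0 by (simp add: eqs)
      have 2: "(LBINT x=s0..s. velocity (soliton_curve G B) x \<bullet> (\<i> * soliton_curve G B x)) = - (Re (G s) - Re (G s0))"
        using int[of 1 K G B s0 s] G s s0 by (simp add: eqs)
      show "curve_star \<theta> (soliton_curve F A) (soliton_curve G B) (\<lambda>t. - Im (F t) - (\<theta> + pi))
          (\<lambda>s. - Im (G s) - \<theta>) t0 s0 (t, s)
          = (F t + G s + (\<i> * complex_of_real (2 * \<theta> + pi) - Re (F t0) - Re (G s0)),
             soliton_curve F A t * soliton_curve G B s)"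
        using True unfolding curve_star_def by (simp add: 1 2 complex_eq_iff algebra_simps)
    qed
  qed
qed

section \<open>Grim reapers\<close>

lemma one_minus_tanh_square: "1 - (tanh x)\<^sup>2 = 1 / (cosh x)\<^sup>2" for x :: real
proof -
  have "1 - (tanh x)\<^sup>2 = ((cosh x)\<^sup>2 - (sinh x)\<^sup>2) / (cosh x)\<^sup>2"
    unfolding tanh_def using cosh_real_pos[of x] by (simp only: power_divide diff_divide_distrib) simp
  then show ?thesis
    by (simp only: hyperbolic_pythagoras)
qed

text \<open>The half-argument identity \<open>1 + tanh (s/2)^2 = cosh s / cosh (s/2)^2\<close>
  simplifies the derivative of the arctangent. The unit vector obtained is the form in which the
  solutions with \<open>c = 0\<close> are recognised.\<close>

lemma has_vector_derivative_grim_reaper: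
  "(grim_reaper has_vector_derivative Complex (tanh s) (1 / cosh s)) (at s)"
proof -
  have c: "cosh s > 0" "cosh (s / 2) > 0" by (simp_all add: cosh_real_pos)
  have 1: "((\<lambda>s. ln (cosh s)) has_real_derivative tanh s) (at s)"
    using c by (auto intro!: derivative_eq_intros simp: tanh_def)
  have "(tanh has_real_derivative 1 - (tanh (s / 2))\<^sup>2) (at (s / 2))"
    using c by (auto intro!: derivative_eq_intros)
  then have "((\<lambda>s. tanh (s / 2)) has_real_derivative (1 - (tanh (s / 2))\<^sup>2) * (1 / 2)) (at s)"
    by (rule DERIV_chain2) (auto intro!: derivative_eq_intros)
  then have "((\<lambda>s. 2 * arctan (tanh (s / 2))) has_real_derivative
      2 * (inverse (1 + (tanh (s / 2))\<^sup>2) * ((1 - (tanh (s / 2))\<^sup>2) * (1 / 2)))) (at s)"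
    by (intro DERIV_cmult DERIV_chain2[OF DERIV_arctan])
  moreover have "2 * (inverse (1 + (tanh (s / 2))\<^sup>2) * ((1 - (tanh (s / 2))\<^sup>2) * (1 / 2))) = 1 / cosh s"
  proof -
    have cs: "cosh s = (cosh (s / 2))\<^sup>2 + (sinh (s / 2))\<^sup>2"
      using cosh_double[of "s / 2"] by simp
    have "1 + (tanh (s / 2))\<^sup>2 = cosh s / (cosh (s / 2))\<^sup>2"
      unfolding cs tanh_def using c(2) by (simp add: power_divide add_divide_distrib)
    then show ?thesis using c one_minus_tanh_square[of "s / 2"] by simp
  qed
  ultimately have 2: "((\<lambda>s. 2 * arctan (tanh (s / 2))) has_real_derivative 1 / cosh s) (at s)"
    by simp
  have "((\<lambda>s. complex_of_real (ln (cosh s)) + \<i> * complex_of_real (2 * arctan (tanh (s / 2))))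
      has_vector_derivative complex_of_real (tanh s) + \<i> * complex_of_real (1 / cosh s)) (at s)"
    by (intro has_vector_derivative_add has_vector_derivative_mult_right has_vector_derivative_of_real 1 2)
  then show ?thesis
    by (simp add: grim_reaper_def[abs_def] complex_eq_iff[of "Complex _ _"] Complex_eq mult_ac)
qed

lemma tanh_artanh_real:
  fixes y :: real
  assumes "\<bar>y\<bar> < 1"
  shows "tanh (artanh y) = y"
proof -
  have pos: "(1 + y) / (1 - y) > 0" using assms by simp
  have "exp (- 2 * artanh y) = inverse (exp (ln ((1 + y) / (1 - y))))"
    by (simp add: artanh_def exp_minus)
  also have "\<dots> = (1 - y) / (1 + y)" using pos by simp
  finally have e: "exp (- 2 * artanh y) = (1 - y) / (1 + y)" .
  show ?thesis
    unfolding tanh_real_altdef e using assms by (simp add: field_simps)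
qed

text \<open>For \<open>c = 0\<close> the curve has velocity zero, so \<open>A\<close> is a fixed
  multiple of the phase and has constant modulus \<open>norm m\<close>.\<close>

lemma soliton_ode_zero:
  assumes ode: "soliton_ode 0 J F A"
  obtains m where "\<And>t. t \<in> J \<Longrightarrow> soliton_curve F A t = m" "\<And>t. t \<in> J \<Longrightarrow> A t = cnj m * phase F t"
proof -
  have "\<exists>m. \<forall>t\<in>J. soliton_curve F A t = m"
    by (rule constant_on_interval_of_zero_derivative)
      (use ode soliton_odeD(4)[OF ode] in \<open>auto simp: soliton_ode_def\<close>)
  then obtain m where m: "\<And>t. t \<in> J \<Longrightarrow> soliton_curve F A t = m" by blast
  have "A t = cnj m * phase F t" if "t \<in> J" for t
    unfolding m[OF that, symmetric] soliton_curve_def using phase_cnj_phase[of F t]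
    by (simp add: mult.commute mult.left_commute)
  with m show ?thesis using that by blast
qed

text \<open>Along a solution with \<open>c = 0\<close>, \<open>Im A\<close> is a constant multiple of \<open>exp (- Re F)\<close>, so it
  vanishes identically or nowhere.\<close>

lemma soliton_ode_zero_cases:
  assumes ode: "soliton_ode 0 J F A"
    and curve: "\<forall>t\<in>J. soliton_curve F A t = m"
  obtains (line) u where "norm u = 1" "\<And>t. t \<in> J \<Longrightarrow> phase F t = u"
  | (grim) \<sigma> k where "m \<noteq> 0" "\<sigma> = 1 \<or> \<sigma> = - 1"
      "\<And>t. t \<in> J \<Longrightarrow> ((\<lambda>t. grim_reaper (\<sigma> * (norm m * t + k)) / cnj m) has_vector_derivative phase F t) (at t)"
proof (cases "\<forall>t\<in>J. Im (A t) = 0")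
  case True
  have J: "is_interval J" using ode by (simp add: soliton_ode_def)
  have "\<exists>u. \<forall>t\<in>J. phase F t = u"
    by (rule constant_on_interval_of_zero_derivative[OF J])
      (use soliton_odeD(3)[OF ode] True in auto)
  then obtain u where u: "\<And>t. t \<in> J \<Longrightarrow> phase F t = u" by blast
  show ?thesis
  \<comment> \<open>That \<open>u\<close> is a unit is read off at a point of \<open>J\<close>; for
    empty \<open>J\<close> any unit serves.\<close>
  proof (cases "J = {}")
    case True
    then show ?thesis by (intro line[of 1]) auto
  next
    case False
    then show ?thesis using u norm_phase by (intro line[of u]) force+
  qed
next
  case False
  then obtain t1 where t1: "t1 \<in> J" "Im (A t1) \<noteq> 0" by blast
  have J: "is_interval J" using ode by (simp add: soliton_ode_def)
  define \<rho> where "\<rho> = norm m"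
  have normA: "norm (A t) = \<rho>" if "t \<in> J" for t
    unfolding \<rho>_def curve[rule_format, OF that, symmetric] by (simp add: soliton_curve_def norm_mult)
  then have A2: "(Re (A t))\<^sup>2 + (Im (A t))\<^sup>2 = \<rho>\<^sup>2" if "t \<in> J" for t
    using that by (metis cmod_power2)
  have \<rho>: "\<rho> > 0" using normA[OF t1(1)] t1(2) by auto
  have m: "m \<noteq> 0" using \<rho> \<rho>_def by auto
  have dF: "((\<lambda>t. Re (F t)) has_real_derivative Re (A t)) (at t)"
    and dRe: "((\<lambda>t. Re (A t)) has_real_derivative (Im (A t))\<^sup>2) (at t)"
    and dIm: "((\<lambda>t. Im (A t)) has_real_derivative - Re (A t) * Im (A t)) (at t)" if "t \<in> J" for t
    using bounded_linear.has_vector_derivative[OF bounded_linear_Re soliton_odeD(1)[OF ode that]]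
      bounded_linear.has_vector_derivative[OF bounded_linear_Re soliton_odeD(2)[OF ode that]]
      bounded_linear.has_vector_derivative[OF bounded_linear_Im soliton_odeD(2)[OF ode that]]
    by (simp_all add: has_real_derivative_iff_has_vector_derivative power2_eq_square mult.commute)
  \<comment> \<open>With \<open>c = 0\<close>, \<open>Im A\<close> has derivative
    \<open>- Re A * Im A\<close>, while \<open>Re A\<close> is the derivative of
    \<open>Re F\<close>; so the exponential factor compensates exactly.\<close>
  have "\<exists>\<kappa>. \<forall>t\<in>J. Im (A t) * exp (Re (F t)) = \<kappa>"
  proof (rule constant_on_interval_of_zero_derivative[OF J])
    fix t assume t: "t \<in> J"
    have "((\<lambda>t. Im (A t) * exp (Re (F t))) has_real_derivative 0) (at t)"
      by (rule derivative_eq_intros dIm[OF t] dF[OF t] refl)+ (simp add: algebra_simps)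
    then show "((\<lambda>t. Im (A t) * exp (Re (F t))) has_vector_derivative 0) (at t)"
      by (simp add: has_real_derivative_iff_has_vector_derivative)
  qed
  then obtain \<kappa> where \<kappa>: "\<And>t. t \<in> J \<Longrightarrow> Im (A t) * exp (Re (F t)) = \<kappa>" by blast
  have "\<kappa> \<noteq> 0" using \<kappa>[OF t1(1)] t1(2) by auto
  \<comment> \<open>The velocity of \<open>grim_reaper\<close> has positive imaginary part.
    Reversing the parameter flips the sign of that part alone, because \<open>tanh\<close> is odd
    and \<open>cosh\<close> is even.\<close>
  define \<sigma> where "\<sigma> = sgn \<kappa>"
  have \<sigma>: "\<sigma> = 1 \<or> \<sigma> = - 1" using \<open>\<kappa> \<noteq> 0\<close> by (auto simp: \<sigma>_def sgn_if)
  have Im_sgn: "Im (A t) = \<sigma> * \<bar>Im (A t)\<bar>" and Im0: "Im (A t) \<noteq> 0" if "t \<in> J" for t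
    unfolding \<sigma>_def \<kappa>[OF that, symmetric] using \<kappa>[OF that] \<open>\<kappa> \<noteq> 0\<close>
    by (auto simp: sgn_mult sgn_mult_abs)
  have Re_less: "\<bar>Re (A t) / \<rho>\<bar> < 1" if "t \<in> J" for t
  proof -
    have "(Re (A t))\<^sup>2 < \<rho>\<^sup>2" using A2[OF that] Im0[OF that] by (smt (verit) zero_less_power2)
    then have "\<bar>Re (A t)\<bar> < \<rho>" using \<rho> by (metis abs_of_pos abs_le_square_iff linorder_not_le)
    then show ?thesis using \<rho> by simp
  qed
  \<comment> \<open>The quotient \<open>y = Re (A t) / \<rho>\<close> satisfies the Riccati equation
    \<open>y' = \<rho> * (1 - y^2)\<close>, so its \<open>artanh\<close> has slope
    \<open>\<rho>\<close>.\<close>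
  have "\<exists>k. \<forall>t\<in>J. artanh (Re (A t) / \<rho>) - \<rho> * t = k"
  proof (rule constant_on_interval_of_zero_derivative[OF J])
    fix t assume t: "t \<in> J"
    have *: "1 - (Re (A t) / \<rho>)\<^sup>2 = (Im (A t))\<^sup>2 / \<rho>\<^sup>2"
      using A2[OF t] \<rho> by (simp add: field_simps)
    have "1 / (1 - (Re (A t) / \<rho>)\<^sup>2) * ((Im (A t))\<^sup>2 / \<rho>) = \<rho>"
      unfolding * using Im0[OF t] \<rho> by (simp add: field_simps power2_eq_square)
    moreover have "((\<lambda>t. artanh (Re (A t) / \<rho>)) has_real_derivative
        1 / (1 - (Re (A t) / \<rho>)\<^sup>2) * ((Im (A t))\<^sup>2 / \<rho>)) (at t)"
      by (rule DERIV_chain2[where f = artanh and g = "\<lambda>t. Re (A t) / \<rho>", OF artanh_real_has_field_derivative[OF Re_less[OF t]]])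
        (use DERIV_cdivide[OF dRe[OF t]] in simp)
    ultimately have "((\<lambda>t. artanh (Re (A t) / \<rho>) - \<rho> * t) has_real_derivative \<rho> - \<rho> * 1) (at t)"
      by (intro DERIV_diff DERIV_cmult DERIV_ident) simp
    then show "((\<lambda>t. artanh (Re (A t) / \<rho>) - \<rho> * t) has_vector_derivative 0) (at t)"
      by (simp add: has_real_derivative_iff_has_vector_derivative)
  qed
  then obtain k where k: "\<And>t. t \<in> J \<Longrightarrow> artanh (Re (A t) / \<rho>) = \<rho> * t + k"
    by (metis add.commute diff_eq_eq)
  show ?thesis
  proof (rule grim[OF m \<sigma>, of k])
    fix t assume t: "t \<in> J"
    let ?h = "\<rho> * t + k"
    have Re: "Re (A t) = \<rho> * tanh ?h"
      using tanh_artanh_real[OF Re_less[OF t]] k[OF t] \<rho> by (simp add: field_simps)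
    have "(Im (A t))\<^sup>2 = (\<rho> / cosh ?h)\<^sup>2"
    proof -
      have "(Im (A t))\<^sup>2 = \<rho>\<^sup>2 * (1 - (tanh ?h)\<^sup>2)"
        using A2[OF t] unfolding Re by (simp add: algebra_simps power_mult_distrib)
      also have "1 - (tanh ?h)\<^sup>2 = 1 / (cosh ?h)\<^sup>2"
        by (rule one_minus_tanh_square)
      finally show ?thesis by (simp add: power_divide)
    qed
    then have "\<bar>Im (A t)\<bar> = \<rho> / cosh ?h"
      using \<rho> by (metis abs_of_pos cosh_real_pos divide_pos_pos power2_eq_iff abs_minus)
    then have Im: "Im (A t) = \<sigma> * (\<rho> / cosh ?h)" using Im_sgn[OF t] by simp
    have d: "((\<lambda>t. \<sigma> * (\<rho> * t + k)) has_vector_derivative \<sigma> * \<rho>) (at t)"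
      by (auto intro!: derivative_eq_intros simp flip: has_real_derivative_iff_has_vector_derivative)
    have "((grim_reaper \<circ> (\<lambda>t. \<sigma> * (\<rho> * t + k))) has_vector_derivative
        (\<sigma> * \<rho>) *\<^sub>R Complex (tanh (\<sigma> * ?h)) (1 / cosh (\<sigma> * ?h))) (at t)"
      by (rule vector_diff_chain_at[OF d has_vector_derivative_grim_reaper])
    moreover have "(\<sigma> * \<rho>) *\<^sub>R Complex (tanh (\<sigma> * h)) (1 / cosh (\<sigma> * h))
        = Complex (\<rho> * tanh h) (\<sigma> * (\<rho> / cosh h))" for h
      using \<sigma> by (auto simp: complex_eq_iff)
    then have "(\<sigma> * \<rho>) *\<^sub>R Complex (tanh (\<sigma> * ?h)) (1 / cosh (\<sigma> * ?h)) = A t"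
      using Re Im by (simp add: complex_eq_iff)
    ultimately have "((\<lambda>t. grim_reaper (\<sigma> * (\<rho> * t + k)) / cnj m) has_vector_derivative A t / cnj m) (at t)"
      by (intro has_vector_derivative_divide) (simp add: comp_def)
    moreover have "A t / cnj m = phase F t"
      unfolding curve[rule_format, OF t, symmetric] soliton_curve_def
      using phase_cnj_phase[of F t] Im0[OF t] by (auto simp: field_simps phase_def)
    ultimately show "((\<lambda>t. grim_reaper (\<sigma> * (norm m * t + k)) / cnj m) has_vector_derivative phase F t) (at t)"
      by (simp add: \<rho>_def)
  qed
qed

section \<open>Integration of the soliton equations\<close>

lemma constant_on_box_of_zero_partials:
  fixes h :: "real \<Rightarrow> real \<Rightarrow> 'b::real_normed_vector"
  assumes IK: "is_interval I" "is_interval K"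
    and x: "\<And>x y. x \<in> I \<Longrightarrow> y \<in> K \<Longrightarrow> ((\<lambda>x. h x y) has_vector_derivative 0) (at x)"
    and y: "\<And>x y. x \<in> I \<Longrightarrow> y \<in> K \<Longrightarrow> (h x has_vector_derivative 0) (at y)"
  obtains C where "\<And>x y. x \<in> I \<Longrightarrow> y \<in> K \<Longrightarrow> h x y = C"
proof -
  have 1: "\<exists>C. \<forall>x\<in>I. h x y = C" if "y \<in> K" for y
    by (rule constant_on_interval_of_zero_derivative[OF IK(1)]) (use x that in blast)
  have 2: "\<exists>C. \<forall>y\<in>K. h x y = C" if "x \<in> I" for x
    by (rule constant_on_interval_of_zero_derivative[OF IK(2)]) (use y that in blast)
  have "h x y = h x' y'" if "x \<in> I" "y \<in> K" "x' \<in> I" "y' \<in> K" for x y x' y'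
    using 1[OF that(2)] 2[OF that(3)] that by metis
  then show ?thesis using that by (metis (full_types))
qed

text \<open>\<open>(A, p)\<close> and \<open>(B, q)\<close> are the columns of a multiple of a unitary matrix, and \<open>W\<close> is the
  phase of its determinant: for the immersion, \<open>exp\<close> of \<open>\<i>\<close> times the Lagrangian angle.\<close>

lemma conformal_unitary_columns:
  fixes A B p q :: complex
  assumes orth: "A * cnj B + p * cnj q = 0"
    and len: "A * cnj A + p * cnj p = B * cnj B + q * cnj q" "A * cnj A + p * cnj p \<noteq> 0"
  defines "W \<equiv> (q * A - p * B) / (A * cnj A + B * cnj B)"
  shows "A * cnj A + p * cnj p = A * cnj A + B * cnj B"
    "q = W * cnj A" "p = - (W * cnj B)" "W * cnj W = 1"
proof -
  define E where "E = A * cnj A + p * cnj p"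
  have E: "B * cnj B + q * cnj q = E" "E \<noteq> 0" "cnj E = E"
    using len by (auto simp: E_def mult.commute)
  have orth': "cnj A * B + cnj p * q = 0"
    using arg_cong[OF orth, of cnj] by simp
  let ?D = "q * A - p * B"
  \<comment> \<open>The two products \<open>?D * cnj A\<close> and \<open>?D * cnj B\<close> use
    orthogonality of the columns. They give the formulas for \<open>q\<close> and \<open>p\<close>
    once \<open>E\<close> is known to be the squared length of the row \<open>(A, B)\<close>
    too.\<close>
  have q: "?D * cnj A = q * E"
  proof -
    have "?D * cnj A = q * E - p * (cnj A * B + cnj p * q)"
      by (simp add: E_def algebra_simps)
    then show ?thesis using orth' by simp
  qed
  have p: "?D * cnj B = - (p * E)"
  proof -
    have "?D * cnj B = - (p * (B * cnj B + q * cnj q)) + q * (A * cnj B + p * cnj q)"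
      by (simp add: algebra_simps)
    then show ?thesis using orth E(1) by simp
  qed
  have DD: "?D * cnj ?D = E * E"
  proof -
    have "?D * cnj ?D = cnj q * (?D * cnj A) - cnj p * (?D * cnj B)"
      by (simp add: algebra_simps)
    also have "\<dots> = E * (q * cnj q + p * cnj p)"
      unfolding q p by (simp add: algebra_simps)
    finally have 1: "?D * cnj ?D = E * (q * cnj q + p * cnj p)" .
    have "(?D * cnj A) * cnj (?D * cnj A) = (q * E) * cnj (q * E)" "(?D * cnj B) * cnj (?D * cnj B) = (p * E) * cnj (p * E)"
      unfolding q p by simp_all
    then have "(?D * cnj ?D) * (A * cnj A) = E * E * (q * cnj q)" "(?D * cnj ?D) * (B * cnj B) = E * E * (p * cnj p)"
      using E(3) by (simp_all add: mult_ac)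
    then have "(?D * cnj ?D) * (A * cnj A + B * cnj B) = E * E * (q * cnj q + p * cnj p)"
      by (simp add: distrib_left)
    \<comment> \<open>With \<open>S\<close> and \<open>T\<close> the squared lengths of the rows
      \<open>(p, q)\<close> and \<open>(A, B)\<close>, facts 2 and 3 read
      \<open>S * T = E * S\<close> and \<open>S + T = 2 * E\<close>, so \<open>S = T = E\<close>
      unless \<open>S = 0\<close>. In that case \<open>(A, 0)\<close> and \<open>(B, 0)\<close>
      would be nonzero orthogonal columns in one complex line.\<close>
    then have 2: "(q * cnj q + p * cnj p) * (A * cnj A + B * cnj B) = E * (q * cnj q + p * cnj p)"
      unfolding 1 using E(2) by (simp add: mult_ac)
    have 3: "(q * cnj q + p * cnj p) + (A * cnj A + B * cnj B) = E + E"
      using E(1) E_def by (metis (no_types, opaque_lifting) add.assoc add.commute)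
    show ?thesis
    proof (cases "q * cnj q + p * cnj p = 0")
      case True
      then have "?D * cnj ?D = 0" unfolding 1 by simp
      then have "?D = 0" by (simp only: mult_eq_0_iff complex_cnj_zero_iff simp_thms)
      then have "q * E = 0" "p * E = 0" using q p by (metis mult_zero_left neg_0_equal_iff_equal)+
      then have "A * cnj A = E" "B * cnj B = E" "p = 0" "q = 0" using E E_def by auto
      moreover from this have "A * cnj B = 0" using orth by simp
      ultimately have False using E(2) by auto
      then show ?thesis ..
    next
      case False
      then have "A * cnj A + B * cnj B = E" using 2 by (simp add: mult.commute)
      then show ?thesis using 1 3 by simp
    qed
  qed
  have "?D \<noteq> 0" using DD E(2) by auto
  have EAB: "A * cnj A + B * cnj B = E"
  proof -
    have "?D * (A * cnj A + B * cnj B) = A * (?D * cnj A) + B * (?D * cnj B)"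
      by (simp add: algebra_simps)
    also have "\<dots> = ?D * E" unfolding q p by (simp add: algebra_simps)
    finally show ?thesis using \<open>?D \<noteq> 0\<close> by simp
  qed
  then show "A * cnj A + p * cnj p = A * cnj A + B * cnj B" by (simp add: E_def)
  have W: "W = ?D / E" using EAB by (simp add: W_def)
  show "q = W * cnj A" using q E(2) by (simp add: W field_simps)
  show "p = - (W * cnj B)" using p E(2) by (simp add: W field_simps)
  show "W * cnj W = 1" using DD E(2,3) by (simp add: W)
qed

text \<open>Here \<open>(A, p)\<close> and \<open>(B, q)\<close> are the partial derivatives of the immersion, written in a unitary
  frame whose first vector is the translating direction. Differentiating \<open>W\<close> and comparing with the soliton equation separates the variables.\<close>

lemma soliton_separation:
  fixes A B A' B' :: "real \<Rightarrow> complex" and p q pxx pxy qyy :: "real \<Rightarrow> real \<Rightarrow> complex"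
  assumes I: "open I" "is_interval I" "I \<noteq> {}" and K: "open K" "is_interval K" "K \<noteq> {}"
    and F: "\<And>x. x \<in> I \<Longrightarrow> (F has_vector_derivative A x) (at x)"
    and A: "\<And>x. x \<in> I \<Longrightarrow> (A has_vector_derivative A' x) (at x)"
    and G: "\<And>y. y \<in> K \<Longrightarrow> (G has_vector_derivative B y) (at y)"
    and B: "\<And>y. y \<in> K \<Longrightarrow> (B has_vector_derivative B' y) (at y)"
    and p_x: "\<And>x y. x \<in> I \<Longrightarrow> y \<in> K \<Longrightarrow> ((\<lambda>x. p x y) has_vector_derivative pxx x y) (at x)"
    and p_y: "\<And>x y. x \<in> I \<Longrightarrow> y \<in> K \<Longrightarrow> (p x has_vector_derivative pxy x y) (at y)"
    and q_x: "\<And>x y. x \<in> I \<Longrightarrow> y \<in> K \<Longrightarrow> ((\<lambda>x. q x y) has_vector_derivative pxy x y) (at x)"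
    and q_y: "\<And>x y. x \<in> I \<Longrightarrow> y \<in> K \<Longrightarrow> (q x has_vector_derivative qyy x y) (at y)"
    and orth: "\<And>x y. x \<in> I \<Longrightarrow> y \<in> K \<Longrightarrow> A x * cnj (B y) + p x y * cnj (q x y) = 0"
    and len: "\<And>x y. x \<in> I \<Longrightarrow> y \<in> K \<Longrightarrow>
      A x * cnj (A x) + p x y * cnj (p x y) = B y * cnj (B y) + q x y * cnj (q x y)"
    and imm: "\<And>x y. x \<in> I \<Longrightarrow> y \<in> K \<Longrightarrow> A x * cnj (A x) + p x y * cnj (p x y) \<noteq> 0"
    and sol_x: "\<And>x y. x \<in> I \<Longrightarrow> y \<in> K \<Longrightarrow>
      Im ((A' x + B' y) * cnj (A x) + (pxx x y + qyy x y) * cnj (p x y))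
        = - Re (A x * cnj (A x) + p x y * cnj (p x y)) * Im (A x)"
    and sol_y: "\<And>x y. x \<in> I \<Longrightarrow> y \<in> K \<Longrightarrow>
      Im ((A' x + B' y) * cnj (B y) + (pxx x y + qyy x y) * cnj (q x y))
        = - Re (A x * cnj (A x) + p x y * cnj (p x y)) * Im (B y)"
  obtains c W0 where "norm W0 = 1" "soliton_ode c I F A" "soliton_ode (- c) K G B"
    "\<And>x y. x \<in> I \<Longrightarrow> y \<in> K \<Longrightarrow> p x y = - (W0 * (phase F x * phase G y) * cnj (B y))"
    "\<And>x y. x \<in> I \<Longrightarrow> y \<in> K \<Longrightarrow> q x y = W0 * (phase F x * phase G y) * cnj (A x)"
proof -
  define W where "W x y = (q x y * A x - p x y * B y) / (A x * cnj (A x) + B y * cnj (B y))" for x y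
  have E: "A x * cnj (A x) + p x y * cnj (p x y) = A x * cnj (A x) + B y * cnj (B y)"
    and q: "q x y = W x y * cnj (A x)" and p: "p x y = - (W x y * cnj (B y))"
    and WW: "W x y * cnj (W x y) = 1" if "x \<in> I" "y \<in> K" for x y
    unfolding W_def using conformal_unitary_columns[OF orth len imm] that by blast+
  have AB: "A x * cnj (A x) + B y * cnj (B y) \<noteq> 0" if "x \<in> I" "y \<in> K" for x y
    using imm E that by metis
  have cnj_diff: "(\<lambda>t. cnj (f t)) differentiable (at t)" if "f differentiable (at t)" for f :: "real \<Rightarrow> complex" and t
    using that bounded_linear.has_derivative[OF bounded_linear_cnj] unfolding differentiable_def by blast
  have diff: "f differentiable (at t)" if "(f has_vector_derivative f') (at t)" for f :: "real \<Rightarrow> complex" and f' t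
    using that by (auto simp: has_vector_derivative_def differentiable_def)
  \<comment> \<open>Differentiating \<open>w * cnj w = 1\<close> shows that the logarithmic
    derivative is purely imaginary.\<close>
  have W_rot: "\<exists>\<mu>. (w has_vector_derivative \<i> * complex_of_real \<mu> * w t) (at t)"
    if w: "w differentiable (at t)" "open J" "t \<in> J" "\<And>s. s \<in> J \<Longrightarrow> w s * cnj (w s) = 1" for w :: "real \<Rightarrow> complex" and J t
  proof -
    obtain w' where w': "(w has_vector_derivative w') (at t)"
      using w(1) vector_derivative_works by blast
    have "((\<lambda>s. w s * cnj (w s)) has_vector_derivative w t * cnj w' + w' * cnj (w t)) (at t)"
      by (intro has_vector_derivative_mult w' bounded_linear.has_vector_derivative[OF bounded_linear_cnj])
    moreover have "((\<lambda>s. w s * cnj (w s)) has_vector_derivative 0) (at t)"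
      by (rule has_vector_derivative_transform_within_open[OF has_vector_derivative_const w(2,3)]) (use w(4) in auto)
    ultimately have "w t * cnj w' + w' * cnj (w t) = 0"
      using vector_derivative_unique_at by blast
    then have "Re (w' * cnj (w t)) = 0"
      by (simp add: complex_eq_iff)
    then have "w' * cnj (w t) = \<i> * complex_of_real (Im (w' * cnj (w t)))"
      by (simp add: complex_eq_iff)
    moreover have "w' = (w' * cnj (w t)) * w t"
      using w(4)[OF w(3)] by (simp add: mult_ac)
    ultimately have "w' = \<i> * complex_of_real (Im (w' * cnj (w t))) * w t" by metis
    then show ?thesis using w' by metis
  qed
  have W_x: "((\<lambda>x. W x y) has_vector_derivative - \<i> * complex_of_real (Im (A x)) * W x y) (at x)"
    and W_y: "(W x has_vector_derivative - \<i> * complex_of_real (Im (B y)) * W x y) (at y)"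
    and sep: "A' x + \<i> * complex_of_real (Im (A x)) * A x = - (B' y + \<i> * complex_of_real (Im (B y)) * B y)"
    if xy: "x \<in> I" "y \<in> K" for x y
  proof -
    have "(\<lambda>x. W x y) differentiable (at x)"
      unfolding W_def using AB[OF xy] diff[OF A[OF xy(1)]] diff[OF p_x[OF xy]] diff[OF q_x[OF xy]]
      by (intro differentiable_divide differentiable_diff differentiable_mult differentiable_add cnj_diff
          differentiable_const) auto
    then obtain \<mu> where \<mu>: "((\<lambda>x. W x y) has_vector_derivative \<i> * complex_of_real \<mu> * W x y) (at x)"
      using W_rot[OF _ I(1) xy(1)] WW xy(2) by blast
    have "W x differentiable (at y)"
      unfolding W_def using AB[OF xy] diff[OF B[OF xy(2)]] diff[OF p_y[OF xy]] diff[OF q_y[OF xy]]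
      by (intro differentiable_divide differentiable_diff differentiable_mult differentiable_add cnj_diff
          differentiable_const) auto
    then obtain \<nu> where \<nu>: "(W x has_vector_derivative \<i> * complex_of_real \<nu> * W x y) (at y)"
      using W_rot[OF _ K(1) xy(2)] WW xy(1) by blast
    note cnj_d = bounded_linear.has_vector_derivative[OF bounded_linear_cnj]
    have "((\<lambda>x. - (W x y * cnj (B y))) has_vector_derivative - (\<i> * complex_of_real \<mu> * W x y * cnj (B y))) (at x)"
      by (intro has_vector_derivative_minus has_vector_derivative_mult_left \<mu>)
    then have "((\<lambda>x. p x y) has_vector_derivative - (\<i> * complex_of_real \<mu> * W x y * cnj (B y))) (at x)"
      by (rule has_vector_derivative_transform_within_open[OF _ I(1) xy(1)]) (use p xy in auto)
    then have pxx: "pxx x y = - (\<i> * complex_of_real \<mu> * W x y * cnj (B y))"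
      using p_x[OF xy] vector_derivative_unique_at by blast
    have "((\<lambda>y. W x y * cnj (A x)) has_vector_derivative (\<i> * complex_of_real \<nu> * W x y * cnj (A x))) (at y)"
      by (intro has_vector_derivative_mult_left \<nu>)
    then have "(q x has_vector_derivative (\<i> * complex_of_real \<nu> * W x y * cnj (A x))) (at y)"
      by (rule has_vector_derivative_transform_within_open[OF _ K(1) xy(2)]) (use q xy in auto)
    then have qyy: "qyy x y = \<i> * complex_of_real \<nu> * W x y * cnj (A x)"
      using q_y[OF xy] vector_derivative_unique_at by blast
    have "((\<lambda>x. W x y * cnj (A x)) has_vector_derivative
        W x y * cnj (A' x) + \<i> * complex_of_real \<mu> * W x y * cnj (A x)) (at x)"
      by (intro has_vector_derivative_mult \<mu> cnj_d A xy)
    then have "((\<lambda>x. q x y) has_vector_derivative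
        W x y * cnj (A' x) + \<i> * complex_of_real \<mu> * W x y * cnj (A x)) (at x)"
      by (rule has_vector_derivative_transform_within_open[OF _ I(1) xy(1)]) (use q xy in auto)
    then have pxy: "pxy x y = W x y * cnj (A' x) + \<i> * complex_of_real \<mu> * W x y * cnj (A x)"
      using q_x[OF xy] vector_derivative_unique_at by blast
    have "((\<lambda>y. - (W x y * cnj (B y))) has_vector_derivative
        - (W x y * cnj (B' y) + \<i> * complex_of_real \<nu> * W x y * cnj (B y))) (at y)"
      by (intro has_vector_derivative_minus has_vector_derivative_mult \<nu> cnj_d B xy)
    then have "(p x has_vector_derivative
        - (W x y * cnj (B' y) + \<i> * complex_of_real \<nu> * W x y * cnj (B y))) (at y)"
      by (rule has_vector_derivative_transform_within_open[OF _ K(1) xy(2)]) (use p xy in auto)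
    then have pxy': "pxy x y = - (W x y * cnj (B' y) + \<i> * complex_of_real \<nu> * W x y * cnj (B y))"
      using p_y[OF xy] vector_derivative_unique_at by blast
    have W0: "W x y \<noteq> 0" using WW[OF xy] by auto
    \<comment> \<open>The two expressions for the mixed derivative, from
      \<open>q = W * cnj A\<close> and from \<open>p = - (W * cnj B)\<close>, are equated;
      cancelling \<open>W\<close> and conjugating gives \<open>S\<close>.\<close>
    have "W x y * cnj (A' x + B' y) - W x y * cnj (\<i> * complex_of_real \<mu> * A x + \<i> * complex_of_real \<nu> * B y)
        = (W x y * cnj (A' x) + \<i> * complex_of_real \<mu> * W x y * cnj (A x))
          + (W x y * cnj (B' y) + \<i> * complex_of_real \<nu> * W x y * cnj (B y))"
      by (simp add: algebra_simps)
    also have "\<dots> = 0"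
      unfolding pxy[symmetric] pxy' by simp
    finally have "W x y * cnj (A' x + B' y) = W x y * cnj (\<i> * complex_of_real \<mu> * A x + \<i> * complex_of_real \<nu> * B y)"
      by simp
    then have "cnj (A' x + B' y) = cnj (\<i> * complex_of_real \<mu> * A x + \<i> * complex_of_real \<nu> * B y)"
      using W0 by simp
    then have S: "A' x + B' y = \<i> * complex_of_real \<mu> * A x + \<i> * complex_of_real \<nu> * B y"
      unfolding complex_cnj_cancel_iff .
    let ?E = "A x * cnj (A x) + B y * cnj (B y)"
    have ReE: "Re ?E \<noteq> 0" using AB[OF xy] by (simp add: complex_eq_iff)
    have cancel: "r = - a" if "r * z = - z * a" "z \<noteq> 0" for r z a :: real
      using that by (metis mult.commute mult_minus_left mult_minus_right mult_right_cancel)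
    \<comment> \<open>After substituting \<open>S\<close>, the two terms in
      \<open>B y * cnj (A x)\<close> cancel and the rest is \<open>\<i> * \<mu> * ?E\<close>. Its
      imaginary part turns the soliton equation into a formula for \<open>\<mu>\<close>;
      \<open>\<nu>\<close> is found in the same way.\<close>
    have "(A' x + B' y) * cnj (A x) + (pxx x y + qyy x y) * cnj (p x y)
        = (A' x + B' y) * cnj (A x) + (\<i> * complex_of_real \<mu> * cnj (B y) - \<i> * complex_of_real \<nu> * cnj (A x)) * B y * (W x y * cnj (W x y))"
      unfolding pxx qyy p[OF xy] by (simp add: algebra_simps)
    also have "\<dots> = \<i> * complex_of_real \<mu> * ?E + \<i> * complex_of_real \<nu> * (B y * cnj (A x) - cnj (A x) * B y)"
      unfolding WW[OF xy] S by (simp add: algebra_simps)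
    finally have "Im ((A' x + B' y) * cnj (A x) + (pxx x y + qyy x y) * cnj (p x y)) = \<mu> * Re ?E"
      by simp
    from this[symmetric] have \<mu>A: "\<mu> = - Im (A x)"
      unfolding sol_x[OF xy] E[OF xy] by (rule cancel[OF _ ReE])
    have "(A' x + B' y) * cnj (B y) + (pxx x y + qyy x y) * cnj (q x y)
        = (A' x + B' y) * cnj (B y) + (\<i> * complex_of_real \<nu> * cnj (A x) - \<i> * complex_of_real \<mu> * cnj (B y)) * A x * (W x y * cnj (W x y))"
      unfolding pxx qyy q[OF xy] by (simp add: algebra_simps)
    also have "\<dots> = \<i> * complex_of_real \<nu> * ?E"
      unfolding WW[OF xy] S by (simp add: algebra_simps)
    finally have "Im ((A' x + B' y) * cnj (B y) + (pxx x y + qyy x y) * cnj (q x y)) = \<nu> * Re ?E"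
      by simp
    from this[symmetric] have \<nu>B: "\<nu> = - Im (B y)"
      unfolding sol_y[OF xy] E[OF xy] by (rule cancel[OF _ ReE])
    show "((\<lambda>x. W x y) has_vector_derivative - \<i> * complex_of_real (Im (A x)) * W x y) (at x)"
      using \<mu> \<mu>A by simp
    show "(W x has_vector_derivative - \<i> * complex_of_real (Im (B y)) * W x y) (at y)"
      using \<nu> \<nu>B by simp
    have "A' x + \<i> * complex_of_real (Im (A x)) * A x + (B' y + \<i> * complex_of_real (Im (B y)) * B y)
        = (A' x + B' y) - (\<i> * complex_of_real \<mu> * A x + \<i> * complex_of_real \<nu> * B y)"
      unfolding \<mu>A \<nu>B by (simp add: algebra_simps)
    also have "\<dots> = 0" using S by simp
    finally show "A' x + \<i> * complex_of_real (Im (A x)) * A x = - (B' y + \<i> * complex_of_real (Im (B y)) * B y)"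
      by (simp only: eq_neg_iff_add_eq_0)
  qed
  obtain x0 y0 where x0: "x0 \<in> I" and y0: "y0 \<in> K" using I(3) K(3) by blast
  define c where "c = A' x0 + \<i> * complex_of_real (Im (A x0)) * A x0"
  have "B' y = - c - \<i> * complex_of_real (Im (B y)) * B y" if "y \<in> K" for y
    unfolding c_def sep[OF x0 that] by simp
  moreover have "A' x = c - \<i> * complex_of_real (Im (A x)) * A x" if "x \<in> I" for x
    unfolding c_def sep[OF x0 y0] sep[OF that y0, symmetric] by simp
  ultimately have odeF: "soliton_ode c I F A" and odeG: "soliton_ode (- c) K G B"
    using F A G B I K by (auto simp: soliton_ode_def)
  \<comment> \<open>\<open>W\<close> satisfies the same linear equation as \<open>phase F\<close> in
    \<open>x\<close> and as \<open>phase G\<close> in \<open>y\<close>. The phases are unimodular,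
    so dividing by them is multiplying by their conjugates.\<close>
  obtain W0 where W0: "\<And>x y. x \<in> I \<Longrightarrow> y \<in> K \<Longrightarrow> W x y * cnj (phase F x) * cnj (phase G y) = W0"
  proof (rule constant_on_box_of_zero_partials[OF I(2) K(2)])
    fix x y assume xy: "x \<in> I" "y \<in> K"
    have "((\<lambda>x. W x y * cnj (phase F x) * cnj (phase G y)) has_vector_derivative
        (W x y * cnj (- \<i> * complex_of_real (Im (A x)) * phase F x)
          + (- \<i> * complex_of_real (Im (A x)) * W x y) * cnj (phase F x)) * cnj (phase G y)) (at x)"
      by (intro has_vector_derivative_mult_left has_vector_derivative_mult W_x[OF xy]
          bounded_linear.has_vector_derivative[OF bounded_linear_cnj] soliton_odeD(3)[OF odeF xy(1)])
    then show "((\<lambda>x. W x y * cnj (phase F x) * cnj (phase G y)) has_vector_derivative 0) (at x)"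
      by (simp add: algebra_simps)
    have "((\<lambda>y. W x y * cnj (phase F x) * cnj (phase G y)) has_vector_derivative
        (W x y * cnj (phase F x)) * cnj (- \<i> * complex_of_real (Im (B y)) * phase G y)
          + ((- \<i> * complex_of_real (Im (B y)) * W x y) * cnj (phase F x)) * cnj (phase G y)) (at y)"
      by (intro has_vector_derivative_mult_left has_vector_derivative_mult W_y[OF xy]
          bounded_linear.has_vector_derivative[OF bounded_linear_cnj] soliton_odeD(3)[OF odeG xy(2)])
    then show "((\<lambda>y. W x y * cnj (phase F x) * cnj (phase G y)) has_vector_derivative 0) (at y)"
      by (simp add: algebra_simps)
  qed blast
  have WPQ: "W x y = W0 * (phase F x * phase G y)" if xy: "x \<in> I" "y \<in> K" for x y
  proof -
    have "W0 * (phase F x * phase G y) = W x y * (phase F x * cnj (phase F x)) * (phase G y * cnj (phase G y))"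
      unfolding W0[OF xy, symmetric] by (simp only: mult_ac)
    then show ?thesis by simp
  qed
  have "norm W0 = 1"
  proof -
    have "(norm (W x0 y0))\<^sup>2 = 1"
      using WW[OF x0 y0] complex_norm_square[of "W x0 y0"] by (metis of_real_eq_1_iff of_real_power)
    then have "norm (W x0 y0) = 1" by (metis norm_ge_zero one_power2 power2_eq_imp_eq zero_le_one)
    then show ?thesis using W0[OF x0 y0, symmetric] by (simp add: norm_mult)
  qed
  then show ?thesis
    using that[OF _ odeF odeG] p q WPQ by simp
qed

section \<open>Unitary frames\<close>

lemma rigid_motion_frame:
  assumes "herm v1 v1 = 1" "herm v2 v2 = 1" "herm v1 v2 = 0"
  shows "rigid_motion (\<lambda>w. cscale (fst w) v1 + cscale (snd w) v2 + b)"
proof -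
  let ?A = "\<lambda>w::C2. cscale (fst w) v1 + cscale (snd w) v2"
  have "linear ?A"
    by (rule linearI) (auto simp: cscale_def scaleR_conv_of_real algebra_simps)
  moreover have "?A (cscale c w) = cscale c (?A w)" for c w
    by (auto simp: cscale_def algebra_simps)
  moreover have "herm (?A v) (?A w) = herm v w" for v w
  proof -
    have 21: "herm v2 v1 = 0"
      using arg_cong[OF assms(3), of cnj] by (simp add: herm_def mult.commute)
    have "herm (?A v) (?A w) = fst v * cnj (fst w) * herm v1 v1 + fst v * cnj (snd w) * herm v1 v2
        + snd v * cnj (fst w) * herm v2 v1 + snd v * cnj (snd w) * herm v2 v2"
      by (simp add: herm_def cscale_def algebra_simps)
    then show ?thesis
      by (simp add: assms 21) (simp add: herm_def)
  qed
  ultimately show ?thesis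
    unfolding rigid_motion_def by (intro exI[of _ ?A] exI[of _ b]) auto
qed

lemma herm_self: "herm v v = complex_of_real ((norm v)\<^sup>2)"
proof -
  have "(norm v)\<^sup>2 = (norm (fst v))\<^sup>2 + (norm (snd v))\<^sup>2"
    by (cases v) (simp add: norm_prod_def)
  then show ?thesis
    by (simp only: herm_def of_real_add complex_norm_square)
qed

lemma inner_eq_Re_herm: "v \<bullet> w = Re (herm v w)" for v w :: C2
  by (cases v; cases w) (simp add: herm_def inner_complex_eq_Re)

text \<open>Left multiplication of \<open>e\<close> by the quaternion j, if \<open>(z1, z2)\<close>
  is read as \<open>z1 + z2 j\<close>. It completes \<open>e\<close> to a Hermitian orthogonal frame
  whose vectors have equal length.\<close>

definition herm_orth :: "C2 \<Rightarrow> C2" where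
  "herm_orth e = (- cnj (snd e), cnj (fst e))"

lemma herm_orth_simps [simp]:
  "herm e (herm_orth e) = 0" "herm (herm_orth e) e = 0" "herm (herm_orth e) (herm_orth e) = herm e e"
  by (simp_all add: herm_def herm_orth_def algebra_simps)

text \<open>Parseval's identity in the frame \<open>e\<close>, \<open>herm_orth e\<close>. The frame
  is not normalised, hence the factor \<open>herm e e\<close>.\<close>

lemma herm_frame:
  "herm v e * cnj (herm w e) + herm v (herm_orth e) * cnj (herm w (herm_orth e)) = herm e e * herm v w"
  by (simp add: herm_def herm_orth_def algebra_simps)

lemma frame_expansion:
  "cscale (herm v e) e + cscale (herm v (herm_orth e)) (herm_orth e) = cscale (herm e e) v"
  by (simp add: herm_def herm_orth_def cscale_def algebra_simps)

text \<open>The coefficients form \<open>R\<close> times a unitary matrix, and the frame vectors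
  have length \<open>norm e\<close>; the quotient of these scales is the dilation. \<open>Fr\<close>
  is obtained before \<open>v\<close> and \<open>w\<close>, so one motion serves all points.\<close>

lemma rigid_motion_of_frame_coordinates:
  assumes e: "e \<noteq> 0" and R: "R > 0"
    and rows: "a1 * cnj a1 + b1 * cnj b1 = complex_of_real (R\<^sup>2)" "a2 * cnj a2 + b2 * cnj b2 = complex_of_real (R\<^sup>2)"
      "a1 * cnj a2 + b1 * cnj b2 = 0"
  obtains Fr where "rigid_motion Fr"
    "\<And>v w. herm v e = a1 * fst w + a2 * snd w + C1 \<Longrightarrow>
      herm v (herm_orth e) = b1 * fst w + b2 * snd w + C2 \<Longrightarrow> v = Fr ((R / norm e) *\<^sub>R w)"
proof -
  let ?N = "complex_of_real (norm e)" and ?R = "complex_of_real R"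
  have N: "?N \<noteq> 0" "?R \<noteq> 0" "norm e > 0" using e R by auto
  have ee: "herm e e = ?N * ?N" by (simp add: herm_self power2_eq_square)
  define f where "f a b = cscale (1 / (?N * ?R)) (cscale a e + cscale b (herm_orth e))" for a b
  have herm_f: "herm (f a b) (f a' b') = (a * cnj a' + b * cnj b') / ?R\<^sup>2" for a b a' b'
  proof -
    have "herm (cscale a e + cscale b (herm_orth e)) (cscale a' e + cscale b' (herm_orth e))
        = (a * cnj a') * herm e e + (a * cnj b') * herm e (herm_orth e)
          + (b * cnj a') * herm (herm_orth e) e + (b * cnj b') * herm (herm_orth e) (herm_orth e)"
      by (simp add: herm_def cscale_def algebra_simps)
    also have "\<dots> = (a * cnj a' + b * cnj b') * (?N * ?N)"
      by (simp add: ee algebra_simps)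
    finally have 1: "herm (cscale a e + cscale b (herm_orth e)) (cscale a' e + cscale b' (herm_orth e))
        = (a * cnj a' + b * cnj b') * (?N * ?N)" .
    have 2: "herm (cscale k v) (cscale k w) = k * cnj k * herm v w" for k v w
      by (simp add: herm_def cscale_def algebra_simps)
    then show ?thesis
      unfolding f_def 2 1 using N by (simp add: field_simps power2_eq_square)
  qed
  define b where "b = cscale (1 / (?N * ?N)) (cscale C1 e + cscale C2 (herm_orth e))"
  show ?thesis
  proof (rule that)
    show "rigid_motion (\<lambda>w. cscale (fst w) (f a1 b1) + cscale (snd w) (f a2 b2) + b)"
      by (rule rigid_motion_frame) (use rows N in \<open>simp_all add: herm_f\<close>)
    fix v w
    assume "herm v e = a1 * fst w + a2 * snd w + C1" "herm v (herm_orth e) = b1 * fst w + b2 * snd w + C2"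
    then have NNv: "cscale (a1 * fst w + a2 * snd w + C1) e
        + cscale (b1 * fst w + b2 * snd w + C2) (herm_orth e) = cscale (?N * ?N) v"
      using frame_expansion[of v e] by (simp add: ee)
    have v: "v = cscale (1 / (?N * ?N))
       (cscale (a1 * fst w + a2 * snd w + C1) e + cscale (b1 * fst w + b2 * snd w + C2) (herm_orth e))"
      unfolding NNv using N by (simp add: cscale_def)
    show "v = cscale (fst ((R / norm e) *\<^sub>R w)) (f a1 b1) + cscale (snd ((R / norm e) *\<^sub>R w)) (f a2 b2) + b"
      unfolding b_def f_def using N
      by (subst v) (simp add: cscale_def scaleR_conv_of_real field_simps)
  qed
qed

text \<open>The matrix with columns \<open>(1, 1)\<close> and \<open>(1, - 1)\<close> is
  \<open>sqrt 2\<close> times a unitary one, which explains the dilation.\<close>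

lemma congruent_sum_difference:
  "congruent_up_to_dilation
     (\<lambda>(s1, s2). (grim_reaper s1 + grim_reaper s2, grim_reaper s1 - grim_reaper s2)) (grim_grim 1)"
proof -
  let ?h = "complex_of_real (sqrt 2)"
  have h: "?h * ?h = 2" by (simp flip: of_real_mult)
  have "rigid_motion (\<lambda>w. cscale (fst w) (1 / ?h, 1 / ?h) + cscale (snd w) (1 / ?h, - (1 / ?h)) + 0)"
    by (rule rigid_motion_frame) (simp_all add: herm_def h)
  then show ?thesis
    unfolding congruent_up_to_dilation_def
    by (intro exI[of _ "\<lambda>w. cscale (fst w) (1 / ?h, 1 / ?h) + cscale (snd w) (1 / ?h, - (1 / ?h)) + 0"]
        exI[of _ "sqrt 2"])
      (auto simp: grim_grim_def cscale_def scaleR_conv_of_real)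
qed

section \<open>The maps \<open>\<alpha> \<ast> \<omega>\<close>\<close>

text \<open>Bundles the conditions of case (iii) in the order of the final statement, so that
  unfolding gives it literally.\<close>

definition star_data :: "real \<Rightarrow> (real \<Rightarrow> complex) \<Rightarrow> (real \<Rightarrow> complex) \<Rightarrow> real set \<Rightarrow> real set \<Rightarrow>
    (real \<Rightarrow> real) \<Rightarrow> (real \<Rightarrow> real) \<Rightarrow> real \<Rightarrow> real \<Rightarrow> bool" where
  "star_data \<theta> \<alpha> \<omega> I1 I2 a b t0 s0 \<longleftrightarrow> 0 \<le> \<theta> \<and> \<theta> < pi \<and>
     unit_speed_curve I1 \<alpha> \<and> unit_speed_curve I2 \<omega> \<and>
     (\<forall>t\<in>I1. curvature_vector \<alpha> t =
        - cos \<theta> *\<^sub>R curve_perp \<alpha> t (\<alpha> t) + sin \<theta> *\<^sub>R curve_perp \<alpha> t (\<i> * \<alpha> t)) \<and>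
     (\<forall>s\<in>I2. curvature_vector \<omega> s =
        cos \<theta> *\<^sub>R curve_perp \<omega> s (\<omega> s) - sin \<theta> *\<^sub>R curve_perp \<omega> s (\<i> * \<omega> s)) \<and>
     continuous_arg I1 (velocity \<alpha>) a \<and> continuous_arg I2 (velocity \<omega>) b \<and> t0 \<in> I1 \<and> s0 \<in> I2"

text \<open>\<open>F\<close> supplies \<open>\<alpha>\<close> and \<open>G\<close> supplies
  \<open>\<omega>\<close>, both slowed by \<open>l\<close>. Each rescaled curve is divided by
  \<open>l\<close>, which accounts for the denominator in the second coordinate.\<close>

lemma star_data_of_soliton_ode:
  assumes F: "soliton_ode (- (complex_of_real (l\<^sup>2) * cis \<theta>)) I F A"
    and G: "soliton_ode (complex_of_real (l\<^sup>2) * cis \<theta>) K G B"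
    and l: "l > 0" and \<theta>: "0 \<le> \<theta>" "\<theta> < pi" and ne: "I \<noteq> {}" "K \<noteq> {}"
  obtains \<alpha> \<omega> a b t0 s0 C where "star_data \<theta> \<alpha> \<omega> ((*) l ` I) ((*) l ` K) a b t0 s0"
    "\<And>x y. x \<in> I \<Longrightarrow> y \<in> K \<Longrightarrow> curve_star \<theta> \<alpha> \<omega> a b t0 s0 (l * x, l * y)
       = (F x + G y + C, soliton_curve F A x * soliton_curve G B y / complex_of_real (l\<^sup>2))"
proof -
  let ?F = "\<lambda>t. F (t / l)" and ?A = "\<lambda>t. A (t / l) / complex_of_real l"
    and ?G = "\<lambda>t. G (t / l)" and ?B = "\<lambda>t. B (t / l) / complex_of_real l"
  have F': "soliton_ode (- cis \<theta>) ((*) l ` I) ?F ?A" and G': "soliton_ode (cis \<theta>) ((*) l ` K) ?G ?B"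
    using soliton_ode_scale[OF F l] soliton_ode_scale[OF G l] l by simp_all
  \<comment> \<open>The sign is absorbed as a half turn, so that the lemmas about
    \<open>cis \<psi>\<close> apply with \<open>\<psi> = \<theta> + pi\<close>.\<close>
  have F'': "soliton_ode (cis (\<theta> + pi)) ((*) l ` I) ?F ?A"
    using F' by (simp add: cis_mult[symmetric])
  let ?\<alpha> = "soliton_curve ?F ?A" and ?\<omega> = "soliton_curve ?G ?B"
  let ?a = "\<lambda>t. - Im (?F t) - (\<theta> + pi)" and ?b = "\<lambda>t. - Im (?G t) - \<theta>"
  obtain x0 y0 where xy0: "x0 \<in> I" "y0 \<in> K" using ne by blast
  have data: "star_data \<theta> ?\<alpha> ?\<omega> ((*) l ` I) ((*) l ` K) ?a ?b (l * x0) (l * y0)"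
    unfolding star_data_def
  proof (intro conjI ballI)
    show "unit_speed_curve ((*) l ` I) ?\<alpha>" "unit_speed_curve ((*) l ` K) ?\<omega>"
      using soliton_curve_unit_speed[OF F''] soliton_curve_unit_speed[OF G'] by simp_all
    show "curvature_vector ?\<alpha> t = - cos \<theta> *\<^sub>R curve_perp ?\<alpha> t (?\<alpha> t) + sin \<theta> *\<^sub>R curve_perp ?\<alpha> t (\<i> * ?\<alpha> t)"
      if "t \<in> (*) l ` I" for t
      using soliton_curve_equation[OF F'' that] by simp
    show "curvature_vector ?\<omega> s = cos \<theta> *\<^sub>R curve_perp ?\<omega> s (?\<omega> s) - sin \<theta> *\<^sub>R curve_perp ?\<omega> s (\<i> * ?\<omega> s)"
      if "s \<in> (*) l ` K" for s
      using soliton_curve_equation[OF G' that] .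
    show "continuous_arg ((*) l ` I) (velocity ?\<alpha>) ?a" "continuous_arg ((*) l ` K) (velocity ?\<omega>) ?b"
      using soliton_curve_continuous_arg[OF F''] soliton_curve_continuous_arg[OF G'] by simp_all
  qed (use \<theta> xy0 in auto)
  obtain C where C: "\<And>t s. t \<in> (*) l ` I \<Longrightarrow> s \<in> (*) l ` K \<Longrightarrow>
      curve_star \<theta> ?\<alpha> ?\<omega> ?a ?b (l * x0) (l * y0) (t, s) = (?F t + ?G s + C, ?\<alpha> t * ?\<omega> s)"
    using soliton_curve_star[OF F' G' \<theta>, of "l * x0" "l * y0"] xy0 by blast
  have "?\<alpha> (l * x) * ?\<omega> (l * y) = soliton_curve F A x * soliton_curve G B y / complex_of_real (l\<^sup>2)" for x y
    using l by (simp add: soliton_curve_def phase_def power2_eq_square)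
  then have "curve_star \<theta> ?\<alpha> ?\<omega> ?a ?b (l * x0) (l * y0) (l * x, l * y)
       = (F x + G y + C, soliton_curve F A x * soliton_curve G B y / complex_of_real (l\<^sup>2))"
    if "x \<in> I" "y \<in> K" for x y
    using C[of "l * x" "l * y"] that l by simp
  with data show ?thesis using that by blast
qed

text \<open>Both curves are the real axis: the curvature vanishes, the position vector is tangent,
  and \<open>\<theta> = 0\<close> removes the rotated term.\<close>

lemma star_data_plane: "star_data 0 of_real of_real UNIV UNIV (\<lambda>t. 0) (\<lambda>t. 0) 0 0"
proof -
  have v: "velocity of_real = (\<lambda>t. 1)"
  proof
    fix t
    have "(complex_of_real has_vector_derivative 1) (at t)"
      using has_vector_derivative_of_real[of "\<lambda>t. t" 1 "at t"] by simp
    then show "velocity of_real t = 1"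
      by (simp add: velocity_def vector_derivative_at)
  qed
  have vv: "velocity (\<lambda>t. 1) t = 0" for t
    by (simp add: velocity_def)
  have "curvature of_real t = 0" for t
    unfolding curvature_def v vv by (rule the_equality) auto
  then have k: "curvature_vector of_real t = 0" for t
    by (simp add: curvature_vector_def)
  have perp: "curve_perp of_real t (complex_of_real s) = 0" for t s
    unfolding curve_perp_def v using normal_component_span_unit[of 1 "complex_of_real s"] by simp
  have "smooth_on UNIV complex_of_real"
    unfolding smooth_on_def using Ck_on_linear[OF bounded_linear_of_real open_UNIV] by blast
  then have "unit_speed_curve UNIV of_real"
    by (simp add: unit_speed_curve_def v)
  then show ?thesis
    by (simp add: star_data_def k perp v continuous_arg_def)
qed

lemma curve_star_plane:
  "curve_star 0 of_real of_real (\<lambda>t. 0) (\<lambda>t. 0) 0 0 (t, s) = (complex_of_real ((s\<^sup>2 - t\<^sup>2) / 2), complex_of_real (t * s))"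
  by (simp add: curve_star_def)

text \<open>For straight lines \<open>\<alpha> \<ast> \<omega>\<close> is the plane in the coordinates \<open>(s + \<i> t)\<^sup>2 / 2\<close>, so a square root
  of the Cartesian coordinates is a chart away from the branch point.\<close>

lemma plane_chart:
  fixes x0 y0 :: real
  assumes B: "open B" "B \<subseteq> {z. 2 * (fst z - x0) + 1 > 0}"
  obtains T T' where "smooth_on B T" "open (T ` B)" "smooth_on (T ` B) T'" "\<And>z. z \<in> B \<Longrightarrow> T' (T z) = z"
    "\<And>x y. (x, y) \<in> B \<Longrightarrow> curve_star 0 of_real of_real (\<lambda>t. 0) (\<lambda>t. 0) 0 0 (T (x, y))
       = (complex_of_real (x - x0 + 1 / 2), complex_of_real (y - y0))"
proof -
  \<comment> \<open>Twice the Cartesian coordinate of the plane, placed so that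
    \<open>(x0, y0)\<close> goes to \<open>1\<close>. On \<open>B\<close> it stays in the right half
    plane, where the principal root is smooth. The root is \<open>s + \<i> * t\<close>, so
    \<open>T\<close> lists its imaginary part first.\<close>
  define \<zeta> where "\<zeta> z = Complex (2 * (fst z - x0) + 1) (2 * (snd z - y0))" for z :: "real \<times> real"
  define S where "S z = csqrt (\<zeta> z)" for z
  define T where "T z = (Im (S z), Re (S z))" for z
  define T' where "T' w = (((snd w)\<^sup>2 - (fst w)\<^sup>2 - 1) / 2 + x0, fst w * snd w + y0)" for w :: "real \<times> real"
  have Re\<zeta>: "Re (\<zeta> z) > 0" if "z \<in> B" for z
    using subsetD[OF B(2) that] by (simp add: \<zeta>_def)
  have S2: "(Re (S z))\<^sup>2 - (Im (S z))\<^sup>2 = 2 * (fst z - x0) + 1" "2 * (Re (S z) * Im (S z)) = 2 * (snd z - y0)" for z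
  proof -
    have "(S z)\<^sup>2 = \<zeta> z" by (simp add: S_def)
    then have "Re ((S z)\<^sup>2) = 2 * (fst z - x0) + 1" "Im ((S z)\<^sup>2) = 2 * (snd z - y0)"
      by (simp_all add: \<zeta>_def)
    then show "(Re (S z))\<^sup>2 - (Im (S z))\<^sup>2 = 2 * (fst z - x0) + 1" "2 * (Re (S z) * Im (S z)) = 2 * (snd z - y0)"
      by (simp_all add: Re_power2 Im_power2)
  qed
  have T'T: "T' (T z) = z" for z
  proof (rule prod_eqI)
    show "fst (T' (T z)) = fst z"
      unfolding T'_def T_def fst_conv snd_conv S2(1) by (simp add: field_simps)
    show "snd (T' (T z)) = snd z"
      unfolding T'_def T_def fst_conv snd_conv using S2(2)[of z] by (simp add: mult.commute)
  qed
  have cs: "curve_star 0 of_real of_real (\<lambda>t. 0) (\<lambda>t. 0) 0 0 (T (x, y))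
       = (complex_of_real (x - x0 + 1 / 2), complex_of_real (y - y0))" for x y
    using S2[of "(x, y)"] by (simp add: T_def curve_star_plane mult.commute flip: of_real_mult)
      (simp add: complex_eq_iff field_simps)
  have S_pos: "Re (S z) > 0" if "z \<in> B" for z
  proof -
    have "(Re (S z))\<^sup>2 > (Im (S z))\<^sup>2"
      using Re\<zeta>[OF that] S2(1)[of z] by (simp add: \<zeta>_def)
    then have "Re (S z) \<noteq> 0" by (metis not_less zero_le_power2 zero_power2)
    then show ?thesis using Re_csqrt[of "\<zeta> z"] by (simp add: S_def)
  qed
  have S_nz: "S z \<noteq> 0" if "z \<in> B" for z
    using S_pos[OF that] by auto
  have d\<zeta>: "(\<zeta> has_derivative (\<lambda>v. 2 * Complex (fst v) (snd v))) (at z)" for z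
  proof -
    have "\<zeta> = (\<lambda>z. 2 * (complex_of_real (fst z) + \<i> * complex_of_real (snd z))
        + (1 - 2 * complex_of_real x0 - 2 * \<i> * complex_of_real y0))"
      by (auto simp: \<zeta>_def complex_eq_iff)
    moreover have "((\<lambda>z. 2 * (complex_of_real (fst z) + \<i> * complex_of_real (snd z))
        + (1 - 2 * complex_of_real x0 - 2 * \<i> * complex_of_real y0)) has_derivative
        (\<lambda>v. 2 * (complex_of_real (fst v) + \<i> * complex_of_real (snd v)) + 0)) (at z)"
      by (intro derivative_intros)
    ultimately show ?thesis by (simp add: Complex_eq)
  qed
  have dS: "(S has_derivative (\<lambda>v. (1 / S z) * Complex (fst v) (snd v))) (at z)" if z: "z \<in> B" for z
  proof -
    have "(csqrt has_field_derivative inverse (2 * csqrt (\<zeta> z))) (at (\<zeta> z))"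
      by (rule has_field_derivative_csqrt) (use Re\<zeta>[OF z] in \<open>auto simp: complex_nonpos_Reals_iff\<close>)
    then have "(csqrt has_derivative (*) (inverse (2 * csqrt (\<zeta> z)))) (at (\<zeta> z))"
      by (simp add: has_field_derivative_def)
    from has_derivative_compose[OF d\<zeta> this]
    show ?thesis
      by (simp add: S_def[abs_def] field_simps)
  qed
  have dW: "((\<lambda>z. 1 / S z) has_derivative (\<lambda>v. - ((1 / S z) * ((1 / S z) * (1 / S z))) * Complex (fst v) (snd v))) (at z)"
    if z: "z \<in> B" for z
  proof -
    have "((\<lambda>z. inverse (S z)) has_derivative (\<lambda>v. - (inverse (S z) * ((1 / S z) * Complex (fst v) (snd v)) * inverse (S z)))) (at z)"
      by (rule Deriv.has_derivative_inverse[OF S_nz[OF z] dS[OF z]])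
    then show ?thesis by (simp add: inverse_eq_divide mult_ac)
  qed
  note bl = Ck_on_bilinear[OF bounded_bilinear_mult B(1)]
  have mc: "Ck_on k B (\<lambda>z. f z * v)" if "Ck_on k B f" for k f and v :: complex
    by (rule Ck_on_bounded_linear[OF bounded_linear_mult_left B(1) that])
  \<comment> \<open>The derivative of \<open>1 / S\<close> is minus its own cube, so regularity
    bootstraps; that of \<open>S\<close>, whose derivative is \<open>1 / S\<close>, follows.\<close>
  have W: "Ck_on k B (\<lambda>z. 1 / S z)" for k
  proof (induction k)
    case 0
    show ?case
      by (auto intro!: continuous_at_imp_continuous_on has_derivative_continuous dW)
  next
    case (Suc k)
    show ?case
    proof (rule Ck_on_SucI[OF B(1) dW])
      show "Ck_on k B (\<lambda>z. - ((1 / S z) * ((1 / S z) * (1 / S z))) * Complex (fst v) (snd v))" for v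
        by (intro mc Ck_on_bounded_linear[OF bounded_linear_minus[OF bounded_linear_ident] B(1)] bl Suc)
    qed
  qed
  have S: "Ck_on k B S" for k
  proof -
    have "Ck_on (Suc k) B S"
      by (rule Ck_on_SucI[OF B(1) dS]) (assumption, intro mc W)
    then show ?thesis by (rule Ck_on_lower)
  qed
  have "bounded_linear (\<lambda>s. (Im s, Re s))"
    by (rule bounded_linear_Pair[OF bounded_linear_Im bounded_linear_Re])
  from Ck_on_bounded_linear[OF this B(1) S]
  have smT: "smooth_on B T"
    by (simp add: smooth_on_def T_def[abs_def])
  have smT': "smooth_on R T'" if R: "open R" for R
    unfolding smooth_on_def
  proof
    fix k
    have fs: "Ck_on k R (fst :: real \<times> real \<Rightarrow> real)" "Ck_on k R (snd :: real \<times> real \<Rightarrow> real)"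
      by (intro Ck_on_linear bounded_linear_fst bounded_linear_snd R)+
    note bl' = Ck_on_bilinear[OF bounded_bilinear_mult R]
    have c: "Ck_on k R (\<lambda>w. (snd w * snd w + (- 1) * (fst w * fst w)) * (1 / 2) + (x0 - 1 / 2))"
      "Ck_on k R (\<lambda>w. fst w * snd w + y0)"
      by (intro Ck_on_add[OF R] bl' fs Ck_on_const[OF R])+
    have "Ck_on k R (\<lambda>w. ((snd w * snd w + (- 1) * (fst w * fst w)) * (1 / 2) + (x0 - 1 / 2)) *\<^sub>R (1::real, 0::real)
        + (fst w * snd w + y0) *\<^sub>R (0, 1))"
      by (rule Ck_on_add[OF R Ck_on_bounded_linear[OF bounded_linear_scaleR_left R c(1)]
            Ck_on_bounded_linear[OF bounded_linear_scaleR_left R c(2)]])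
    moreover have "(\<lambda>w. ((snd w * snd w + (- 1) * (fst w * fst w)) * (1 / 2) + (x0 - 1 / 2)) *\<^sub>R (1::real, 0::real)
        + (fst w * snd w + y0) *\<^sub>R (0, 1)) = T'"
      by (auto simp: T'_def power2_eq_square field_simps)
    ultimately show "Ck_on k R T'" by simp
  qed
  \<comment> \<open>The sign condition selects the principal root; it describes the image as a
    preimage, which makes it open.\<close>
  have "T ` B = {w. snd w > 0} \<inter> T' -` B"
  proof (intro equalityI subsetI)
    fix w assume w: "w \<in> {w. snd w > 0} \<inter> T' -` B"
    have "\<zeta> (T' w) = (Complex (snd w) (fst w))\<^sup>2"
      by (simp add: \<zeta>_def T'_def complex_eq_iff Re_power2 Im_power2 field_simps)
    then have "S (T' w) = Complex (snd w) (fst w)"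
      unfolding S_def using w by (simp add: csqrt_square)
    then have "T (T' w) = w" by (simp add: T_def)
    then show "w \<in> T ` B" using w by (metis IntD2 imageI vimageD)
  qed (use S_pos T'T in \<open>auto simp: T_def\<close>)
  moreover have "open ({w. snd w > 0} \<inter> T' -` B)"
  proof (rule open_Int)
    show "open {w :: real \<times> real. snd w > 0}"
      by (intro open_Collect_less continuous_intros)
    show "open (T' -` B)"
      using open_vimage[OF B(1) smooth_on_imp_continuous_on[OF smT'[OF open_UNIV]]] .
  qed
  ultimately have op: "open (T ` B)" by simp
  show ?thesis
    by (rule that[OF smT op smT'[OF op] T'T cs])
qed

section \<open>Lagrangian translating solitons in isothermal coordinates\<close>

lemma bounded_linear_herm: "bounded_linear (\<lambda>v. herm v w)"
  unfolding herm_def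
  by (intro bounded_linear_add bounded_linear_mult_left[THEN bounded_linear_compose] bounded_linear_fst bounded_linear_snd)

lemma subspace_tangent_plane:
  assumes "smooth_on S X" "z \<in> S"
  shows "subspace (tangent_plane X z)"
  unfolding tangent_plane_def
  using has_derivative_linear[OF smooth_on_has_derivative[OF assms]]
  by (intro linear_subspace_image subspace_UNIV)

lemma normal_component_inner:
  fixes T :: "'a::euclidean_space set"
  assumes "subspace T" "\<And>t. t \<in> T \<Longrightarrow> t \<bullet> n = 0"
  shows "normal_component T v \<bullet> n = v \<bullet> n"
  using assms(2)[OF normal_component_props(2)[OF assms(1), of v]] by (simp add: inner_diff_left)

text \<open>By the Lagrangian condition \<open>\<i>\<close> times a tangent vector is normal, so
  pairing with it removes both normal projections. In isothermal coordinates the trace is the flat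
  Laplacian divided by \<open>E\<close>.\<close>

lemma soliton_normal_equation:
  assumes X: "smooth_on S X" and z: "z \<in> S"
    and g: "metric X z (1,0) (1,0) = E" "metric X z (0,1) (0,1) = E" "metric X z (1,0) (0,1) = 0" "E \<noteq> 0"
    and lag: "\<And>v w. kaehler (pd v X z) (pd w X z) = 0"
    and sol: "mean_curvature X z = normal_component (tangent_plane X z) e"
  shows "Im (herm (pd_x (pd_x X) z + pd_y (pd_y X) z) (pd w X z)) = E * Im (herm e (pd w X z))"
proof -
  let ?T = "tangent_plane X z" and ?n = "cscale \<i> (pd w X z)"
  have n: "v \<bullet> ?n = Im (herm v (pd w X z))" for v
    by (simp add: inner_eq_Re_herm herm_def cscale_def)
  note nc = normal_component_inner[OF subspace_tangent_plane[OF X z], where n = ?n]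
  have perp: "t \<bullet> ?n = 0" if "t \<in> ?T" for t
  proof -
    from that obtain v where "t = pd v X z" unfolding tangent_plane_def by blast
    then show ?thesis using lag[of v w] by (simp add: n kaehler_def)
  qed
  have "mean_curvature X z = (1 / (E * E)) *\<^sub>R (E *\<^sub>R normal_component ?T (pd_x (pd_x X) z)
      + E *\<^sub>R normal_component ?T (pd_y (pd_y X) z))"
    by (simp add: mean_curvature_def g second_fund_def)
  then have "mean_curvature X z \<bullet> ?n = (1 / (E * E)) * (E * (pd_x (pd_x X) z \<bullet> ?n) + E * (pd_y (pd_y X) z \<bullet> ?n))"
    by (simp add: inner_add_left nc[OF perp])
  then have "(1 / (E * E)) * (E * (pd_x (pd_x X) z \<bullet> ?n) + E * (pd_y (pd_y X) z \<bullet> ?n)) = e \<bullet> ?n"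
    using nc[OF perp, of e] unfolding sol by simp
  then have "E * (pd_x (pd_x X) z \<bullet> ?n + pd_y (pd_y X) z \<bullet> ?n) = E * (E * (e \<bullet> ?n))"
    using g(4) by (simp add: field_simps)
  then have "pd_x (pd_x X) z \<bullet> ?n + pd_y (pd_y X) z \<bullet> ?n = E * (e \<bullet> ?n)"
    by (rule mult_left_cancel[OF g(4), THEN iffD1])
  then show ?thesis
    unfolding n[symmetric] by (simp add: inner_add_left)
qed

text \<open>Passes from the geometry to ordinary differential equations. The domain shrinks to a
  square around the base point because separation of variables needs a product of intervals.\<close>

lemma lagrangian_soliton_integration:
  assumes \<Omega>: "open \<Omega>" "(x0, y0) \<in> \<Omega>" and X: "smooth_on \<Omega> X" and e: "e \<noteq> 0"
    and iso_all: "\<forall>z\<in>\<Omega>. metric X z (1,0) (1,0) = exp (2 * u z) \<and> metric X z (0,1) (0,1) = exp (2 * u z) \<and>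
      metric X z (1,0) (0,1) = 0"
    and lag_all: "\<forall>z\<in>\<Omega>. \<forall>v w. kaehler (pd v X z) (pd w X z) = 0"
    and sol_all: "\<forall>z\<in>\<Omega>. mean_curvature X z = normal_component (tangent_plane X z) e"
    and sep_all: "\<forall>z\<in>\<Omega>. pd_x (pd_y (\<lambda>z. herm (X z) e)) z = 0"
  obtains d c W0 F G A B where "d > 0" "ball x0 d \<times> ball y0 d \<subseteq> \<Omega>" "norm W0 = 1"
    "soliton_ode c (ball x0 d) F A" "soliton_ode (- c) (ball y0 d) G B"
    "\<And>x y. x \<in> ball x0 d \<Longrightarrow> y \<in> ball y0 d \<Longrightarrow> herm (X (x, y)) e = F x + G y"
    "\<And>x y. x \<in> ball x0 d \<Longrightarrow> y \<in> ball y0 d \<Longrightarrow> ((\<lambda>x. herm (X (x, y)) (herm_orth e)) has_vector_derivative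
       - (W0 * (phase F x * phase G y) * cnj (B y))) (at x)"
    "\<And>x y. x \<in> ball x0 d \<Longrightarrow> y \<in> ball y0 d \<Longrightarrow> ((\<lambda>y. herm (X (x, y)) (herm_orth e)) has_vector_derivative
       W0 * (phase F x * phase G y) * cnj (A x)) (at y)"
    "\<And>x y. x \<in> ball x0 d \<Longrightarrow> y \<in> ball y0 d \<Longrightarrow> A x \<noteq> 0 \<or> B y \<noteq> 0"
proof -
  note iso = iso_all[rule_format] and lag = lag_all[rule_format] and sol = sol_all[rule_format] and sep = sep_all[rule_format]
  obtain U V where UV: "open U" "open V" "x0 \<in> U" "y0 \<in> V" "U \<times> V \<subseteq> \<Omega>"
    using \<Omega> open_prod_elim by (metis mem_Sigma_iff)
  obtain d1 d2 where d12: "d1 > 0" "ball x0 d1 \<subseteq> U" "d2 > 0" "ball y0 d2 \<subseteq> V"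
    using UV open_contains_ball by metis
  define d where "d = min d1 d2"
  let ?I = "ball x0 d" and ?K = "ball y0 d"
  have d: "d > 0" using d12 by (simp add: d_def)
  have "?I \<subseteq> U" "?K \<subseteq> V" using d12 by (auto simp: d_def)
  then have sub: "?I \<times> ?K \<subseteq> \<Omega>" using UV(5) by blast
  have \<Omega>I: "(x, y) \<in> \<Omega>" if "x \<in> ?I" "y \<in> ?K" for x y
    using sub that by blast
  have c0: "x0 \<in> ?I" "y0 \<in> ?K" using d by auto
  have IK: "open ?I" "is_interval ?I" "?I \<noteq> {}" "open ?K" "is_interval ?K" "?K \<noteq> {}"
    using d c0 by (auto simp: is_interval_ball_real)
  define H1 where "H1 z = herm (X z) e" for z
  define H2 where "H2 z = herm (X z) (herm_orth e)" for z
  have pdX: "smooth_on \<Omega> (pd v X)" for v using smooth_on_pd[OF X] .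
  have diffX: "f differentiable (at z)" if "smooth_on \<Omega> f" "z \<in> \<Omega>" for f :: "real \<times> real \<Rightarrow> C2" and z
    using smooth_on_has_derivative[OF that] by (auto simp: differentiable_def)
  have pd1: "pd v (\<lambda>z. herm (f z) w) z = herm (pd v f z) w" if "smooth_on \<Omega> f" "z \<in> \<Omega>" for f v w z
    by (rule pd_bounded_linear[OF bounded_linear_herm diffX[OF that]])
  have pd2: "pd v' (pd v (\<lambda>z. herm (X z) w)) z = herm (pd v' (pd v X) z) w" if z: "z \<in> \<Omega>" for v v' w z
  proof -
    have "pd v' (pd v (\<lambda>z. herm (X z) w)) z = pd v' (\<lambda>z. herm (pd v X z) w) z"
      by (rule pd_cong_open[OF \<Omega>(1) z]) (rule pd1[OF X])
    then show ?thesis using pd1[OF pdX z] by simp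
  qed
  have sm: "smooth_on \<Omega> H1" "smooth_on \<Omega> H2"
    unfolding H1_def[abs_def] H2_def[abs_def]
    by (intro smooth_on_bounded_linear[OF bounded_linear_herm \<Omega>(1) X])+
  have smpd: "smooth_on \<Omega> (pd v H1)" "smooth_on \<Omega> (pd v H2)" for v
    using smooth_on_pd sm by blast+
  have sep1: "pd_x (pd_y H1) z = 0" "pd_y (pd_x H1) z = 0" if "z \<in> \<Omega>" for z
    using sep[OF that] pd_commute[OF \<Omega>(1) sm(1) that] unfolding H1_def[abs_def] by simp_all
  define F where "F x = H1 (x, y0)" for x
  \<comment> \<open>The value at the base point is already contained in \<open>F\<close>.\<close>
  define G where "G y = H1 (x0, y) - H1 (x0, y0)" for y
  define A where "A x = pd_x H1 (x, y0)" for x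
  define B where "B y = pd_y H1 (x0, y)" for y
  define A' where "A' x = pd_x (pd_x H1) (x, y0)" for x
  define B' where "B' y = pd_y (pd_y H1) (x0, y)" for y
  \<comment> \<open>The \<open>y\<close>-derivative of \<open>pd_x H1\<close> is the mixed
    derivative in the other order, hence zero.\<close>
  have A_eq: "pd_x H1 (x, y) = A x" if xy: "x \<in> ?I" "y \<in> ?K" for x y
  proof -
    have "\<exists>C. \<forall>y\<in>?K. pd_x H1 (x, y) = C"
      by (rule constant_on_interval_of_zero_derivative[OF IK(5)])
        (use smooth_on_pd_y[OF smpd(1)] sep1(2) \<Omega>I xy(1) in metis)
    then show ?thesis using xy c0 by (auto simp: A_def)
  qed
  have B_eq: "pd_y H1 (x, y) = B y" if xy: "x \<in> ?I" "y \<in> ?K" for x y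
  proof -
    have "\<exists>C. \<forall>x\<in>?I. pd_y H1 (x, y) = C"
      by (rule constant_on_interval_of_zero_derivative[OF IK(2)])
        (use smooth_on_pd_x[OF smpd(1)] sep1(1) \<Omega>I xy(2) in metis)
    then show ?thesis using xy c0 by (auto simp: B_def)
  qed
  have dF: "(F has_vector_derivative A x) (at x)" if "x \<in> ?I" for x
    unfolding F_def[abs_def] A_def using smooth_on_pd_x[OF sm(1) \<Omega>I[OF that c0(2)]] .
  have dA: "(A has_vector_derivative A' x) (at x)" if "x \<in> ?I" for x
    unfolding A_def[abs_def] A'_def using smooth_on_pd_x[OF smpd(1) \<Omega>I[OF that c0(2)]] .
  have dG: "(G has_vector_derivative B y) (at y)" if "y \<in> ?K" for y
    unfolding G_def[abs_def] B_def
    using has_vector_derivative_diff[OF smooth_on_pd_y[OF sm(1) \<Omega>I[OF c0(1) that]] has_vector_derivative_const]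
    by simp
  have dB: "(B has_vector_derivative B' y) (at y)" if "y \<in> ?K" for y
    unfolding B_def[abs_def] B'_def using smooth_on_pd_y[OF smpd(1) \<Omega>I[OF c0(1) that]] .
  have A'_eq: "pd_x (pd_x H1) (x, y) = A' x" if xy: "x \<in> ?I" "y \<in> ?K" for x y
  proof -
    have "((\<lambda>x. pd_x H1 (x, y)) has_vector_derivative A' x) (at x)"
      by (rule has_vector_derivative_transform_within_open[OF dA[OF xy(1)] IK(1) xy(1)])
        (use A_eq xy in simp)
    then show ?thesis
      using smooth_on_pd_x[OF smpd(1) \<Omega>I[OF xy]] vector_derivative_unique_at by blast
  qed
  have B'_eq: "pd_y (pd_y H1) (x, y) = B' y" if xy: "x \<in> ?I" "y \<in> ?K" for x y
  proof -
    have "((\<lambda>y. pd_y H1 (x, y)) has_vector_derivative B' y) (at y)"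
      by (rule has_vector_derivative_transform_within_open[OF dB[OF xy(2)] IK(4) xy(2)])
        (use B_eq xy in simp)
    then show ?thesis
      using smooth_on_pd_y[OF smpd(1) \<Omega>I[OF xy]] vector_derivative_unique_at by blast
  qed
  have H1_eq: "H1 (x, y) = F x + G y" if xy: "x \<in> ?I" "y \<in> ?K" for x y
  proof -
    obtain C where C: "\<And>x y. x \<in> ?I \<Longrightarrow> y \<in> ?K \<Longrightarrow> H1 (x, y) - (F x + G y) = C"
    proof (rule constant_on_box_of_zero_partials[OF IK(2,5)])
      fix x y assume xy: "x \<in> ?I" "y \<in> ?K"
      show "((\<lambda>x. H1 (x, y) - (F x + G y)) has_vector_derivative 0) (at x)"
        using has_vector_derivative_diff[OF smooth_on_pd_x[OF sm(1) \<Omega>I[OF xy]]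
            has_vector_derivative_add[OF dF[OF xy(1)] has_vector_derivative_const[of "G y"]]] A_eq[OF xy] by simp
      show "((\<lambda>y. H1 (x, y) - (F x + G y)) has_vector_derivative 0) (at y)"
        using has_vector_derivative_diff[OF smooth_on_pd_y[OF sm(1) \<Omega>I[OF xy]]
            has_vector_derivative_add[OF has_vector_derivative_const[of "F x"] dG[OF xy(2)]]] B_eq[OF xy] by simp
    qed blast
    have "C = 0" using C[OF c0] by (simp add: F_def G_def)
    then show ?thesis using C[OF xy] by simp
  qed
  have frame: "herm (pd v X z) (pd w X z) * herm e e
      = pd v H1 z * cnj (pd w H1 z) + pd v H2 z * cnj (pd w H2 z)" if "z \<in> \<Omega>" for v w z
    unfolding H1_def[abs_def] H2_def[abs_def] pd1[OF X that] herm_frame by (simp add: mult.commute)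
  \<comment> \<open>The Lagrangian condition says that \<open>herm\<close> is real on tangent
    vectors, so the metric conditions become complex equations.\<close>
  have met: "herm (pd v X z) (pd w X z) = complex_of_real (metric X z v w)" if "z \<in> \<Omega>" for v w z
    using lag[OF that, of v w] by (simp add: complex_eq_iff metric_def inner_eq_Re_herm kaehler_def)
  define E where "E z = exp (2 * u z)" for z
  have E: "E z > 0" for z by (simp add: E_def)
  have ee: "herm e e = complex_of_real ((norm e)\<^sup>2)" by (rule herm_self)
  have xx: "pd_x H1 z * cnj (pd_x H1 z) + pd_x H2 z * cnj (pd_x H2 z) = complex_of_real (E z * (norm e)\<^sup>2)"
    and yy: "pd_y H1 z * cnj (pd_y H1 z) + pd_y H2 z * cnj (pd_y H2 z) = complex_of_real (E z * (norm e)\<^sup>2)"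
    and xy: "pd_x H1 z * cnj (pd_y H1 z) + pd_x H2 z * cnj (pd_y H2 z) = 0"
    if "z \<in> \<Omega>" for z
    unfolding frame[OF that, symmetric] met[OF that] ee using iso[OF that] by (simp_all add: E_def)
  have soliton: "Im ((pd_x (pd_x H1) z + pd_y (pd_y H1) z) * cnj (pd w H1 z)
      + (pd_x (pd_x H2) z + pd_y (pd_y H2) z) * cnj (pd w H2 z)) = - (E z * (norm e)\<^sup>2) * Im (pd w H1 z)"
    if z: "z \<in> \<Omega>" for w z
  proof -
    let ?L = "pd_x (pd_x X) z + pd_y (pd_y X) z"
    have L: "pd_x (pd_x (\<lambda>z. herm (X z) v)) z + pd_y (pd_y (\<lambda>z. herm (X z) v)) z = herm ?L v" for v
      unfolding pd2[OF z] by (simp add: herm_def algebra_simps)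
    have "(pd_x (pd_x H1) z + pd_y (pd_y H1) z) * cnj (pd w H1 z)
      + (pd_x (pd_x H2) z + pd_y (pd_y H2) z) * cnj (pd w H2 z) = complex_of_real ((norm e)\<^sup>2) * herm ?L (pd w X z)"
      unfolding H1_def[abs_def] H2_def[abs_def] L pd1[OF X z] herm_frame ee ..
    moreover have "Im (herm ?L (pd w X z)) = E z * Im (herm e (pd w X z))"
      by (rule soliton_normal_equation[OF X z _ _ _ _ lag[OF z] sol[OF z]]) (use iso[OF z] in \<open>auto simp: E_def\<close>)
    \<comment> \<open>\<open>herm\<close> is conjugate linear in its second argument; this is the
      origin of the minus sign in the rotation of \<open>W\<close>.\<close>
    moreover have "Im (herm e (pd w X z)) = - Im (pd w H1 z)"
      unfolding H1_def[abs_def] pd1[OF X z] by (simp add: herm_def)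
    ultimately show ?thesis by simp
  qed
  obtain c W0 where W0: "norm W0 = 1" "soliton_ode c ?I F A" "soliton_ode (- c) ?K G B"
    and p: "\<And>x y. x \<in> ?I \<Longrightarrow> y \<in> ?K \<Longrightarrow> pd_x H2 (x, y) = - (W0 * (phase F x * phase G y) * cnj (B y))"
    and q: "\<And>x y. x \<in> ?I \<Longrightarrow> y \<in> ?K \<Longrightarrow> pd_y H2 (x, y) = W0 * (phase F x * phase G y) * cnj (A x)"
  proof (rule soliton_separation[OF IK dF dA dG dB,
        where p = "\<lambda>x y. pd_x H2 (x, y)" and q = "\<lambda>x y. pd_y H2 (x, y)"
          and pxx = "\<lambda>x y. pd_x (pd_x H2) (x, y)" and pxy = "\<lambda>x y. pd_y (pd_x H2) (x, y)"
          and qyy = "\<lambda>x y. pd_y (pd_y H2) (x, y)"])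
    fix x y assume I: "x \<in> ?I" and K: "y \<in> ?K"
    note z = \<Omega>I[OF I K]
    show "((\<lambda>x. pd_x H2 (x, y)) has_vector_derivative pd_x (pd_x H2) (x, y)) (at x)"
      by (rule smooth_on_pd_x[OF smpd(2) z])
    show "((\<lambda>y. pd_x H2 (x, y)) has_vector_derivative pd_y (pd_x H2) (x, y)) (at y)"
      by (rule smooth_on_pd_y[OF smpd(2) z])
    \<comment> \<open>The integrability condition \<open>p_y = q_x\<close> enters here.\<close>
    show "((\<lambda>x. pd_y H2 (x, y)) has_vector_derivative pd_y (pd_x H2) (x, y)) (at x)"
      unfolding pd_commute[OF \<Omega>(1) sm(2) z, symmetric] by (rule smooth_on_pd_x[OF smpd(2) z])
    show "((\<lambda>y. pd_y H2 (x, y)) has_vector_derivative pd_y (pd_y H2) (x, y)) (at y)"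
      by (rule smooth_on_pd_y[OF smpd(2) z])
    note eqs = A_eq[OF I K] B_eq[OF I K] A'_eq[OF I K] B'_eq[OF I K]
    show "A x * cnj (B y) + pd_x H2 (x, y) * cnj (pd_y H2 (x, y)) = 0"
      using xy[OF z] unfolding eqs .
    show "A x * cnj (A x) + pd_x H2 (x, y) * cnj (pd_x H2 (x, y)) = B y * cnj (B y) + pd_y H2 (x, y) * cnj (pd_y H2 (x, y))"
      using xx[OF z] yy[OF z] unfolding eqs by simp
    show "A x * cnj (A x) + pd_x H2 (x, y) * cnj (pd_x H2 (x, y)) \<noteq> 0"
      using xx[OF z] E[of "(x, y)"] e unfolding eqs by simp
    have Re: "Re (A x * cnj (A x) + pd_x H2 (x, y) * cnj (pd_x H2 (x, y))) = E (x, y) * (norm e)\<^sup>2"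
      using xx[OF z] unfolding eqs by (simp only: Re_complex_of_real)
    show "Im ((A' x + B' y) * cnj (A x) + (pd_x (pd_x H2) (x, y) + pd_y (pd_y H2) (x, y)) * cnj (pd_x H2 (x, y)))
        = - Re (A x * cnj (A x) + pd_x H2 (x, y) * cnj (pd_x H2 (x, y))) * Im (A x)"
      unfolding Re using soliton[OF z, of "(1, 0)"] unfolding eqs .
    show "Im ((A' x + B' y) * cnj (B y) + (pd_x (pd_x H2) (x, y) + pd_y (pd_y H2) (x, y)) * cnj (pd_y H2 (x, y)))
        = - Re (A x * cnj (A x) + pd_x H2 (x, y) * cnj (pd_x H2 (x, y))) * Im (B y)"
      unfolding Re using soliton[OF z, of "(0, 1)"] unfolding eqs .
  next
    fix c W0
    assume "norm W0 = 1" "soliton_ode c ?I F A" "soliton_ode (- c) ?K G B"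
      "\<And>x y. x \<in> ?I \<Longrightarrow> y \<in> ?K \<Longrightarrow> pd_x H2 (x, y) = - (W0 * (phase F x * phase G y) * cnj (B y))"
      "\<And>x y. x \<in> ?I \<Longrightarrow> y \<in> ?K \<Longrightarrow> pd_y H2 (x, y) = W0 * (phase F x * phase G y) * cnj (A x)"
    then show thesis by (rule that)
  qed
  show ?thesis
  proof (rule that[OF d sub W0])
    fix x y assume I: "x \<in> ?I" and K: "y \<in> ?K"
    note z = \<Omega>I[OF I K]
    show "herm (X (x, y)) e = F x + G y"
      using H1_eq[OF I K] by (simp add: H1_def)
    show "((\<lambda>x. herm (X (x, y)) (herm_orth e)) has_vector_derivative
       - (W0 * (phase F x * phase G y) * cnj (B y))) (at x)"
      using smooth_on_pd_x[OF sm(2) z] unfolding p[OF I K] H2_def .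
    show "((\<lambda>y. herm (X (x, y)) (herm_orth e)) has_vector_derivative
       W0 * (phase F x * phase G y) * cnj (A x)) (at y)"
      using smooth_on_pd_y[OF sm(2) z] unfolding q[OF I K] H2_def .
    \<comment> \<open>If both vanished, then so would \<open>pd_x H2\<close>, which contains the
      factor \<open>cnj (B y)\<close>, and the metric would degenerate.\<close>
    show "A x \<noteq> 0 \<or> B y \<noteq> 0"
      using xx[OF z] E[of "(x, y)"] e unfolding A_eq[OF I K] p[OF I K] by auto
  qed
qed

section \<open>Classification\<close>

lemma locally_congruent_of_diagonal_change:
  assumes M: "smooth_surface M atl" "(U, \<psi>) \<in> atl" "p \<in> U" "\<psi> p = (x0, y0)" "d > 0"
      "ball x0 d \<times> ball y0 d \<subseteq> \<psi> ` U"
    and ab: "a \<noteq> 0" "b \<noteq> 0"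
    and D: "\<And>x y. x \<in> ball x0 d \<Longrightarrow> y \<in> ball y0 d \<Longrightarrow> (a * x + h, b * y + k) \<in> D"
    and F: "rigid_motion Fr" "r > 0"
    and eq: "\<And>x y. x \<in> ball x0 d \<Longrightarrow> y \<in> ball y0 d \<Longrightarrow>
      local_rep \<phi> (U, \<psi>) (x, y) = Fr (r *\<^sub>R \<Psi> (a * x + h, b * y + k))"
  shows "locally_congruent_up_to_dilation atl \<phi> p D \<Psi>"
proof (rule locally_congruent_of_affine_change[OF M(1,2) _ M(6,3), where
      L = "\<lambda>z. (a * fst z, b * snd z)" and L' = "\<lambda>z. (fst z / a, snd z / b)" and b = "(h, k)" and r = r])
  show "linear (\<lambda>z. (a * fst z, b * snd z))" "linear (\<lambda>z. (fst z / a, snd z / b))"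
    by (rule linearI; simp add: algebra_simps add_divide_distrib)+
qed (use M(4,5) ab D F eq in \<open>auto simp: open_Times\<close>)

text \<open>For the cases in which the first parameter of the model belongs to \<open>y\<close>:
  \<open>\<alpha>\<close> arising from \<open>G\<close>, or a grim reaper only in the
  \<open>y\<close>-factor.\<close>

lemma locally_congruent_of_antidiagonal_change:
  assumes M: "smooth_surface M atl" "(U, \<psi>) \<in> atl" "p \<in> U" "\<psi> p = (x0, y0)" "d > 0"
      "ball x0 d \<times> ball y0 d \<subseteq> \<psi> ` U"
    and ab: "a \<noteq> 0" "b \<noteq> 0"
    and D: "\<And>x y. x \<in> ball x0 d \<Longrightarrow> y \<in> ball y0 d \<Longrightarrow> (a * y + h, b * x + k) \<in> D"
    and F: "rigid_motion Fr" "r > 0"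
    and eq: "\<And>x y. x \<in> ball x0 d \<Longrightarrow> y \<in> ball y0 d \<Longrightarrow>
      local_rep \<phi> (U, \<psi>) (x, y) = Fr (r *\<^sub>R \<Psi> (a * y + h, b * x + k))"
  shows "locally_congruent_up_to_dilation atl \<phi> p D \<Psi>"
proof (rule locally_congruent_of_affine_change[OF M(1,2) _ M(6,3), where
      L = "\<lambda>z. (a * snd z, b * fst z)" and L' = "\<lambda>z. (snd z / b, fst z / a)" and b = "(h, k)" and r = r])
  show "linear (\<lambda>z. (a * snd z, b * fst z))" "linear (\<lambda>z. (snd z / b, fst z / a))"
    by (rule linearI; simp add: algebra_simps add_divide_distrib)+
qed (use M(4,5) ab D F eq in \<open>auto simp: open_Times\<close>)

text \<open>The range \<open>[0, pi)\<close> covers each line through the origin once, so the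
  direction of \<open>c\<close> is determined only up to sign.\<close>

lemma nonzero_complex_polar_half:
  assumes "c \<noteq> 0"
  obtains l \<theta> :: real where "l > 0" "0 \<le> \<theta>" "\<theta> < pi"
    "c = - (complex_of_real (l\<^sup>2) * cis \<theta>) \<or> c = complex_of_real (l\<^sup>2) * cis \<theta>"
proof -
  define l where "l = sqrt (norm c)"
  have l: "l > 0" "l\<^sup>2 = norm c" using assms by (simp_all add: l_def)
  have c: "c = complex_of_real (l\<^sup>2) * cis (Arg c)"
    using rcis_cmod_Arg[of c] by (simp add: l(2) rcis_def)
  have Arg: "- pi < Arg c" "Arg c \<le> pi" by (auto simp: mpi_less_Arg Arg_le_pi)
  consider "0 \<le> Arg c" "Arg c < pi" | "Arg c = pi" | "Arg c < 0" using Arg by linarith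
  then show ?thesis
  proof cases
    case 1
    then show ?thesis using that[OF l(1)] c by blast
  next
    case 2
    then have "c = - (complex_of_real (l\<^sup>2) * cis 0)" using c by simp
    then show ?thesis using that[OF l(1), of 0] by simp
  next
    case 3
    have "cis (Arg c) = - cis (Arg c + pi)" by (simp add: cis_mult[symmetric])
    then have "c = - (complex_of_real (l\<^sup>2) * cis (Arg c + pi))" using c by simp
    then show ?thesis using that[OF l(1), of "Arg c + pi"] Arg 3 by simp
  qed
qed

text \<open>A nonzero \<open>c\<close> lets the second coordinate be integrated as a product of two
  curves; for \<open>c = 0\<close> these curves are constant and the coordinates become
  sums.\<close>

lemma classification_at_point:
  fixes \<phi> :: "'m::{t2_space, second_countable_topology} \<Rightarrow> C2" and \<psi> :: "'m \<Rightarrow> real \<times> real"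
  assumes M: "smooth_surface M atl" "(U, \<psi>) \<in> atl" "p \<in> U" "\<psi> p = (x0, y0)" "d > 0"
      "ball x0 d \<times> ball y0 d \<subseteq> \<psi> ` U"
    and e: "e \<noteq> 0" and W0: "norm W0 = 1"
    and odeF: "soliton_ode c (ball x0 d) F A" and odeG: "soliton_ode (- c) (ball y0 d) G B"
  defines "X \<equiv> local_rep \<phi> (U, \<psi>)"
  assumes H1: "\<And>x y. x \<in> ball x0 d \<Longrightarrow> y \<in> ball y0 d \<Longrightarrow> herm (X (x, y)) e = F x + G y"
    and H2x: "\<And>x y. x \<in> ball x0 d \<Longrightarrow> y \<in> ball y0 d \<Longrightarrow> ((\<lambda>x. herm (X (x, y)) (herm_orth e)) has_vector_derivative
       - (W0 * (phase F x * phase G y) * cnj (B y))) (at x)"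
    and H2y: "\<And>x y. x \<in> ball x0 d \<Longrightarrow> y \<in> ball y0 d \<Longrightarrow> ((\<lambda>y. herm (X (x, y)) (herm_orth e)) has_vector_derivative
       W0 * (phase F x * phase G y) * cnj (A x)) (at y)"
    and imm: "\<And>x y. x \<in> ball x0 d \<Longrightarrow> y \<in> ball y0 d \<Longrightarrow> A x \<noteq> 0 \<or> B y \<noteq> 0"
  shows "locally_congruent_up_to_dilation atl \<phi> p UNIV grim_line
    \<or> (\<exists>r>0. locally_congruent_up_to_dilation atl \<phi> p UNIV (grim_grim r))
    \<or> (\<exists>\<theta> \<alpha> \<omega> I1 I2 a b t0 s0. star_data \<theta> \<alpha> \<omega> I1 I2 a b t0 s0 \<and>
         locally_congruent_up_to_dilation atl \<phi> p (I1 \<times> I2) (curve_star \<theta> \<alpha> \<omega> a b t0 s0))"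
proof -
  let ?I = "ball x0 d" and ?K = "ball y0 d"
  have IK: "is_interval ?I" "is_interval ?K" "?I \<noteq> {}" "?K \<noteq> {}" "x0 \<in> ?I" "y0 \<in> ?K"
    using M(5) by (auto simp: is_interval_ball_real)
  have WW: "W0 * cnj W0 = 1" using W0 complex_norm_square[of W0] by simp
  note diag = locally_congruent_of_diagonal_change[OF M] and antidiag = locally_congruent_of_antidiagonal_change[OF M]
  show ?thesis
  proof (cases "c = 0")
    case False
    have cc: "cnj c \<noteq> 0" using False by simp
    obtain C2 where "\<And>x y. x \<in> ?I \<Longrightarrow> y \<in> ?K \<Longrightarrow> herm (X (x, y)) (herm_orth e)
        - - (W0 / cnj c) * (soliton_curve F A x * soliton_curve G B y) = C2"
    proof (rule constant_on_box_of_zero_partials[OF IK(1,2)])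
      fix x y assume xy: "x \<in> ?I" "y \<in> ?K"
      show "((\<lambda>x. herm (X (x, y)) (herm_orth e)
          - - (W0 / cnj c) * (soliton_curve F A x * soliton_curve G B y)) has_vector_derivative 0) (at x)"
        using has_vector_derivative_diff[OF H2x[OF xy] has_vector_derivative_mult_right[OF
              has_vector_derivative_mult_left[OF soliton_odeD(4)[OF odeF xy(1)], of "soliton_curve G B y"], of "- (W0 / cnj c)"]] cc
        by (simp add: soliton_curve_def[of G] mult_ac)
      show "((\<lambda>y. herm (X (x, y)) (herm_orth e)
          - - (W0 / cnj c) * (soliton_curve F A x * soliton_curve G B y)) has_vector_derivative 0) (at y)"
        using has_vector_derivative_diff[OF H2y[OF xy] has_vector_derivative_mult_right[OF
              has_vector_derivative_mult_right[OF soliton_odeD(4)[OF odeG xy(2)], of "soliton_curve F A x"], of "- (W0 / cnj c)"]] cc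
        by (simp add: soliton_curve_def[of F] mult_ac)
    qed blast
    then have H2: "herm (X (x, y)) (herm_orth e) = - (W0 / cnj c) * (soliton_curve F A x * soliton_curve G B y) + C2"
      if "x \<in> ?I" "y \<in> ?K" for x y
      using that by (metis diff_eq_eq add.commute)
    obtain l \<theta> where l: "l > 0" and \<theta>: "0 \<le> \<theta>" "\<theta> < pi"
      and c: "c = - (complex_of_real (l\<^sup>2) * cis \<theta>) \<or> c = complex_of_real (l\<^sup>2) * cis \<theta>"
      using nonzero_complex_polar_half[OF False] by blast
    \<comment> \<open>The coefficient of the second coordinate of \<open>curve_star\<close>, which
      carries a division by \<open>l\<close> squared. It is unimodular because \<open>norm c\<close>
      is \<open>l\<close> squared, so \<open>1\<close> and \<open>k\<close> form a unitary diagonal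
      matrix.\<close>
    define k where "k = - (W0 / cnj c) * complex_of_real (l\<^sup>2)"
    have "norm c = l\<^sup>2" using c l by (auto simp: norm_mult norm_power)
    then have "norm k = 1" using W0 l by (simp add: k_def norm_mult norm_divide norm_power)
    then have kk: "k * cnj k = 1" using complex_norm_square[of k] by simp
    have frame: "\<exists>Fr. rigid_motion Fr \<and> (\<forall>v w. herm v e = fst w - C1 \<longrightarrow>
        herm v (herm_orth e) = k * snd w + C2 \<longrightarrow> v = Fr ((1 / norm e) *\<^sub>R w))" for C1
    proof -
      obtain Fr where Fr: "rigid_motion Fr" "\<And>v w. herm v e = 1 * fst w + 0 * snd w + - C1 \<Longrightarrow>
        herm v (herm_orth e) = 0 * fst w + k * snd w + C2 \<Longrightarrow> v = Fr ((1 / norm e) *\<^sub>R w)"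
        by (rule rigid_motion_of_frame_coordinates[OF e, of 1 1 0 0 k "- C1" C2]) (use kk in auto)
      show ?thesis
        by (intro exI[of _ Fr] conjI allI impI Fr) simp_all
    qed
    have ne: "1 / norm e > 0" using e by simp
    from c show ?thesis
    proof
      assume c: "c = - (complex_of_real (l\<^sup>2) * cis \<theta>)"
      obtain \<alpha> \<omega> a b t0 s0 C where star: "star_data \<theta> \<alpha> \<omega> ((*) l ` ?I) ((*) l ` ?K) a b t0 s0"
        "\<And>x y. x \<in> ?I \<Longrightarrow> y \<in> ?K \<Longrightarrow> curve_star \<theta> \<alpha> \<omega> a b t0 s0 (l * x, l * y)
       = (F x + G y + C, soliton_curve F A x * soliton_curve G B y / complex_of_real (l\<^sup>2))"
        using star_data_of_soliton_ode[OF odeF[unfolded c] odeG[unfolded c minus_minus] l \<theta> IK(3,4)] by blast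
      obtain Fr where Fr: "rigid_motion Fr" "\<And>v w. herm v e = fst w - C \<Longrightarrow>
          herm v (herm_orth e) = k * snd w + C2 \<Longrightarrow> v = Fr ((1 / norm e) *\<^sub>R w)"
        using frame[of C] by blast
      have "locally_congruent_up_to_dilation atl \<phi> p ((*) l ` ?I \<times> (*) l ` ?K) (curve_star \<theta> \<alpha> \<omega> a b t0 s0)"
      proof (rule diag[OF _ _ _ Fr(1) ne, where a = l and b = l and h = 0 and k = 0])
        fix x y assume xy: "x \<in> ?I" "y \<in> ?K"
        have "X (x, y) = Fr ((1 / norm e) *\<^sub>R curve_star \<theta> \<alpha> \<omega> a b t0 s0 (l * x, l * y))"
          by (rule Fr(2)) (use l in \<open>simp_all add: star(2)[OF xy] H1[OF xy] H2[OF xy] k_def\<close>)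
        then show "local_rep \<phi> (U, \<psi>) (x, y) = Fr ((1 / norm e) *\<^sub>R curve_star \<theta> \<alpha> \<omega> a b t0 s0 (l * x + 0, l * y + 0))"
          by (simp add: X_def)
      qed (use l in auto)
      then show ?thesis using star(1) by blast
    next
      \<comment> \<open>Now \<open>G\<close> has the constant with the minus sign and supplies
        \<open>\<alpha>\<close>, so the variables are exchanged.\<close>
      assume c: "c = complex_of_real (l\<^sup>2) * cis \<theta>"
      obtain \<alpha> \<omega> a b t0 s0 C where star: "star_data \<theta> \<alpha> \<omega> ((*) l ` ?K) ((*) l ` ?I) a b t0 s0"
        "\<And>y x. y \<in> ?K \<Longrightarrow> x \<in> ?I \<Longrightarrow> curve_star \<theta> \<alpha> \<omega> a b t0 s0 (l * y, l * x)
       = (G y + F x + C, soliton_curve G B y * soliton_curve F A x / complex_of_real (l\<^sup>2))"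
        using star_data_of_soliton_ode[OF odeG[unfolded c] odeF[unfolded c] l \<theta> IK(4,3)] by blast
      obtain Fr where Fr: "rigid_motion Fr" "\<And>v w. herm v e = fst w - C \<Longrightarrow>
          herm v (herm_orth e) = k * snd w + C2 \<Longrightarrow> v = Fr ((1 / norm e) *\<^sub>R w)"
        using frame[of C] by blast
      have "locally_congruent_up_to_dilation atl \<phi> p ((*) l ` ?K \<times> (*) l ` ?I) (curve_star \<theta> \<alpha> \<omega> a b t0 s0)"
      proof (rule antidiag[OF _ _ _ Fr(1) ne, where a = l and b = l and h = 0 and k = 0])
        fix x y assume xy: "x \<in> ?I" "y \<in> ?K"
        have "X (x, y) = Fr ((1 / norm e) *\<^sub>R curve_star \<theta> \<alpha> \<omega> a b t0 s0 (l * y, l * x))"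
          by (rule Fr(2)) (use l in \<open>simp_all add: star(2)[OF xy(2,1)] H1[OF xy] H2[OF xy] k_def mult.commute\<close>)
        then show "local_rep \<phi> (U, \<psi>) (x, y) = Fr ((1 / norm e) *\<^sub>R curve_star \<theta> \<alpha> \<omega> a b t0 s0 (l * y + 0, l * x + 0))"
          by (simp add: X_def)
      qed (use l in auto)
      then show ?thesis using star(1) by blast
    qed
  next
    case True
    have odeF0: "soliton_ode 0 ?I F A" and odeG0: "soliton_ode 0 ?K G B" using odeF odeG True by simp_all
    obtain m where m: "\<And>x. x \<in> ?I \<Longrightarrow> soliton_curve F A x = m" "\<And>x. x \<in> ?I \<Longrightarrow> A x = cnj m * phase F x"
      using soliton_ode_zero[OF odeF0] by blast
    obtain n where n: "\<And>y. y \<in> ?K \<Longrightarrow> soliton_curve G B y = n" "\<And>y. y \<in> ?K \<Longrightarrow> B y = cnj n * phase G y"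
      using soliton_ode_zero[OF odeG0] by blast
    have mn: "\<forall>x\<in>?I. soliton_curve F A x = m" "\<forall>y\<in>?K. soliton_curve G B y = n"
      using m(1) n(1) by blast+
    \<comment> \<open>The common length of the columns \<open>(cnj m, - W0 * n)\<close> and
      \<open>(cnj n, W0 * m)\<close>, the directions of the two orthogonal complex lines.\<close>
    define R where "R = sqrt ((norm m)\<^sup>2 + (norm n)\<^sup>2)"
    have "m \<noteq> 0 \<or> n \<noteq> 0" using imm[OF IK(5,6)] m(2)[OF IK(5)] n(2)[OF IK(6)] by auto
    then have R: "R > 0" by (auto simp: R_def sum_power2_gt_zero_iff)
    have R2: "complex_of_real (R\<^sup>2) = m * cnj m + n * cnj n"
      by (simp add: R_def complex_norm_square[symmetric] flip: of_real_power)
    \<comment> \<open>The primitives \<open>f\<close> and \<open>g\<close> of the phases are left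
      open, since each may be a grim reaper or a line.\<close>
    have int: "\<exists>C1 C2. \<forall>x\<in>?I. \<forall>y\<in>?K. herm (X (x, y)) e = cnj m * f x + cnj n * g y + C1 \<and>
        herm (X (x, y)) (herm_orth e) = - (W0 * n) * f x + (W0 * m) * g y + C2"
      if f: "\<And>x. x \<in> ?I \<Longrightarrow> (f has_vector_derivative phase F x) (at x)"
        and g: "\<And>y. y \<in> ?K \<Longrightarrow> (g has_vector_derivative phase G y) (at y)" for f g
    proof -
      have "\<exists>C. \<forall>x\<in>?I. F x - cnj m * f x = C"
      proof (rule constant_on_interval_of_zero_derivative[OF IK(1)])
        fix x assume x: "x \<in> ?I"
        show "((\<lambda>x. F x - cnj m * f x) has_vector_derivative 0) (at x)"
          using has_vector_derivative_diff[OF soliton_odeD(1)[OF odeF0 x]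
              has_vector_derivative_mult_right[OF f[OF x], of "cnj m"]] m(2)[OF x] by simp
      qed
      then obtain CF where CF: "\<And>x. x \<in> ?I \<Longrightarrow> F x - cnj m * f x = CF" by blast
      have "\<exists>C. \<forall>y\<in>?K. G y - cnj n * g y = C"
      proof (rule constant_on_interval_of_zero_derivative[OF IK(2)])
        fix y assume y: "y \<in> ?K"
        show "((\<lambda>y. G y - cnj n * g y) has_vector_derivative 0) (at y)"
          using has_vector_derivative_diff[OF soliton_odeD(1)[OF odeG0 y]
              has_vector_derivative_mult_right[OF g[OF y], of "cnj n"]] n(2)[OF y] by simp
      qed
      then obtain CG where CG: "\<And>y. y \<in> ?K \<Longrightarrow> G y - cnj n * g y = CG" by blast
      obtain C2 where C2: "\<And>x y. x \<in> ?I \<Longrightarrow> y \<in> ?K \<Longrightarrow>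
          herm (X (x, y)) (herm_orth e) - (- (W0 * n) * f x + (W0 * m) * g y) = C2"
      proof (rule constant_on_box_of_zero_partials[OF IK(1,2)])
        fix x y assume xy: "x \<in> ?I" "y \<in> ?K"
        show "((\<lambda>x. herm (X (x, y)) (herm_orth e) - (- (W0 * n) * f x + (W0 * m) * g y)) has_vector_derivative 0) (at x)"
          using has_vector_derivative_diff[OF H2x[OF xy] has_vector_derivative_add[OF
                has_vector_derivative_mult_right[OF f[OF xy(1)], of "- (W0 * n)"] has_vector_derivative_const[of "(W0 * m) * g y"]]]
          by (simp add: n(1)[OF xy(2), symmetric] soliton_curve_def mult_ac)
        show "((\<lambda>y. herm (X (x, y)) (herm_orth e) - (- (W0 * n) * f x + (W0 * m) * g y)) has_vector_derivative 0) (at y)"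
          using has_vector_derivative_diff[OF H2y[OF xy] has_vector_derivative_add[OF
                has_vector_derivative_const[of "- (W0 * n) * f x"] has_vector_derivative_mult_right[OF g[OF xy(2)], of "W0 * m"]]]
          by (simp add: m(1)[OF xy(1), symmetric] soliton_curve_def mult_ac)
      qed blast
      have "herm (X (x, y)) e = cnj m * f x + cnj n * g y + (CF + CG)"
        "herm (X (x, y)) (herm_orth e) = - (W0 * n) * f x + (W0 * m) * g y + C2" if xy: "x \<in> ?I" "y \<in> ?K" for x y
        using H1[OF xy] CF[OF xy(1)] CG[OF xy(2)] C2[OF xy] by (auto simp: algebra_simps)
      then show ?thesis by blast
    qed
    have row: "(a * \<kappa>1) * cnj (a' * \<kappa>2) + (b * \<kappa>1) * cnj (b' * \<kappa>2) = (a * cnj a' + b * cnj b') * (\<kappa>1 * cnj \<kappa>2)"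
      for a a' b b' \<kappa>1 \<kappa>2 :: complex by (simp add: algebra_simps)
    have rows: "cnj m * cnj (cnj m) + - (W0 * n) * cnj (- (W0 * n)) = complex_of_real (R\<^sup>2)"
      "cnj n * cnj (cnj n) + (W0 * m) * cnj (W0 * m) = complex_of_real (R\<^sup>2)"
      "cnj m * cnj (cnj n) + - (W0 * n) * cnj (W0 * m) = 0"
      "cnj n * cnj (cnj m) + (W0 * m) * cnj (- (W0 * n)) = 0"
    proof -
      have "cnj m * cnj (cnj m) + - (W0 * n) * cnj (- (W0 * n)) = m * cnj m + (W0 * cnj W0) * (n * cnj n)"
        "cnj n * cnj (cnj n) + (W0 * m) * cnj (W0 * m) = n * cnj n + (W0 * cnj W0) * (m * cnj m)"
        "cnj m * cnj (cnj n) + - (W0 * n) * cnj (W0 * m) = cnj m * n * (1 - W0 * cnj W0)"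
        "cnj n * cnj (cnj m) + (W0 * m) * cnj (- (W0 * n)) = cnj n * m * (1 - W0 * cnj W0)"
        by (simp_all add: algebra_simps)
      then show "cnj m * cnj (cnj m) + - (W0 * n) * cnj (- (W0 * n)) = complex_of_real (R\<^sup>2)"
        "cnj n * cnj (cnj n) + (W0 * m) * cnj (W0 * m) = complex_of_real (R\<^sup>2)"
        "cnj m * cnj (cnj n) + - (W0 * n) * cnj (W0 * m) = 0"
        "cnj n * cnj (cnj m) + (W0 * m) * cnj (- (W0 * n)) = 0"
        unfolding R2 WW by simp_all
    qed
    have \<kappa>sq: "k * cnj k = complex_of_real (\<kappa>\<^sup>2)" if "norm k = \<kappa>" for k \<kappa>
      using complex_norm_square[of k] that by simp
    \<comment> \<open>The factors \<open>\<kappa>1\<close> and \<open>\<kappa>2\<close> convert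
      model coordinates into \<open>f\<close> and \<open>g\<close>. Their moduli must agree for the
      matrix to stay a multiple of a unitary one; \<open>prod'\<close> exchanges the model
      coordinates.\<close>
    have prod: "\<exists>Fr. rigid_motion Fr \<and> (\<forall>x\<in>?I. \<forall>y\<in>?K. \<forall>w. f x = \<kappa>1 * fst w \<longrightarrow> g y = \<kappa>2 * snd w \<longrightarrow>
          X (x, y) = Fr ((R * \<kappa> / norm e) *\<^sub>R w))"
      and prod': "\<exists>Fr. rigid_motion Fr \<and> (\<forall>x\<in>?I. \<forall>y\<in>?K. \<forall>w. f x = \<kappa>1 * snd w \<longrightarrow> g y = \<kappa>2 * fst w \<longrightarrow>
          X (x, y) = Fr ((R * \<kappa> / norm e) *\<^sub>R w))"
      if f: "\<And>x. x \<in> ?I \<Longrightarrow> (f has_vector_derivative phase F x) (at x)"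
        and g: "\<And>y. y \<in> ?K \<Longrightarrow> (g has_vector_derivative phase G y) (at y)"
        and \<kappa>: "norm \<kappa>1 = \<kappa>" "norm \<kappa>2 = \<kappa>" "\<kappa> > 0" for f g \<kappa>1 \<kappa>2 \<kappa>
    proof -
      obtain C1 C2 where C: "\<And>x y. x \<in> ?I \<Longrightarrow> y \<in> ?K \<Longrightarrow> herm (X (x, y)) e = cnj m * f x + cnj n * g y + C1"
        "\<And>x y. x \<in> ?I \<Longrightarrow> y \<in> ?K \<Longrightarrow> herm (X (x, y)) (herm_orth e) = - (W0 * n) * f x + (W0 * m) * g y + C2"
        using int[OF f g] by blast
      have R\<kappa>: "R * \<kappa> > 0" using R \<kappa>(3) by simp
      have sq: "complex_of_real (R\<^sup>2) * complex_of_real (\<kappa>\<^sup>2) = complex_of_real ((R * \<kappa>)\<^sup>2)"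
        by (simp add: power_mult_distrib)
      obtain Fr where Fr: "rigid_motion Fr" "\<And>v w. herm v e = (cnj m * \<kappa>1) * fst w + (cnj n * \<kappa>2) * snd w + C1 \<Longrightarrow>
          herm v (herm_orth e) = (- (W0 * n) * \<kappa>1) * fst w + ((W0 * m) * \<kappa>2) * snd w + C2 \<Longrightarrow>
          v = Fr ((R * \<kappa> / norm e) *\<^sub>R w)"
        by (rule rigid_motion_of_frame_coordinates[OF e R\<kappa>, of "cnj m * \<kappa>1" "- (W0 * n) * \<kappa>1" "cnj n * \<kappa>2" "(W0 * m) * \<kappa>2" C1 C2])
          (unfold row rows \<kappa>sq[OF \<kappa>(1)] \<kappa>sq[OF \<kappa>(2)] sq, simp_all)
      show "\<exists>Fr. rigid_motion Fr \<and> (\<forall>x\<in>?I. \<forall>y\<in>?K. \<forall>w. f x = \<kappa>1 * fst w \<longrightarrow> g y = \<kappa>2 * snd w \<longrightarrow>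
          X (x, y) = Fr ((R * \<kappa> / norm e) *\<^sub>R w))"
        by (intro exI[of _ Fr] conjI ballI allI impI Fr) (simp_all add: C)
      obtain Fr where Fr: "rigid_motion Fr" "\<And>v w. herm v e = (cnj n * \<kappa>2) * fst w + (cnj m * \<kappa>1) * snd w + C1 \<Longrightarrow>
          herm v (herm_orth e) = ((W0 * m) * \<kappa>2) * fst w + (- (W0 * n) * \<kappa>1) * snd w + C2 \<Longrightarrow>
          v = Fr ((R * \<kappa> / norm e) *\<^sub>R w)"
        by (rule rigid_motion_of_frame_coordinates[OF e R\<kappa>, of "cnj n * \<kappa>2" "(W0 * m) * \<kappa>2" "cnj m * \<kappa>1" "- (W0 * n) * \<kappa>1" C1 C2])
          (unfold row rows \<kappa>sq[OF \<kappa>(1)] \<kappa>sq[OF \<kappa>(2)] sq, simp_all)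
      show "\<exists>Fr. rigid_motion Fr \<and> (\<forall>x\<in>?I. \<forall>y\<in>?K. \<forall>w. f x = \<kappa>1 * snd w \<longrightarrow> g y = \<kappa>2 * fst w \<longrightarrow>
          X (x, y) = Fr ((R * \<kappa> / norm e) *\<^sub>R w))"
        by (intro exI[of _ Fr] conjI ballI allI impI Fr) (simp_all add: C)
    qed
    have line: "((\<lambda>t. u * complex_of_real (t - t0)) has_vector_derivative u) (at t)" for u t0 t
      using has_vector_derivative_mult_right[of "\<lambda>t. complex_of_real (t - t0)" 1 "at t" u]
        has_vector_derivative_of_real[of "\<lambda>t. t - t0" 1 "at t"] by (auto intro!: derivative_eq_intros)
    show ?thesis
    proof (cases rule: soliton_ode_zero_cases[OF odeF0 mn(1), case_names line grim])
      case f: (grim \<sigma> k)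
      have fg: "norm (1 / cnj m) = 1 / norm m" "1 / norm m > 0" using f(1) by (simp_all add: norm_divide)
      have r: "R * (1 / norm m) / norm e > 0" using R f(1) e by simp
      have \<sigma>: "\<sigma> * norm m \<noteq> 0" using f(1,2) by auto
      show ?thesis
      proof (cases rule: soliton_ode_zero_cases[OF odeG0 mn(2), case_names line grim])
        case g: (grim \<tau> j)
        \<comment> \<open>The factors are grim reapers of sizes \<open>1 / norm m\<close> and
          \<open>1 / norm n\<close>; their ratio, which no dilation changes, is the parameter of
          \<open>grim_grim\<close>.\<close>
        define q where "q = norm m / norm n"
        have q: "q > 0" using f(1) g(1) by (simp add: q_def)
        have "norm (1 / (cnj n * complex_of_real q)) = 1 / norm m"
          using g(1) f(1) by (simp add: q_def norm_divide norm_mult)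
        from prod[OF f(3) g(3) fg(1) this fg(2)] obtain Fr where Fr: "rigid_motion Fr"
          "\<And>x y w. x \<in> ?I \<Longrightarrow> y \<in> ?K \<Longrightarrow> grim_reaper (\<sigma> * (norm m * x + k)) / cnj m = (1 / cnj m) * fst w \<Longrightarrow>
             grim_reaper (\<tau> * (norm n * y + j)) / cnj n = (1 / (cnj n * complex_of_real q)) * snd w \<Longrightarrow>
             X (x, y) = Fr ((R * (1 / norm m) / norm e) *\<^sub>R w)" by blast
        have "locally_congruent_up_to_dilation atl \<phi> p UNIV (grim_grim q)"
        proof (rule diag[OF \<sigma> _ _ Fr(1) r, where b = "\<tau> * norm n" and h = "\<sigma> * k" and k = "\<tau> * j"])
          fix x y assume xy: "x \<in> ?I" "y \<in> ?K"
          show "local_rep \<phi> (U, \<psi>) (x, y) = Fr ((R * (1 / norm m) / norm e) *\<^sub>R grim_grim q (\<sigma> * norm m * x + \<sigma> * k, \<tau> * norm n * y + \<tau> * j))"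
            unfolding X_def[symmetric]
            by (rule Fr(2)[OF xy]) (use q in \<open>simp_all add: grim_grim_def scaleR_conv_of_real distrib_left mult.assoc\<close>)
        qed (use g(1,2) in auto)
        then show ?thesis using q by blast
      next
        case g: (line u)
        have dg: "((\<lambda>t. u * complex_of_real (t - 0)) has_vector_derivative phase G y) (at y)" if "y \<in> ?K" for y
          using line[of u 0 y] g(2)[OF that] by simp
        \<comment> \<open>A line has no scale of its own: its parameter is stretched by
          \<open>norm m\<close> to match the modulus of the grim reaper factor.\<close>
        have "norm (u / complex_of_real (norm m)) = 1 / norm m" using g(1) by (simp add: norm_divide)
        from prod[OF f(3) dg fg(1) this fg(2)] obtain Fr where Fr: "rigid_motion Fr"
          "\<And>x y w. x \<in> ?I \<Longrightarrow> y \<in> ?K \<Longrightarrow> grim_reaper (\<sigma> * (norm m * x + k)) / cnj m = (1 / cnj m) * fst w \<Longrightarrow>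
             u * complex_of_real (y - 0) = (u / complex_of_real (norm m)) * snd w \<Longrightarrow>
             X (x, y) = Fr ((R * (1 / norm m) / norm e) *\<^sub>R w)" by blast
        have "locally_congruent_up_to_dilation atl \<phi> p UNIV grim_line"
        proof (rule diag[OF \<sigma> _ _ Fr(1) r, where b = "norm m" and h = "\<sigma> * k" and k = 0])
          fix x y assume xy: "x \<in> ?I" "y \<in> ?K"
          show "local_rep \<phi> (U, \<psi>) (x, y) = Fr ((R * (1 / norm m) / norm e) *\<^sub>R grim_line (\<sigma> * norm m * x + \<sigma> * k, norm m * y + 0))"
            unfolding X_def[symmetric]
            by (rule Fr(2)[OF xy]) (use f(1) in \<open>simp_all add: grim_line_def distrib_left mult.assoc\<close>)
        qed (use f(1) in auto)
        then show ?thesis by blast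
      qed
    next
      case f: (line v)
      show ?thesis
      proof (cases rule: soliton_ode_zero_cases[OF odeG0 mn(2), case_names line grim])
        case g: (grim \<tau> j)
        have df: "((\<lambda>t. v * complex_of_real (t - 0)) has_vector_derivative phase F x) (at x)" if "x \<in> ?I" for x
          using line[of v 0 x] f(2)[OF that] by simp
        have fg: "norm (1 / cnj n) = 1 / norm n" "1 / norm n > 0" using g(1) by (simp_all add: norm_divide)
        have r: "R * (1 / norm n) / norm e > 0" using R g(1) e by simp
        have \<tau>: "\<tau> * norm n \<noteq> 0" using g(1,2) by auto
        have "norm (v / complex_of_real (norm n)) = 1 / norm n" using f(1) by (simp add: norm_divide)
        from prod'[OF df g(3) this fg] obtain Fr where Fr: "rigid_motion Fr"
          "\<And>x y w. x \<in> ?I \<Longrightarrow> y \<in> ?K \<Longrightarrow> v * complex_of_real (x - 0) = (v / complex_of_real (norm n)) * snd w \<Longrightarrow>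
             grim_reaper (\<tau> * (norm n * y + j)) / cnj n = (1 / cnj n) * fst w \<Longrightarrow>
             X (x, y) = Fr ((R * (1 / norm n) / norm e) *\<^sub>R w)" by blast
        have "locally_congruent_up_to_dilation atl \<phi> p UNIV grim_line"
        proof (rule antidiag[OF \<tau> _ _ Fr(1) r, where b = "norm n" and h = "\<tau> * j" and k = 0])
          fix x y assume xy: "x \<in> ?I" "y \<in> ?K"
          show "local_rep \<phi> (U, \<psi>) (x, y) = Fr ((R * (1 / norm n) / norm e) *\<^sub>R grim_line (\<tau> * norm n * y + \<tau> * j, norm n * x + 0))"
            unfolding X_def[symmetric]
            by (rule Fr(2)[OF xy]) (use g(1) in \<open>simp_all add: grim_line_def distrib_left mult.assoc\<close>)
        qed (use g(1) in auto)
        then show ?thesis by blast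
      next
        case g: (line u)
        \<comment> \<open>The shift by \<open>1 / 2\<close> puts the base point at
          \<open>(1 / 2, 0)\<close> in the plane, away from the branch point at the origin.\<close>
        have df: "((\<lambda>t. v * complex_of_real (t - (x0 - 1 / 2))) has_vector_derivative phase F x) (at x)" if "x \<in> ?I" for x
          using line[of v "x0 - 1 / 2" x] f(2)[OF that] by simp
        have dg: "((\<lambda>t. u * complex_of_real (t - y0)) has_vector_derivative phase G y) (at y)" if "y \<in> ?K" for y
          using line[of u y0 y] g(2)[OF that] by simp
        from prod[OF df dg f(1) g(1) zero_less_one] obtain Fr where Fr: "rigid_motion Fr"
          "\<And>x y w. x \<in> ?I \<Longrightarrow> y \<in> ?K \<Longrightarrow> v * complex_of_real (x - (x0 - 1 / 2)) = v * fst w \<Longrightarrow>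
             u * complex_of_real (y - y0) = u * snd w \<Longrightarrow> X (x, y) = Fr ((R * 1 / norm e) *\<^sub>R w)" by blast
        \<comment> \<open>The half space where the square root is a chart; it contains the base
          point, where the expression is \<open>1\<close>.\<close>
        define Bx where "Bx = (?I \<times> ?K) \<inter> {z. 2 * (fst z - x0) + 1 > 0}"
        have Bx: "open Bx"
          unfolding Bx_def by (intro open_Int open_Times open_ball open_Collect_less continuous_intros)
        have Bx_pos: "Bx \<subseteq> {z. 2 * (fst z - x0) + 1 > 0}" by (auto simp: Bx_def)
        let ?\<Psi> = "curve_star 0 of_real of_real (\<lambda>t. 0) (\<lambda>t. 0) 0 0"
        obtain T T' where T: "smooth_on Bx T" "open (T ` Bx)" "smooth_on (T ` Bx) T'" "\<And>z. z \<in> Bx \<Longrightarrow> T' (T z) = z"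
          "\<And>x y. (x, y) \<in> Bx \<Longrightarrow> ?\<Psi> (T (x, y)) = (complex_of_real (x - x0 + 1 / 2), complex_of_real (y - y0))"
          using plane_chart[OF Bx Bx_pos, of y0] by blast
        have "locally_congruent_up_to_dilation atl \<phi> p (UNIV \<times> UNIV) ?\<Psi>"
        proof (rule locally_congruent_of_chart_change[OF M(1,2) Bx _ M(3) _ T(1-4) _ Fr(1), where r = "R * 1 / norm e"])
          fix z assume z: "z \<in> Bx"
          obtain x y where xy: "z = (x, y)" by (cases z)
          show "local_rep \<phi> (U, \<psi>) z = Fr ((R * 1 / norm e) *\<^sub>R ?\<Psi> (T z))"
            unfolding X_def[symmetric] xy
            by (rule Fr(2)) (use z in \<open>simp_all add: xy T(5) Bx_def algebra_simps\<close>)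
        qed (use M(4-6) R e in \<open>auto simp: Bx_def\<close>)
        then show ?thesis using star_data_plane by blast
      qed
    qed
  qed
qed

theorem theorem1:
  fixes M :: "'m::{t2_space, second_countable_topology} set"
    and atl :: "'m chart set"
    and \<phi> :: "'m \<Rightarrow> C2"
    and e :: C2
    and U :: "'m set"
    and \<psi> :: "'m \<Rightarrow> real \<times> real"
  assumes "smooth_surface M atl"
    and "lagrangian_immersion atl \<phi>"
    and "translating_soliton atl \<phi> e"
    and "(U, \<psi>) \<in> atl"
    and "isothermal \<phi> (U, \<psi>)"
    and "\<forall>z\<in>chart_dom (U, \<psi>). pd_x (pd_y (local_rep (\<lambda>q. herm (\<phi> q) e) (U, \<psi>))) z = 0"
  shows "(\<forall>p\<in>U.
            locally_congruent_up_to_dilation atl \<phi> p UNIV grim_line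
          \<or> (\<exists>r>0. locally_congruent_up_to_dilation atl \<phi> p UNIV (grim_grim r))
          \<or> (\<exists>\<theta> \<alpha> \<omega> I1 I2 a b t0 s0.
               0 \<le> \<theta> \<and> \<theta> < pi \<and>
               unit_speed_curve I1 \<alpha> \<and> unit_speed_curve I2 \<omega> \<and>
               (\<forall>t\<in>I1. curvature_vector \<alpha> t =
                  - cos \<theta> *\<^sub>R curve_perp \<alpha> t (\<alpha> t) + sin \<theta> *\<^sub>R curve_perp \<alpha> t (\<i> * \<alpha> t)) \<and>
               (\<forall>s\<in>I2. curvature_vector \<omega> s =
                  cos \<theta> *\<^sub>R curve_perp \<omega> s (\<omega> s) - sin \<theta> *\<^sub>R curve_perp \<omega> s (\<i> * \<omega> s)) \<and>
               continuous_arg I1 (velocity \<alpha>) a \<and> continuous_arg I2 (velocity \<omega>) b \<and>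
               t0 \<in> I1 \<and> s0 \<in> I2 \<and>
               locally_congruent_up_to_dilation atl \<phi> p (I1 \<times> I2) (curve_star \<theta> \<alpha> \<omega> a b t0 s0)))
       \<and> congruent_up_to_dilation
           (\<lambda>(s1, s2). (grim_reaper s1 + grim_reaper s2, grim_reaper s1 - grim_reaper s2))
           (grim_grim 1)"
proof (intro conjI ballI)
  fix p assume p: "p \<in> U"
  let ?X = "local_rep \<phi> (U, \<psi>)"
  have chart: "is_chart M (U, \<psi>)" using assms(1,4) by (auto simp: smooth_surface_def)
  have X: "smooth_on (\<psi> ` U) ?X"
    using assms(2,4) by (force simp: lagrangian_immersion_def immersion_def simp del: local_rep.simps)
  have lag: "\<forall>z\<in>\<psi> ` U. \<forall>v w. kaehler (pd v ?X z) (pd w ?X z) = 0"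
    using assms(2,4) unfolding lagrangian_immersion_def by (metis chart_dom.simps)
  have sol: "\<forall>z\<in>\<psi> ` U. mean_curvature ?X z = normal_component (tangent_plane ?X z) e"
    using assms(3,4) unfolding translating_soliton_def by (metis chart_dom.simps)
  have e: "e \<noteq> 0" using assms(3) by (simp add: translating_soliton_def)
  obtain u where iso: "\<forall>z\<in>\<psi> ` U. metric ?X z (1,0) (1,0) = exp (2 * u z) \<and> metric ?X z (0,1) (0,1) = exp (2 * u z) \<and>
      metric ?X z (1,0) (0,1) = 0"
    using assms(5) unfolding isothermal_def by (metis chart_dom.simps)
  have sep: "\<forall>z\<in>\<psi> ` U. pd_x (pd_y (\<lambda>z. herm (?X z) e)) z = 0"
    using assms(6) by (simp add: comp_def)
  obtain x0 y0 where xy0: "\<psi> p = (x0, y0)" by (cases "\<psi> p")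
  then have z0: "(x0, y0) \<in> \<psi> ` U" using p by (metis imageI)
  have classified: "locally_congruent_up_to_dilation atl \<phi> p UNIV grim_line
    \<or> (\<exists>r>0. locally_congruent_up_to_dilation atl \<phi> p UNIV (grim_grim r))
    \<or> (\<exists>\<theta> \<alpha> \<omega> I1 I2 a b t0 s0. star_data \<theta> \<alpha> \<omega> I1 I2 a b t0 s0 \<and>
         locally_congruent_up_to_dilation atl \<phi> p (I1 \<times> I2) (curve_star \<theta> \<alpha> \<omega> a b t0 s0))"
  proof (rule lagrangian_soliton_integration[OF is_chart_props(3)[OF chart] z0 X e iso lag sol sep])
    fix d c W0 F G A B
    assume I: "d > 0" "ball x0 d \<times> ball y0 d \<subseteq> \<psi> ` U" "norm W0 = 1"
      "soliton_ode c (ball x0 d) F A" "soliton_ode (- c) (ball y0 d) G B"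
      "\<And>x y. x \<in> ball x0 d \<Longrightarrow> y \<in> ball y0 d \<Longrightarrow> herm (?X (x, y)) e = F x + G y"
      "\<And>x y. x \<in> ball x0 d \<Longrightarrow> y \<in> ball y0 d \<Longrightarrow> ((\<lambda>x. herm (?X (x, y)) (herm_orth e)) has_vector_derivative
         - (W0 * (phase F x * phase G y) * cnj (B y))) (at x)"
      "\<And>x y. x \<in> ball x0 d \<Longrightarrow> y \<in> ball y0 d \<Longrightarrow> ((\<lambda>y. herm (?X (x, y)) (herm_orth e)) has_vector_derivative
         W0 * (phase F x * phase G y) * cnj (A x)) (at y)"
      "\<And>x y. x \<in> ball x0 d \<Longrightarrow> y \<in> ball y0 d \<Longrightarrow> A x \<noteq> 0 \<or> B y \<noteq> 0"
    show ?thesis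
      by (rule classification_at_point[OF assms(1,4) p xy0 I(1,2) e I(3-5)]; rule I(6-9); assumption)
  qed
  show "locally_congruent_up_to_dilation atl \<phi> p UNIV grim_line
          \<or> (\<exists>r>0. locally_congruent_up_to_dilation atl \<phi> p UNIV (grim_grim r))
          \<or> (\<exists>\<theta> \<alpha> \<omega> I1 I2 a b t0 s0.
               0 \<le> \<theta> \<and> \<theta> < pi \<and>
               unit_speed_curve I1 \<alpha> \<and> unit_speed_curve I2 \<omega> \<and>
               (\<forall>t\<in>I1. curvature_vector \<alpha> t =
                  - cos \<theta> *\<^sub>R curve_perp \<alpha> t (\<alpha> t) + sin \<theta> *\<^sub>R curve_perp \<alpha> t (\<i> * \<alpha> t)) \<and>
               (\<forall>s\<in>I2. curvature_vector \<omega> s =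
                  cos \<theta> *\<^sub>R curve_perp \<omega> s (\<omega> s) - sin \<theta> *\<^sub>R curve_perp \<omega> s (\<i> * \<omega> s)) \<and>
               continuous_arg I1 (velocity \<alpha>) a \<and> continuous_arg I2 (velocity \<omega>) b \<and>
               t0 \<in> I1 \<and> s0 \<in> I2 \<and>
               locally_congruent_up_to_dilation atl \<phi> p (I1 \<times> I2) (curve_star \<theta> \<alpha> \<omega> a b t0 s0))"
    using classified unfolding star_data_def conj_assoc .
qed (rule congruent_sum_difference)

end
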